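(* Let $T>0$, let $\lambda:[0,1]\times[0,1]\to(0,\infty)$ be a positive function with continuous partial derivatives in both coordinates, and let $\{X_t^N\}_{t\ge 0}$ be the generalized $N$-urn Ehrenfest process with rate function $\lambda$. Assume that for every $N\ge 1$ the variables $\{X_0^N(i)\}_{i=1}^N$ are independent and $X_0^N(i)$ is Poisson distributed with mean $\phi(i/N)$, where $\phi\in C[0,1]$. Let $\mu^N=\{\mu_t^N\}_{0\le t\le T}$ with $\mu_t^N(dx)=\frac1N\sum_{i=1}^N X_t^N(i)\,\delta_{i/N}(dx)$, a random element of $D([0,T],\mathcal{S})$. Then, as $N\to\infty$, $\mu^N$ converges weakly (in distribution) to the unique $\mu=\{\mu_t\}_{0\le t\le T}\in D([0,T],\mathcal{S})$ such that for all $0\le t\le T$ and $f\in C[0,1]$, $$\mu_t(f)=\int_0^1 f(x)\phi(x)\,dx+\int_0^t\mu_s\big((P_1-P_2)f\big)\,ds .$$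
   Context: The generalized $N$-urn Ehrenfest process with rate function $\lambda$ is the continuous-time Markov process $\{X_t^N\}_{t\ge0}$ on $X=\{0,1,2,\dots\}^N$ with generator $$\mathcal{L}_Nf(x)=\sum_{i=1}^N\sum_{j=1}^N\frac{x(i)\lambda(\frac iN,\frac jN)}{N}\big(f(x^{i,j})-f(x)\big),$$ where $x^{i,i}=x$ and, for $i\ne j$, $x^{i,j}$ is obtained from $x$ by replacing $x(i)$ by $x(i)-1$ and $x(j)$ by $x(j)+1$. (Each ball independently moves from box $i$ to box $j$ at rate $\lambda(i/N,j/N)/N$; $X_t^N(i)$ is the number of balls in box $i$ at time $t$.) $\mathcal{S}$ is the dual of $C[0,1]$ with the topology in which $\mathscr{A}_n\to\mathscr{A}$ iff $\mathscr{A}_n(f)\to\mathscr{A}(f)$ for every $f\in C[0,1]$. A bounded signed measure $\mathfrak{m}$ on $[0,1]$ is identified with the element $f\mapsto\int f\,d\mathfrak{m}$ of $\mathcal{S}$. $D([0,T],\mathcal{S})$ is the Skorokhod space of càdlàg functions $[0,T]\to\mathcal{S}$. $P_1,P_2:C[0,1]\to C[0,1]$ are the linear operators $(P_1f)(x)=\int_0^1\lambda(x,y)f(y)\,dy$ and $(P_2f)(x)=f(x)\int_0^1\lambda(x,y)\,dy$. A $\mu$ satisfying the displayed integral identity is called a weak solution of $\frac{d}{dt}\mu_t=(P_1^*-P_2^* )\mu_t$, $\mu_0(dx)=\phi(x)dx$; it exists and is unique. *)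

theory Defs
  imports "HOL-Probability.Probability"
begin

section \<open>The interval [0,1] as a metric space, C[0,1] and its dual\<close>

typedef unit_interval = "{0..1::real}"
  morphisms coord pt
  by (rule exI[of _ 0]) simp

instantiation unit_interval :: metric_space
begin

definition dist_unit_interval :: "unit_interval \<Rightarrow> unit_interval \<Rightarrow> real"
  where "dist_unit_interval u v = dist (coord u) (coord v)"

definition uniformity_unit_interval :: "(unit_interval \<times> unit_interval) filter"
  where "uniformity_unit_interval = (INF e\<in>{0<..}. principal {(u, v). dist u v < e})"

definition open_unit_interval :: "unit_interval set \<Rightarrow> bool"
  where "open_unit_interval S = (\<forall>u\<in>S. \<forall>\<^sub>F (u', v) in uniformity. u' = u \<longrightarrow> v \<in> S)"

instance
proof
  fix u v w :: unit_interval
  show "dist u v = 0 \<longleftrightarrow> u = v"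
    by (simp add: dist_unit_interval_def coord_inject)
  show "dist u v \<le> dist u w + dist v w"
    unfolding dist_unit_interval_def by (rule dist_triangle2)
qed (rule open_unit_interval_def uniformity_unit_interval_def)+

end

lemma coord_pt [simp]: "0 \<le> x \<Longrightarrow> x \<le> 1 \<Longrightarrow> coord (pt x) = x"
  by (simp add: pt_inverse)

lemma coord_ge_0 [simp]: "0 \<le> coord u" and coord_le_1 [simp]: "coord u \<le> 1"
  using coord[of u] by auto

lemma continuous_on_coord: "continuous_on UNIV coord"
  by (auto simp: continuous_on_iff dist_unit_interval_def)

lemma continuous_on_pt: "continuous_on {0..1} pt"
  by (auto simp: continuous_on_iff dist_unit_interval_def)

text \<open>As \<open>[0,1]\<close> is compact, the bounded continuous functions on it are all of \<open>C[0,1]\<close>, and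
  the type \<open>C01\<close> carries the supremum norm.\<close>

type_synonym C01 = "unit_interval \<Rightarrow>\<^sub>C real"

lemma bcontfun_unit_intervalI:
  assumes "continuous_on {0..1} g"
  shows "(\<lambda>u. g (coord u) :: real) \<in> bcontfun"
proof -
  have r: "range coord = {0..1}"
    by (simp add: type_definition.Rep_range[OF type_definition_unit_interval])
  have c: "continuous_on UNIV (\<lambda>u. g (coord u))"
    by (rule continuous_on_compose2[OF assms continuous_on_coord]) (simp add: r)
  have "range (\<lambda>u. g (coord u)) = g ` {0..1}"
    using r by (metis image_image)
  moreover have "bounded (g ` {0..1})"
    using assms compact_continuous_image compact_imp_bounded by blast
  ultimately show ?thesis
    using c by (simp add: bcontfun_def)
qed

type_synonym dual_C01 = "C01 \<Rightarrow>\<^sub>L real"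

text \<open>The type \<open>dual_C01\<close> itself carries the operator norm. The topology used below is the
  weak-* topology: that of pointwise convergence of functionals on \<open>C[0,1]\<close>.\<close>

definition weak_star :: "dual_C01 topology"
  where "weak_star = pullback_topology UNIV blinfun_apply euclidean"

lemma topspace_weak_star [simp]: "topspace weak_star = UNIV"
  by (simp add: weak_star_def topspace_pullback_topology)

lemma limitin_weak_star:
  "limitin weak_star A a F \<longleftrightarrow> (\<forall>f. ((\<lambda>n. blinfun_apply (A n) f) \<longlongrightarrow> blinfun_apply a f) F)"
proof -
  have "limitin weak_star A a F \<longleftrightarrow> ((\<lambda>n. blinfun_apply (A n)) \<longlongrightarrow> blinfun_apply a) F"
    (is "?L \<longleftrightarrow> ?R")
  proof
    assume ?L
    show ?R
    proof (rule topological_tendstoI)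
      fix S :: "(C01 \<Rightarrow> real) set"
      assume S: "open S" "blinfun_apply a \<in> S"
      then have "openin weak_star (blinfun_apply -` S)" "a \<in> blinfun_apply -` S"
        by (auto simp: weak_star_def openin_pullback_topology)
      with \<open>?L\<close> have "\<forall>\<^sub>F n in F. A n \<in> blinfun_apply -` S"
        by (simp only: limitin_def)
      then show "\<forall>\<^sub>F n in F. blinfun_apply (A n) \<in> S"
        by (simp only: vimage_eq)
    qed
  next
    assume R: ?R
    show ?L
      unfolding limitin_def
    proof (intro conjI allI impI)
      show "a \<in> topspace weak_star" by simp
      fix U assume "openin weak_star U \<and> a \<in> U"
      then obtain S where "open S" "U = blinfun_apply -` S" "blinfun_apply a \<in> S"
        by (auto simp: weak_star_def openin_pullback_topology)
      with topological_tendstoD[OF R] show "\<forall>\<^sub>F n in F. A n \<in> U"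
        by (simp only: vimage_eq)
    qed
  qed
  also have "\<dots> \<longleftrightarrow> (\<forall>f. ((\<lambda>n. blinfun_apply (A n) f) \<longlongrightarrow> blinfun_apply a f) F)"
    using limitin_componentwise[of "\<lambda>_. euclidean :: real topology" UNIV
        "\<lambda>n. blinfun_apply (A n)" "blinfun_apply a" F]
    by (simp add: euclidean_product_topology)
  finally show ?thesis .
qed

definition functional_of_measure :: "unit_interval measure \<Rightarrow> dual_C01"
  where "functional_of_measure m = Blinfun (\<lambda>f. \<integral>u. apply_bcontfun f u \<partial>m)"

definition dirac :: "real \<Rightarrow> dual_C01"
  where "dirac x = functional_of_measure (return borel (pt x))"

lemma dirac_apply [simp]: "blinfun_apply (dirac x) f = apply_bcontfun f (pt x)"
proof -
  have i: "(\<integral>u. apply_bcontfun g u \<partial>return borel (pt x)) = apply_bcontfun g (pt x)" for g :: C01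
    by (rule integral_return) (auto intro: borel_measurable_continuous_onI)
  have "bounded_linear (\<lambda>g::C01. apply_bcontfun g (pt x))"
  proof (rule bounded_linear_intro[where K = 1])
    fix g :: C01
    show "norm (apply_bcontfun g (pt x)) \<le> norm g * 1"
      using norm_bounded[of g] by simp
  qed (simp_all add: plus_bcontfun.rep_eq scaleR_bcontfun.rep_eq)
  then show ?thesis
    unfolding dirac_def functional_of_measure_def i by (simp add: bounded_linear_Blinfun_apply)
qed


section \<open>The space of cadlag paths with values in the dual, with the Skorokhod topology\<close>

definition cadlag_paths :: "real \<Rightarrow> (real \<Rightarrow> dual_C01) set"
  where "cadlag_paths T = {\<xi> \<in> extensional {0..T}.
    (\<forall>t\<in>{0..<T}. limitin weak_star \<xi> (\<xi> t) (at_right t)) \<and>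
    (\<forall>t\<in>{0<..T}. \<exists>l. limitin weak_star \<xi> l (at_left t))}"

definition time_changes :: "real \<Rightarrow> (real \<Rightarrow> real) set"
  where "time_changes T = {\<tau>. continuous_on {0..T} \<tau> \<and> strict_mono_on {0..T} \<tau> \<and> \<tau> ` {0..T} = {0..T}}"

text \<open>The weak-* topology is not metrizable; it is the locally convex topology of the seminorms
  \<open>A \<mapsto> max {\<bar>A f\<bar> | f \<in> F}\<close> with \<open>F\<close> a finite subset of \<open>C[0,1]\<close>. The Skorokhod topology
  is the one given by the Skorokhod distances with respect to these seminorms (Mitoma,
  Jakubowski). Note that a single time change serves all \<open>f \<in> F\<close>.\<close>

definition skorokhod_nbhd :: "real \<Rightarrow> (real \<Rightarrow> dual_C01) \<Rightarrow> C01 set \<Rightarrow> real \<Rightarrow> (real \<Rightarrow> dual_C01) set"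
  where "skorokhod_nbhd T \<xi> F \<epsilon> = {\<eta> \<in> cadlag_paths T. \<exists>\<tau>\<in>time_changes T. \<forall>t\<in>{0..T}.
    \<bar>\<tau> t - t\<bar> < \<epsilon> \<and> (\<forall>f\<in>F. \<bar>blinfun_apply (\<xi> t) f - blinfun_apply (\<eta> (\<tau> t)) f\<bar> < \<epsilon>)}"

definition skorokhod_open :: "real \<Rightarrow> (real \<Rightarrow> dual_C01) set \<Rightarrow> bool"
  where "skorokhod_open T U \<longleftrightarrow> U \<subseteq> cadlag_paths T \<and>
    (\<forall>\<xi>\<in>U. \<exists>F \<epsilon>. finite F \<and> 0 < \<epsilon> \<and> skorokhod_nbhd T \<xi> F \<epsilon> \<subseteq> U)"

definition skorokhod :: "real \<Rightarrow> (real \<Rightarrow> dual_C01) topology"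
  where "skorokhod T = topology (skorokhod_open T)"

lemma skorokhod_nbhd_mono:
  assumes "F \<subseteq> G" "\<delta> \<le> \<epsilon>"
  shows "skorokhod_nbhd T \<xi> G \<delta> \<subseteq> skorokhod_nbhd T \<xi> F \<epsilon>"
proof
  fix \<eta> assume "\<eta> \<in> skorokhod_nbhd T \<xi> G \<delta>"
  then obtain \<tau> where 1: "\<eta> \<in> cadlag_paths T" "\<tau> \<in> time_changes T"
    and 2: "\<forall>t\<in>{0..T}. \<bar>\<tau> t - t\<bar> < \<delta> \<and>
      (\<forall>f\<in>G. \<bar>blinfun_apply (\<xi> t) f - blinfun_apply (\<eta> (\<tau> t)) f\<bar> < \<delta>)"
    by (auto simp: skorokhod_nbhd_def)
  have "\<forall>t\<in>{0..T}. \<bar>\<tau> t - t\<bar> < \<epsilon> \<and>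
      (\<forall>f\<in>F. \<bar>blinfun_apply (\<xi> t) f - blinfun_apply (\<eta> (\<tau> t)) f\<bar> < \<epsilon>)"
    using 2 assms by (meson less_le_trans subsetD)
  with 1 show "\<eta> \<in> skorokhod_nbhd T \<xi> F \<epsilon>"
    by (auto simp: skorokhod_nbhd_def)
qed

lemma istopology_skorokhod_open: "istopology (skorokhod_open T)"
  unfolding istopology_def
proof (intro conjI allI impI)
  fix U V assume U: "skorokhod_open T U" and V: "skorokhod_open T V"
  show "skorokhod_open T (U \<inter> V)"
    unfolding skorokhod_open_def
  proof (intro conjI ballI)
    show "U \<inter> V \<subseteq> cadlag_paths T"
      using U by (auto simp: skorokhod_open_def)
    fix \<xi> assume "\<xi> \<in> U \<inter> V"
    then obtain F \<delta> G \<epsilon> where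
      "finite F" "0 < \<delta>" "skorokhod_nbhd T \<xi> F \<delta> \<subseteq> U"
      "finite G" "0 < \<epsilon>" "skorokhod_nbhd T \<xi> G \<epsilon> \<subseteq> V"
      using U V unfolding skorokhod_open_def by (meson IntD1 IntD2)
    moreover have "skorokhod_nbhd T \<xi> (F \<union> G) (min \<delta> \<epsilon>) \<subseteq> skorokhod_nbhd T \<xi> F \<delta>"
      "skorokhod_nbhd T \<xi> (F \<union> G) (min \<delta> \<epsilon>) \<subseteq> skorokhod_nbhd T \<xi> G \<epsilon>"
      by (intro skorokhod_nbhd_mono; simp)+
    ultimately show "\<exists>H \<epsilon>'. finite H \<and> 0 < \<epsilon>' \<and> skorokhod_nbhd T \<xi> H \<epsilon>' \<subseteq> U \<inter> V"
      by (intro exI[of _ "F \<union> G"] exI[of _ "min \<delta> \<epsilon>"]) auto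
  qed
next
  fix K assume K: "\<forall>U\<in>K. skorokhod_open T U"
  show "skorokhod_open T (\<Union>K)"
    unfolding skorokhod_open_def
  proof (intro conjI ballI)
    show "\<Union>K \<subseteq> cadlag_paths T"
      using K by (auto simp: skorokhod_open_def)
    fix \<xi> assume "\<xi> \<in> \<Union>K"
    then obtain U where "U \<in> K" "\<xi> \<in> U" by blast
    then show "\<exists>F \<epsilon>. finite F \<and> 0 < \<epsilon> \<and> skorokhod_nbhd T \<xi> F \<epsilon> \<subseteq> \<Union>K"
      using K unfolding skorokhod_open_def by (meson Sup_upper order_trans)
  qed
qed

lemma openin_skorokhod: "openin (skorokhod T) U \<longleftrightarrow> skorokhod_open T U"
  by (simp add: skorokhod_def istopology_skorokhod_open topology_inverse')

lemma topspace_skorokhod [simp]: "topspace (skorokhod T) = cadlag_paths T"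
proof -
  have "skorokhod_open T (cadlag_paths T)"
    unfolding skorokhod_open_def
    by (intro conjI ballI exI[of _ "{}"] exI[of _ 1]) (auto simp: skorokhod_nbhd_def)
  then show ?thesis
    unfolding topspace_def openin_skorokhod by (auto simp: skorokhod_open_def)
qed


section \<open>Weak convergence of laws on a topological space\<close>

definition borel_of :: "'a topology \<Rightarrow> 'a measure"
  where "borel_of X = sigma (topspace X) {U. openin X U}"

definition converges_weakly :: "'a topology \<Rightarrow> (nat \<Rightarrow> 'a measure) \<Rightarrow> 'a measure \<Rightarrow> bool"
  where "converges_weakly X P Q \<longleftrightarrow>
    (\<forall>G. continuous_map X euclideanreal G \<and> bounded (G ` topspace X) \<longrightarrow>
      (\<lambda>n. \<integral>x. G x \<partial>P n) \<longlonglongrightarrow> (\<integral>x. G x \<partial>Q))"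


section \<open>Continuous-time Markov chains on a countable state space\<close>

definition transition_semigroup :: "'s set \<Rightarrow> (real \<Rightarrow> 's \<Rightarrow> 's pmf) \<Rightarrow> bool"
  where "transition_semigroup E p \<longleftrightarrow>
    (\<forall>t\<ge>0. \<forall>x\<in>E. set_pmf (p t x) \<subseteq> E) \<and>
    (\<forall>x\<in>E. p 0 x = return_pmf x) \<and>
    (\<forall>s\<ge>0. \<forall>t\<ge>0. \<forall>x\<in>E. p (s + t) x = bind_pmf (p s x) (p t))"

definition has_generator :: "'s set \<Rightarrow> (real \<Rightarrow> 's \<Rightarrow> 's pmf) \<Rightarrow> (('s \<Rightarrow> real) \<Rightarrow> 's \<Rightarrow> real) \<Rightarrow> bool"
  where "has_generator E p L \<longleftrightarrow>
    (\<forall>f. bounded (f ` E) \<longrightarrow> (\<forall>x\<in>E.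
      ((\<lambda>t. (measure_pmf.expectation (p t x) f - f x) / t) \<longlongrightarrow> L f x) (at_right 0)))"

text \<open>The Markov property is expressed by the finite-dimensional distributions. Paths are
  cadlag with respect to the discrete topology of the state space.\<close>

definition markov_process ::
    "'s set \<Rightarrow> (('s \<Rightarrow> real) \<Rightarrow> 's \<Rightarrow> real) \<Rightarrow> 'w measure \<Rightarrow> (real \<Rightarrow> 'w \<Rightarrow> 's) \<Rightarrow> bool"
  where "markov_process E L M X \<longleftrightarrow>
    prob_space M \<and>
    (\<forall>t\<ge>0. X t \<in> measurable M (count_space E)) \<and>
    (\<forall>\<omega>\<in>space M. \<forall>t\<ge>0. \<forall>\<^sub>F s in at_right t. X s \<omega> = X t \<omega>) \<and>
    (\<forall>\<omega>\<in>space M. \<forall>t>0. \<exists>x. \<forall>\<^sub>F s in at_left t. X s \<omega> = x) \<and>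
    (\<exists>p. transition_semigroup E p \<and> has_generator E p L \<and>
      (\<forall>n t x. 0 \<le> t 0 \<and> (\<forall>k<n. t k \<le> t (Suc k)) \<and> (\<forall>k\<le>n. x k \<in> E) \<longrightarrow>
        measure M {\<omega> \<in> space M. \<forall>k\<le>n. X (t k) \<omega> = x k} =
        measure M {\<omega> \<in> space M. X (t 0) \<omega> = x 0} *
          (\<Prod>k<n. pmf (p (t (Suc k) - t k) (x k)) (x (Suc k)))))"


section \<open>The generalized N-urn Ehrenfest process\<close>

definition urn_states :: "nat \<Rightarrow> (nat \<Rightarrow> nat) set"
  where "urn_states N = {1..N} \<rightarrow>\<^sub>E UNIV"

text \<open>If \<open>x i = 0\<close>, the subtraction truncates, but then the move has rate \<open>0\<close>.\<close>

definition move_ball :: "nat \<Rightarrow> nat \<Rightarrow> (nat \<Rightarrow> nat) \<Rightarrow> nat \<Rightarrow> nat"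
  where "move_ball i j x = (if i = j then x else x(i := x i - 1, j := x j + 1))"

definition ehrenfest_generator ::
    "nat \<Rightarrow> (real \<Rightarrow> real \<Rightarrow> real) \<Rightarrow> ((nat \<Rightarrow> nat) \<Rightarrow> real) \<Rightarrow> (nat \<Rightarrow> nat) \<Rightarrow> real"
  where "ehrenfest_generator N lam f x =
    (\<Sum>i=1..N. \<Sum>j=1..N. real (x i) * lam (real i / real N) (real j / real N) / real N *
      (f (move_ball i j x) - f x))"

definition ehrenfest_process ::
    "nat \<Rightarrow> (real \<Rightarrow> real \<Rightarrow> real) \<Rightarrow> 'w measure \<Rightarrow> (real \<Rightarrow> 'w \<Rightarrow> nat \<Rightarrow> nat) \<Rightarrow> bool"
  where "ehrenfest_process N lam M X \<longleftrightarrow>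
    markov_process (urn_states N) (ehrenfest_generator N lam) M X"

definition empirical_functional :: "nat \<Rightarrow> (nat \<Rightarrow> nat) \<Rightarrow> dual_C01"
  where "empirical_functional N x =
    (1 / real N) *\<^sub>R (\<Sum>i=1..N. real (x i) *\<^sub>R dirac (real i / real N))"

definition empirical_path :: "real \<Rightarrow> nat \<Rightarrow> (real \<Rightarrow> 'w \<Rightarrow> nat \<Rightarrow> nat) \<Rightarrow> 'w \<Rightarrow> real \<Rightarrow> dual_C01"
  where "empirical_path T N X \<omega> = (\<lambda>t\<in>{0..T}. empirical_functional N (X t \<omega>))"

text \<open>The library's \<open>poisson_pmf\<close> is only specified for positive rates; here mean \<open>0\<close> is
  allowed and gives the point mass at \<open>0\<close>, since \<open>0 ^ 0 = 1\<close>.\<close>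

definition poisson_distributed :: "'w measure \<Rightarrow> ('w \<Rightarrow> nat) \<Rightarrow> real \<Rightarrow> bool"
  where "poisson_distributed M Y m \<longleftrightarrow> 0 \<le> m \<and> Y \<in> measurable M (count_space UNIV) \<and>
    (\<forall>k. measure M {\<omega> \<in> space M. Y \<omega> = k} = exp (- m) * m ^ k / fact k)"


section \<open>The limiting equation\<close>

text \<open>Derivatives at the boundary of the square are one-sided; the partial derivatives are
  continuous jointly in both variables.\<close>

definition C1_on_square :: "(real \<Rightarrow> real \<Rightarrow> real) \<Rightarrow> bool"
  where "C1_on_square lam \<longleftrightarrow> (\<exists>D1 D2.
    continuous_on ({0..1} \<times> {0..1}) (\<lambda>(x, y). D1 x y) \<and>
    continuous_on ({0..1} \<times> {0..1}) (\<lambda>(x, y). D2 x y) \<and>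
    (\<forall>x\<in>{0..1}. \<forall>y\<in>{0..1}.
      ((\<lambda>u. lam u y) has_real_derivative D1 x y) (at x within {0..1}) \<and>
      ((\<lambda>v. lam x v) has_real_derivative D2 x y) (at y within {0..1})))"

definition P1 :: "(real \<Rightarrow> real \<Rightarrow> real) \<Rightarrow> C01 \<Rightarrow> C01"
  where "P1 lam f = Bcontfun (\<lambda>u. integral {0..1} (\<lambda>y. lam (coord u) y * apply_bcontfun f (pt y)))"

definition P2 :: "(real \<Rightarrow> real \<Rightarrow> real) \<Rightarrow> C01 \<Rightarrow> C01"
  where "P2 lam f = Bcontfun (\<lambda>u. apply_bcontfun f u * integral {0..1} (\<lambda>y. lam (coord u) y))"

lemma continuous_on_bcontfun_pt: "continuous_on {0..1} (\<lambda>y. apply_bcontfun (f :: C01) (pt y))"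
  by (rule continuous_on_compose2[OF continuous_on_apply_bcontfun[of UNIV] continuous_on_pt]) simp

lemma P1_apply:
  assumes "continuous_on ({0..1} \<times> {0..1}) (\<lambda>(x, y). lam x y)"
  shows "apply_bcontfun (P1 lam f) u = integral {0..1} (\<lambda>y. lam (coord u) y * apply_bcontfun f (pt y))"
proof -
  have "continuous_on ({0..1} \<times> {0..1}) (\<lambda>z. lam (fst z) (snd z) * apply_bcontfun f (pt (snd z)))"
    using assms
  proof (intro continuous_on_mult)
    show "continuous_on ({0..1} \<times> {0..1}) (\<lambda>z. apply_bcontfun f (pt (snd z)))"
      by (rule continuous_on_compose2[OF continuous_on_bcontfun_pt continuous_on_snd[OF continuous_on_id]])
        auto
  qed (simp add: case_prod_beta)
  then have "continuous_on {0..1} (\<lambda>x. integral (cbox 0 1) (\<lambda>y. lam x y * apply_bcontfun f (pt y)))"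
    by (intro integral_continuous_on_param) (simp add: case_prod_beta)
  then show ?thesis
    unfolding P1_def by (subst Bcontfun_inverse) (auto dest: bcontfun_unit_intervalI)
qed

lemma P2_apply:
  assumes "continuous_on ({0..1} \<times> {0..1}) (\<lambda>(x, y). lam x y)"
  shows "apply_bcontfun (P2 lam f) u = apply_bcontfun f u * integral {0..1} (\<lambda>y. lam (coord u) y)"
proof -
  have "continuous_on {0..1} (\<lambda>x. integral (cbox 0 1) (\<lambda>y. lam x y))"
    using assms by (intro integral_continuous_on_param) simp
  then have "continuous_on {0..1} (\<lambda>x. apply_bcontfun f (pt x) * integral {0..1} (\<lambda>y. lam x y))"
    using continuous_on_bcontfun_pt by (intro continuous_on_mult) auto
  from bcontfun_unit_intervalI[OF this]
  show ?thesis
    unfolding P2_def by (subst Bcontfun_inverse) (auto simp: coord_inverse)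
qed

definition weak_solution ::
    "(real \<Rightarrow> real \<Rightarrow> real) \<Rightarrow> C01 \<Rightarrow> real \<Rightarrow> (real \<Rightarrow> dual_C01) \<Rightarrow> bool"
  where "weak_solution lam \<phi> T \<mu> \<longleftrightarrow> (\<forall>t\<in>{0..T}. \<forall>f.
    blinfun_apply (\<mu> t) f =
      integral {0..1} (\<lambda>x. apply_bcontfun f (pt x) * apply_bcontfun \<phi> (pt x)) +
      integral {0..t} (\<lambda>s. blinfun_apply (\<mu> s) (P1 lam f - P2 lam f)))"

end

theory Submission
  imports Defs
begin

text \<open>The generator of the process preserves the finite set of configurations with a given number of
  balls and acts on functions that are linear in the configuration through a bounded operator
  \<open>A\<^sub>N\<close> on \<open>N\<close>-vectors, the discretisation of \<open>A = P\<^sub>1 - P\<^sub>2\<close>. Hence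
  \<open>\<mu>\<^sub>s\<^sup>N(exp((t - s) A\<^sub>N) f)\<close> is a martingale in \<open>s \<le> t\<close>, and since the balls are
  independent its variance is of order \<open>1/N\<close>. Doob's maximal inequality thus controls it uniformly in
  \<open>s \<le> t\<close>; its initial value converges to \<open>\<mu>\<^sub>t(f)\<close> by Chebyshev's inequality for the Poisson
  weights and Riemann sums. Since \<open>exp((t - s) A\<^sub>N) f\<close> is within \<open>O(t - s)\<close> of \<open>f\<close>,
  finitely many horizons \<open>t\<close> give uniform convergence in probability of \<open>\<mu>\<^sup>N(f)\<close> to the
  continuous limit \<open>\<mu>(f)\<close> on \<open>[0,T]\<close>, which puts the path in any given Skorokhod
  neighbourhood of \<open>\<mu>\<close>. The limit itself is the power series with coefficients
  \<open>\<integral>\<phi> A\<^sup>n f / n!\<close>, and uniqueness follows by iterating the integral equation, the norms being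
  bounded by the uniform boundedness principle.\<close>


section \<open>Power series of exponential type\<close>

text \<open>Because the limit law is a point mass, a bounded continuous functional has to be
  examined only near one path. That path is continuous, so uniform closeness for finitely many test
  functions already gives Skorokhod closeness, with the identity as time change. The hypotheses
  present the generator only as a derivative at time 0 of the semigroup on bounded functions, while
  linear functions of the configuration are unbounded. Fixing the number of balls leaves a finite
  closed set, on which the Kolmogorov equation can be derived by hand. The random number of balls
  returns at the end as a sum over initial states, cut off at (norm of phi + 1) times N.
  Exponentials of operators enter only through scalar series with coefficients a_n / n!, where a_n
  is a functional of the n-th iterate. All of them obey a bound C (2 Lambda)^n that is uniform in N,
  so convergence of the single coefficients suffices. Suprema over time and the non-metrizable path
  space raise measurability questions; exceptional events are therefore covered by measurable sets
  and never measured themselves.\<close>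

definition exp_series :: "(nat \<Rightarrow> real) \<Rightarrow> real \<Rightarrow> real"
  where "exp_series a t = (\<Sum>n. t ^ n / fact n * a n)"

text \<open>\<open>K\<close> bounds an operator and \<open>C\<close> the size of a functional times
  that of a test vector. All later instances have \<open>K = 2 * \<Lambda>\<close>.\<close>

definition exp_type :: "real \<Rightarrow> real \<Rightarrow> (nat \<Rightarrow> real) \<Rightarrow> bool"
  where "exp_type C K a \<longleftrightarrow> 0 \<le> C \<and> 0 \<le> K \<and> (\<forall>n. \<bar>a n\<bar> \<le> C * K ^ n)"

lemma exp_type_bound_summable: "summable (\<lambda>n. C * ((K * t) ^ n / fact n))" for K t :: real
  using summable_mult[OF summable_exp[of "K * t"], of C] by (simp add: divide_inverse mult_ac)

lemma exp_type_term_le: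
  assumes "exp_type C K a"
  shows "norm (t ^ n / fact n * a n) \<le> C * ((K * \<bar>t\<bar>) ^ n / fact n)"
proof -
  have "norm (t ^ n / fact n * a n) = \<bar>t\<bar> ^ n / fact n * \<bar>a n\<bar>"
    by (simp add: abs_mult power_abs)
  also have "\<dots> \<le> \<bar>t\<bar> ^ n / fact n * (C * K ^ n)"
    using assms by (intro mult_left_mono) (auto simp: exp_type_def)
  finally show ?thesis by (simp add: power_mult_distrib mult_ac)
qed

lemma exp_series_summable:
  assumes "exp_type C K a"
  shows "summable (\<lambda>n. t ^ n / fact n * a n)"
  by (rule summable_comparison_test'[OF exp_type_bound_summable exp_type_term_le[OF assms]])

lemma exp_series_bound:
  assumes "exp_type C K a"
  shows "\<bar>exp_series a t\<bar> \<le> C * exp (K * \<bar>t\<bar>)"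
proof -
  have "\<bar>exp_series a t\<bar> \<le> (\<Sum>n. C * ((K * \<bar>t\<bar>) ^ n / fact n))"
    unfolding exp_series_def real_norm_def[symmetric]
    using norm_suminf_le[OF exp_type_term_le[OF assms] exp_type_bound_summable] by simp
  also have "\<dots> = C * exp (K * \<bar>t\<bar>)"
    using exp_type_bound_summable[of 1 K "\<bar>t\<bar>"]
    by (subst suminf_mult) (auto simp: exp_def divide_inverse mult_ac)
  finally show ?thesis .
qed

lemma exp_type_shift:
  assumes "exp_type C K a"
  shows "exp_type (C * K) K (\<lambda>n. a (Suc n))"
  using assms by (auto simp: exp_type_def mult_ac) (metis mult.assoc mult.commute power_Suc)

text \<open>If \<open>a n\<close> is a functional of the n-th iterate of an operator, the shifted
  sequence belongs to one more application of it. This is thus the linear differential equation of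
  the flow.\<close>

lemma exp_series_has_derivative:
  assumes a: "exp_type C K a"
  shows "(exp_series a has_real_derivative exp_series (\<lambda>n. a (Suc n)) t) (at t)"
proof -
  define c where "c n = a n / fact n" for n
  have "summable (\<lambda>n. c n * y ^ n)" for y
    using exp_series_summable[OF a, of y] by (simp add: c_def mult_ac)
  from termdiffs_strong_converges_everywhere[OF this]
  have "((\<lambda>x. \<Sum>n. c n * x ^ n) has_real_derivative (\<Sum>n. diffs c n * t ^ n)) (at t)" .
  moreover have "(\<lambda>x. \<Sum>n. c n * x ^ n) = exp_series a"
    unfolding exp_series_def c_def by (simp add: mult_ac)
  moreover have "diffs c n = a (Suc n) / fact n" for n
    by (simp add: diffs_def c_def field_simps del: of_nat_Suc)
  ultimately show ?thesis unfolding exp_series_def by (simp add: mult_ac)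
qed

lemma exp_series_0: "exp_series a 0 = a 0"
proof -
  have "exp_series a 0 = (\<Sum>n\<in>{0}. 0 ^ n / fact n * a n)"
    unfolding exp_series_def by (rule suminf_finite) auto
  then show ?thesis by simp
qed

lemma exp_series_linear:
  assumes "exp_type C K a" "exp_type C' K' b"
  shows "exp_series (\<lambda>n. x * a n + y * b n) t = x * exp_series a t + y * exp_series b t"
proof -
  have "(\<lambda>n. t ^ n / fact n * (x * a n + y * b n)) sums (x * exp_series a t + y * exp_series b t)"
    unfolding distrib_left mult.left_commute[of _ x] mult.left_commute[of _ y] exp_series_def
    by (intro sums_add sums_mult summable_sums exp_series_summable[OF assms(1)] exp_series_summable[OF assms(2)])
  then show ?thesis unfolding exp_series_def by (simp add: sums_iff)
qed

lemma exp_series_sum: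
  assumes "finite I" "\<And>i. i \<in> I \<Longrightarrow> exp_type (C i) (K i) (a i)"
  shows "exp_series (\<lambda>n. \<Sum>i\<in>I. x i * a i n) t = (\<Sum>i\<in>I. x i * exp_series (a i) t)"
proof -
  have "(\<lambda>n. \<Sum>i\<in>I. x i * (t ^ n / fact n * a i n)) sums (\<Sum>i\<in>I. x i * exp_series (a i) t)"
    unfolding exp_series_def
    by (intro sums_sum sums_mult summable_sums exp_series_summable[OF assms(2)])
  then show ?thesis unfolding exp_series_def by (simp add: sums_iff sum_distrib_left mult_ac)
qed

lemma exp_series_increment:
  assumes a: "exp_type C K a" and t: "0 \<le> t"
  shows "\<bar>exp_series a t - a 0\<bar> \<le> t * (C * K * exp (K * t))"
proof (cases "t = 0")
  case False
  then obtain z where z: "0 < z" "z < t"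
    "exp_series a t - exp_series a 0 = (t - 0) * exp_series (\<lambda>n. a (Suc n)) z"
    using MVT2[of 0 t "exp_series a" "exp_series (\<lambda>n. a (Suc n))"] exp_series_has_derivative[OF a] t
    by (metis order_le_less)
  have "\<bar>exp_series (\<lambda>n. a (Suc n)) z\<bar> \<le> C * K * exp (K * \<bar>z\<bar>)"
    by (rule exp_series_bound[OF exp_type_shift[OF a]])
  also have "\<dots> \<le> C * K * exp (K * t)"
    using a z unfolding exp_type_def by (intro mult_left_mono) (auto intro: mult_left_mono)
  finally show ?thesis using z t by (simp add: exp_series_0 abs_mult mult_left_mono)
qed (simp add: exp_series_0)

text \<open>Dominated convergence for series (Tannery): the dominating terms are free of
  \<open>N\<close>, so nothing about the speed of convergence in \<open>n\<close> is asked. The case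
  \<open>N = 0\<close> is left out because the grid \<open>i / N\<close> is meaningless
  there.\<close>

lemma tendsto_exp_series:
  fixes a :: "nat \<Rightarrow> nat \<Rightarrow> real"
  assumes a: "\<And>N. 1 \<le> N \<Longrightarrow> exp_type C K (a N)"
    and lim: "\<And>n. (\<lambda>N. a N n) \<longlonglongrightarrow> b n"
  shows "(\<lambda>N. exp_series (a N) t) \<longlonglongrightarrow> exp_series b t"
proof -
  have "((\<lambda>N. \<Sum>n. t ^ n / fact n * a N n) \<longlongrightarrow> (\<Sum>n. t ^ n / fact n * b n)) sequentially"
  proof (rule tannerys_theorem[THEN conjunct2, THEN conjunct2])
    show "((\<lambda>N. t ^ k / fact k * a N k) \<longlongrightarrow> t ^ k / fact k * b k) sequentially" for k
      by (intro tendsto_intros lim)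
    show "\<forall>\<^sub>F (k, N) in at_top \<times>\<^sub>F sequentially.
        norm (t ^ k / fact k * a N k) \<le> C * ((K * \<bar>t\<bar>) ^ k / fact k)"
      unfolding eventually_prod_sequentially
      by (intro exI[of _ 1]) (use exp_type_term_le[OF a] in auto)
  qed (use exp_type_bound_summable in auto)
  then show ?thesis unfolding exp_series_def .
qed


section \<open>Uniform boundedness and regulated functions\<close>

text \<open>Sokal's elementary proof of the uniform boundedness principle.\<close>

lemma blinfun_large_on_ball:
  fixes T :: "'a::real_normed_vector \<Rightarrow>\<^sub>L 'b::real_normed_vector"
  assumes r: "0 < r" and c: "c < norm T"
  shows "\<exists>y. norm (y - x) \<le> r \<and> r * c \<le> norm (T y)"
proof (cases "c < 0")
  case True
  then have "r * c \<le> 0" using r by (simp add: mult_nonneg_nonpos)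
  then show ?thesis using r by (intro exI[of _ x]) (auto intro: order_trans)
next
  case False
  obtain z where z: "c * norm z < norm (T z)"
    using norm_blinfun_bound[of c T] c False by (metis linorder_not_less)
  then have "norm z > 0" by (metis blinfun.zero_right mult_zero_right norm_zero order_less_irrefl zero_less_norm_iff)
  define w where "w = (r / norm z) *\<^sub>R z"
  have w: "norm w = r" unfolding w_def using \<open>norm z > 0\<close> r by simp
  have "r * c = r / norm z * (c * norm z)" using \<open>norm z > 0\<close> by simp
  also have "\<dots> \<le> r / norm z * norm (T z)" using z r by (intro mult_left_mono) auto
  also have "\<dots> = norm (T w)" unfolding w_def using r by (simp add: blinfun.scaleR_right)
  finally have Tw: "r * c \<le> norm (T w)" .
  \<comment> \<open>Whatever \<open>T x\<close> is, one of the two opposite points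
    \<open>x + w\<close> and \<open>x - w\<close> has an image at least as large as that of
    \<open>w\<close>.\<close>
  have "2 *\<^sub>R T w = T (x + w) - T (x - w)"
    by (simp add: blinfun.add_right blinfun.diff_right scaleR_2)
  then have "2 * norm (T w) = norm (T (x + w) - T (x - w))"
    by (metis abs_numeral norm_scaleR)
  also have "\<dots> \<le> norm (T (x + w)) + norm (T (x - w))" by (rule norm_triangle_ineq4)
  finally have "r * c \<le> norm (T (x + w)) \<or> r * c \<le> norm (T (x - w))"
    using Tw by linarith
  then show ?thesis
    using w by (auto intro: exI[of _ "x + w"] exI[of _ "x - w"])
qed

text \<open>Operators with norms above 4^n are met by steps of length at most 3^-n. Step
  \<open>n\<close> reaches an image of size 2/3 of 3^-n times the norm. The remaining steps add up
  to at most 1/2 of 3^-n and destroy at most 1/2 of the same quantity, so at least 1/6 of (4/3)^n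
  survives at the limit point.\<close>

lemma banach_steinhaus:
  fixes A :: "'i \<Rightarrow> 'a::banach \<Rightarrow>\<^sub>L 'b::real_normed_vector"
  assumes pointwise: "\<And>x. \<exists>B. \<forall>i\<in>I. norm (A i x) \<le> B"
  shows "\<exists>B. \<forall>i\<in>I. norm (A i) \<le> B"
proof (rule ccontr)
  assume "\<nexists>B. \<forall>i\<in>I. norm (A i) \<le> B"
  then have "\<exists>i\<in>I. 4 ^ n < norm (A i)" for n :: nat by (meson linorder_not_less)
  then obtain i where i: "\<And>n. i n \<in> I" "\<And>n :: nat. 4 ^ n < norm (A (i n))" by metis
  define good where "good n x y \<longleftrightarrow> norm (y - x) \<le> (1/3) ^ n \<and>
    (1/3) ^ n * (2/3 * norm (A (i n))) \<le> norm (A (i n) y)" for n :: nat and x y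
  have ex: "\<exists>y. good n x y" for n x
    unfolding good_def
  proof (rule blinfun_large_on_ball)
    have "0 < norm (A (i n))" using i(2)[of n] by (meson less_trans zero_less_numeral zero_less_power)
    then show "2/3 * norm (A (i n)) < norm (A (i n))" by simp
  qed simp
  define x where "x = rec_nat 0 (\<lambda>n y. SOME z. good n y z)"
  have x: "good n (x n) (x (Suc n))" for n
    unfolding x_def using someI_ex[OF ex] by simp
  have sg: "summable (\<lambda>k. (1/3 :: real) ^ (k + m))" for m
    using summable_geometric[of "1/3 :: real"] by (subst summable_iff_shift) auto
  have summ: "summable (\<lambda>k. norm (x (Suc (k + m)) - x (k + m)))" for m
    by (rule summable_comparison_test'[OF sg[of m]]) (use x in \<open>auto simp: good_def\<close>)
  have lim: "(\<lambda>k. x (Suc (k + m)) - x (k + m)) sums (\<Sum>k. x (Suc (k + m)) - x (k + m))" for m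
    by (intro summable_sums summable_norm_cancel[OF summ])
  define z where "z = x 0 + (\<Sum>k. x (Suc (k + 0)) - x (k + 0))"
  have zx: "z - x m = (\<Sum>k. x (Suc (k + m)) - x (k + m))" for m
  proof -
    have "(\<Sum>k. x (Suc k) - x k) = (\<Sum>k. x (Suc (k + m)) - x (k + m)) + (\<Sum>k<m. x (Suc k) - x k)"
      using suminf_split_initial_segment[of "\<lambda>k. x (Suc k) - x k" m] lim[of 0]
      by (simp add: sums_iff)
    then show ?thesis by (simp add: z_def sum_lessThan_telescope algebra_simps)
  qed
  have dist: "norm (z - x (Suc n)) \<le> 1/2 * (1/3) ^ n" for n
  proof -
    have "norm (z - x (Suc n)) \<le> (\<Sum>k. (1/3) ^ (k + Suc n))"
      unfolding zx
      by (rule norm_suminf_le[OF _ sg]) (use x[unfolded good_def] in blast)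
    also have "\<dots> = 1/2 * (1/3) ^ n"
      using sums_mult2[OF geometric_sums[of "1/3 :: real"], of "(1/3) ^ Suc n"]
      by (simp add: power_add sums_iff mult_ac)
    finally show ?thesis .
  qed
  obtain B where B: "\<And>n. norm (A (i n) z) \<le> B" using pointwise[of z] i(1) by blast
  have "1/6 * (4/3) ^ n \<le> B" for n :: nat
  proof -
    define a where "a = norm (A (i n))"
    have "(1/3) ^ n * (2/3 * a) \<le> norm (A (i n) (x (Suc n)))"
      using x[of n] by (simp add: good_def a_def)
    also have "\<dots> = norm (A (i n) z - A (i n) (z - x (Suc n)))" by (simp add: blinfun.diff_right)
    also have "\<dots> \<le> norm (A (i n) z) + norm (A (i n) (z - x (Suc n)))" by (rule norm_triangle_ineq4)
    also have "\<dots> \<le> B + a * (1/2 * (1/3) ^ n)"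
      unfolding a_def by (intro add_mono B order_trans[OF norm_blinfun] mult_left_mono dist) simp
    finally have "1/6 * ((1/3) ^ n * a) \<le> B" by (simp add: algebra_simps)
    moreover have "(4/3) ^ n \<le> (1/3) ^ n * a"
    proof -
      have "(4/3 :: real) ^ n = (1/3) ^ n * 4 ^ n" by (simp add: power_mult_distrib[symmetric])
      also have "\<dots> \<le> (1/3) ^ n * a" unfolding a_def using i(2)[of n] by (intro mult_left_mono) auto
      finally show ?thesis .
    qed
    ultimately show ?thesis by linarith
  qed
  moreover obtain n where "6 * B < (4/3 :: real) ^ n" using real_arch_pow[of "4/3" "6 * B"] by auto
  ultimately have "1/6 * (4/3) ^ n \<le> B" "6 * B < (4/3) ^ n" by blast+
  then show False by linarith
qed

text \<open>Near each time \<open>p\<close> the function is within \<open>e\<close> of one that is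
  constant to the left of \<open>p\<close> and equal to \<open>f p\<close> from \<open>p\<close> on.
  The compactness principle \<open>Bolzano\<close> glues these pieces, and uniform limits of
  integrable functions are integrable. It is applied to the scalar paths of a cadlag
  functional-valued path, which is why right continuity stops before \<open>T\<close>.\<close>

lemma regulated_integrable_bounded:
  fixes f :: "real \<Rightarrow> real"
  assumes right: "\<And>t. 0 \<le> t \<Longrightarrow> t < T \<Longrightarrow> (f \<longlongrightarrow> f t) (at_right t)"
    and left: "\<And>t. 0 < t \<Longrightarrow> t \<le> T \<Longrightarrow> \<exists>l. (f \<longlongrightarrow> l) (at_left t)"
    and T: "0 \<le> T"
  shows "f integrable_on {0..T}" and "\<exists>B. \<forall>t\<in>{0..T}. \<bar>f t\<bar> \<le> B"
proof -
  have key: "\<exists>g B. g integrable_on {0..T} \<and> (\<forall>t\<in>{0..T}. \<bar>f t - g t\<bar> \<le> e \<and> \<bar>f t\<bar> \<le> B)" if e: "0 < e" for e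
  proof -
    define P where "P a b \<longleftrightarrow> (0 \<le> a \<and> b \<le> T \<longrightarrow>
      (\<exists>g B. g integrable_on {a..b} \<and> (\<forall>t\<in>{a..b}. \<bar>f t - g t\<bar> \<le> e \<and> \<bar>f t\<bar> \<le> B)))" for a b
    have "P 0 T"
      using T
    proof (induction rule: Bolzano)
      case (trans a b c)
      show ?case
        unfolding P_def
      proof
        assume "0 \<le> a \<and> c \<le> T"
        then have "0 \<le> a" "b \<le> T" "0 \<le> b" "c \<le> T" using trans(3,4) by auto
        from trans(1) \<open>0 \<le> a\<close> \<open>b \<le> T\<close> obtain g B where
          g: "g integrable_on {a..b}" "\<And>t. t \<in> {a..b} \<Longrightarrow> \<bar>f t - g t\<bar> \<le> e \<and> \<bar>f t\<bar> \<le> B"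
          unfolding P_def by blast
        from trans(2) \<open>0 \<le> b\<close> \<open>c \<le> T\<close> obtain h C where
          h: "h integrable_on {b..c}" "\<And>t. t \<in> {b..c} \<Longrightarrow> \<bar>f t - h t\<bar> \<le> e \<and> \<bar>f t\<bar> \<le> C"
          unfolding P_def by blast
        define k where "k t = (if t \<le> b then g t else h t)" for t
        have "k integrable_on {a..b}"
          by (rule integrable_eq[OF g(1)]) (auto simp: k_def)
        moreover have "k integrable_on {b..c}"
          by (rule integrable_spike_finite[OF _ _ h(1), of "{b}"]) (auto simp: k_def)
        ultimately have "k integrable_on {a..c}"
          using Henstock_Kurzweil_Integration.integrable_combine[of a b c k] trans(3,4) by blast
        moreover have "\<bar>f t - k t\<bar> \<le> e \<and> \<bar>f t\<bar> \<le> max B C" if "t \<in> {a..c}" for t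
          using g(2)[of t] h(2)[of t] that by (cases "t \<le> b") (auto simp: k_def)
        ultimately show "\<exists>g B. g integrable_on {a..c} \<and> (\<forall>t\<in>{a..c}. \<bar>f t - g t\<bar> \<le> e \<and> \<bar>f t\<bar> \<le> B)"
          by blast
      qed
    next
      case (local p)
      have "\<exists>d>0. p < T \<longrightarrow> (\<forall>s. p < s \<and> s < p + d \<longrightarrow> \<bar>f s - f p\<bar> < e)"
      proof (cases "p < T")
        case True
        have "\<forall>\<^sub>F s in at_right p. \<bar>f s - f p\<bar> < e"
          using tendstoD[OF right[OF local(1) True] e] by (simp add: dist_real_def)
        then obtain b where "b > p" "\<And>s. p < s \<Longrightarrow> s < b \<Longrightarrow> \<bar>f s - f p\<bar> < e"
          unfolding eventually_at_right_field by blast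
        then show ?thesis by (intro exI[of _ "b - p"]) auto
      qed (auto intro: exI[of _ 1])
      then obtain d1 where d1: "d1 > 0" "\<And>s. p < T \<Longrightarrow> p < s \<Longrightarrow> s < p + d1 \<Longrightarrow> \<bar>f s - f p\<bar> < e" by blast
      have "\<exists>d>0. \<exists>l. 0 < p \<longrightarrow> (\<forall>s. p - d < s \<and> s < p \<longrightarrow> \<bar>f s - l\<bar> < e)"
      proof (cases "0 < p")
        case True
        then obtain l where "(f \<longlongrightarrow> l) (at_left p)" using left local by blast
        then have "\<forall>\<^sub>F s in at_left p. \<bar>f s - l\<bar> < e"
          using tendstoD[OF _ e] by (fastforce simp: dist_real_def)
        then obtain b where "b < p" "\<And>s. b < s \<Longrightarrow> s < p \<Longrightarrow> \<bar>f s - l\<bar> < e"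
          unfolding eventually_at_left_field by blast
        then show ?thesis by (intro exI[of _ "p - b"]) auto
      qed (auto intro: exI[of _ 1])
      then obtain d2 l where d2: "d2 > 0" "\<And>s. 0 < p \<Longrightarrow> p - d2 < s \<Longrightarrow> s < p \<Longrightarrow> \<bar>f s - l\<bar> < e" by blast
      have "P a b" if ab: "a \<le> p" "p \<le> b" "b - a < min d1 d2" for a b
        unfolding P_def
      proof
        assume bd: "0 \<le> a \<and> b \<le> T"
        define g where "g t = (if t < p then l else f p)" for t
        have "g integrable_on {a..p}"
          by (rule integrable_spike_finite[of "{p}" _ _ "\<lambda>_. l"]) (auto simp: g_def)
        moreover have "g integrable_on {p..b}"
          by (rule integrable_eq[of "\<lambda>_. f p"]) (auto simp: g_def)
        ultimately have "g integrable_on {a..b}"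
          using Henstock_Kurzweil_Integration.integrable_combine[of a p b g] ab by blast
        moreover have "\<bar>f t - g t\<bar> \<le> e" if "t \<in> {a..b}" for t
          using d1(2)[of t] d2(2)[of t] that ab bd e by (cases t p rule: linorder_cases) (auto simp: g_def)
        moreover have "\<bar>f t\<bar> \<le> e + \<bar>l\<bar> + \<bar>f p\<bar>" if t: "t \<in> {a..b}" for t
        proof -
          have "\<bar>g t\<bar> \<le> \<bar>l\<bar> + \<bar>f p\<bar>" by (simp add: g_def)
          then show ?thesis using \<open>\<And>t. t \<in> {a..b} \<Longrightarrow> \<bar>f t - g t\<bar> \<le> e\<close>[OF t] by linarith
        qed
        ultimately show "\<exists>g B. g integrable_on {a..b} \<and> (\<forall>t\<in>{a..b}. \<bar>f t - g t\<bar> \<le> e \<and> \<bar>f t\<bar> \<le> B)"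
          by blast
      qed
      then show ?case using d1(1) d2(1) by (intro exI[of _ "min d1 d2"]) auto
    qed
    then show ?thesis by (simp add: P_def)
  qed
  then show "\<exists>B. \<forall>t\<in>{0..T}. \<bar>f t\<bar> \<le> B" using zero_less_one by blast
  have "f integrable_on cbox 0 T"
    by (rule integrable_uniform_limit) (use key in \<open>auto simp: cbox_interval, blast\<close>)
  then show "f integrable_on {0..T}" by simp
qed

text \<open>The derivatives are given in each variable separately. Being continuous on a compact
  square they are bounded, so the mean value inequality yields Lipschitz bounds in each variable
  that are uniform in the other; together these give joint continuity.\<close>

lemma C1_on_square_continuous:
  assumes "C1_on_square lam"
  shows "continuous_on ({0..1} \<times> {0..1}) (\<lambda>(x, y). lam x y)"
proof -
  obtain D1 D2 where D: "continuous_on ({0..1} \<times> {0..1}) (\<lambda>(x, y). D1 x y)"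
    "continuous_on ({0..1} \<times> {0..1}) (\<lambda>(x, y). D2 x y)"
    "\<And>x y. x \<in> {0..1} \<Longrightarrow> y \<in> {0..1} \<Longrightarrow> ((\<lambda>u. lam u y) has_real_derivative D1 x y) (at x within {0..1})"
    "\<And>x y. x \<in> {0..1} \<Longrightarrow> y \<in> {0..1} \<Longrightarrow> ((\<lambda>v. lam x v) has_real_derivative D2 x y) (at y within {0..1})"
    using assms unfolding C1_on_square_def by blast
  have cpt: "compact ({0..1} \<times> {0..1} :: (real \<times> real) set)" by (intro compact_Times) auto
  have bdd: "\<exists>B. \<forall>x\<in>{0..1}. \<forall>y\<in>{0..1}. \<bar>d x y\<bar> \<le> B"
    if "continuous_on ({0..1} \<times> {0..1}) (\<lambda>(x, y). d x y)" for d :: "real \<Rightarrow> real \<Rightarrow> real"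
    using compact_imp_bounded[OF compact_continuous_image[OF that cpt]]
    by (fastforce simp: bounded_iff)
  obtain B1 B2 where B: "\<And>x y. x \<in> {0..1} \<Longrightarrow> y \<in> {0..1} \<Longrightarrow> \<bar>D1 x y\<bar> \<le> B1"
    "\<And>x y. x \<in> {0..1} \<Longrightarrow> y \<in> {0..1} \<Longrightarrow> \<bar>D2 x y\<bar> \<le> B2"
    using bdd[OF D(1)] bdd[OF D(2)] by metis
  have L1: "\<bar>lam x y - lam x' y\<bar> \<le> B1 * \<bar>x - x'\<bar>" if "x \<in> {0..1}" "x' \<in> {0..1}" "y \<in> {0..1}" for x x' y
    using field_differentiable_bound[of "{0..1}" "\<lambda>u. lam u y" "\<lambda>u. D1 u y" B1 x x'] D(3) B(1) that by auto
  have L2: "\<bar>lam x y - lam x y'\<bar> \<le> B2 * \<bar>y - y'\<bar>" if "x \<in> {0..1}" "y \<in> {0..1}" "y' \<in> {0..1}" for x y y'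
    using field_differentiable_bound[of "{0..1}" "\<lambda>v. lam x v" "\<lambda>v. D2 x v" B2 y y'] D(4) B(2) that by auto
  show ?thesis
    unfolding continuous_on_def
  proof
    fix z :: "real \<times> real" assume z: "z \<in> {0..1} \<times> {0..1}"
    let ?F = "at z within {0..1} \<times> {0..1}"
    have "((\<lambda>w. B1 * \<bar>fst w - fst z\<bar> + B2 * \<bar>snd w - snd z\<bar>) \<longlongrightarrow>
        B1 * \<bar>fst z - fst z\<bar> + B2 * \<bar>snd z - snd z\<bar>) ?F"
      by (intro tendsto_intros)
    then have lim: "((\<lambda>w. B1 * \<bar>fst w - fst z\<bar> + B2 * \<bar>snd w - snd z\<bar>) \<longlongrightarrow> 0) ?F" by simp
    have "\<forall>\<^sub>F w in ?F. w \<in> {0..1} \<times> {0..1}"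
      by (simp add: eventually_at_filter)
    then have "\<forall>\<^sub>F w in ?F. norm ((\<lambda>(x, y). lam x y) w - (\<lambda>(x, y). lam x y) z) \<le>
        B1 * \<bar>fst w - fst z\<bar> + B2 * \<bar>snd w - snd z\<bar>"
    proof eventually_elim
      case (elim w)
      have "\<bar>lam (fst w) (snd w) - lam (fst z) (snd z)\<bar> \<le>
        \<bar>lam (fst w) (snd w) - lam (fst z) (snd w)\<bar> + \<bar>lam (fst z) (snd w) - lam (fst z) (snd z)\<bar>"
        by linarith
      then show ?case
        using L1[of "fst w" "fst z" "snd w"] L2[of "fst z" "snd w" "snd z"] elim z
        by (auto simp: case_prod_beta mem_Times_iff)
    qed
    then have "((\<lambda>w. (\<lambda>(x, y). lam x y) w - (\<lambda>(x, y). lam x y) z) \<longlongrightarrow> 0) ?F"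
      by (rule Lim_null_comparison[OF _ lim])
    then show "((\<lambda>(x, y). lam x y) \<longlongrightarrow> (\<lambda>(x, y). lam x y) z) ?F"
      by (rule LIM_zero_cancel)
  qed
qed


section \<open>The limiting flow\<close>

text \<open>Completeness of \<open>C01\<close> is what \<open>banach_steinhaus\<close> asks for in
  the uniqueness proof.\<close>

instance bcontfun :: (metric_space, banach) banach ..

text \<open>\<open>\<Lambda>\<close> enters the later bounds through \<open>2 * \<Lambda>\<close>,
  which dominates the drift operator and all its discretisations at once.\<close>

locale urn_rates =
  fixes lam :: "real \<Rightarrow> real \<Rightarrow> real" and \<Lambda> :: real
  assumes lam_cont: "continuous_on ({0..1} \<times> {0..1}) (\<lambda>(x, y). lam x y)"
    and lam_bound: "\<And>x y. x \<in> {0..1} \<Longrightarrow> y \<in> {0..1} \<Longrightarrow> \<bar>lam x y\<bar> \<le> \<Lambda>"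
begin

lemma Lam_nonneg: "0 \<le> \<Lambda>"
  using lam_bound[of 0 0] by simp

definition drift :: "C01 \<Rightarrow> C01"
  where "drift f = P1 lam f - P2 lam f"

lemma lam_section_cont:
  assumes "x \<in> {0..1}"
  shows "continuous_on {0..1} (lam x)"
proof -
  have "continuous_on {0..1} (\<lambda>y. (\<lambda>(x, y). lam x y) (x, y))"
    by (rule continuous_on_compose2[OF lam_cont]) (use assms in \<open>auto intro!: continuous_intros\<close>)
  then show ?thesis by simp
qed

lemma drift_integrable:
  assumes "x \<in> {0..1}"
  shows "(\<lambda>y. lam x y * (apply_bcontfun f (pt y) - c)) integrable_on {0..1}"
  by (intro integrable_continuous_interval continuous_intros lam_section_cont assms
      continuous_on_bcontfun_pt)

text \<open>In terms of increments of \<open>f\<close> the drift is the generator of a single ball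
  jumping on the unit interval; the discrete \<open>box_drift\<close> is its Riemann sum.\<close>

lemma drift_apply:
  "apply_bcontfun (drift f) u =
    integral {0..1} (\<lambda>y. lam (coord u) y * (apply_bcontfun f (pt y) - apply_bcontfun f u))"
proof -
  have u: "coord u \<in> {0..1}" by simp
  have 1: "(\<lambda>y. lam (coord u) y * apply_bcontfun f (pt y)) integrable_on {0..1}"
    using drift_integrable[OF u, of f 0] by simp
  have 2: "(\<lambda>y. apply_bcontfun f u * lam (coord u) y) integrable_on {0..1}"
    by (intro integrable_continuous_interval continuous_intros lam_section_cont u)
  have "(\<lambda>y. lam (coord u) y * (apply_bcontfun f (pt y) - apply_bcontfun f u)) =
      (\<lambda>y. lam (coord u) y * apply_bcontfun f (pt y) - apply_bcontfun f u * lam (coord u) y)"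
    by (simp add: algebra_simps)
  then show ?thesis
    using integral_diff[OF 1 2]
    by (simp add: drift_def minus_bcontfun.rep_eq P1_apply[OF lam_cont] P2_apply[OF lam_cont])
qed

lemma norm_drift_le: "norm (drift f) \<le> 2 * \<Lambda> * norm f"
proof (rule norm_bound)
  fix u
  have u: "coord u \<in> {0..1}" by simp
  have "norm (apply_bcontfun (drift f) u) \<le> integral {0..1} (\<lambda>y::real. 2 * \<Lambda> * norm f)"
    unfolding drift_apply
  proof (rule integral_norm_bound_integral[OF drift_integrable[OF u]])
    fix y :: real assume y: "y \<in> {0..1}"
    have "\<bar>apply_bcontfun f (pt y) - apply_bcontfun f u\<bar> \<le> 2 * norm f"
      using norm_bounded[of f "pt y"] norm_bounded[of f u] by simp
    then have "\<bar>lam (coord u) y\<bar> * \<bar>apply_bcontfun f (pt y) - apply_bcontfun f u\<bar> \<le> \<Lambda> * (2 * norm f)"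
      using lam_bound[OF u y] by (intro mult_mono) auto
    then show "norm (lam (coord u) y * (apply_bcontfun f (pt y) - apply_bcontfun f u)) \<le> 2 * \<Lambda> * norm f"
      by (simp add: abs_mult)
  qed (rule integrable_const_ivl)
  then show "norm (apply_bcontfun (drift f) u) \<le> 2 * \<Lambda> * norm f" by simp
qed

lemma drift_add: "drift (f + g) = drift f + drift g"
proof (rule bcontfun_eqI)
  fix u
  have u: "coord u \<in> {0..1}" by simp
  show "apply_bcontfun (drift (f + g)) u = apply_bcontfun (drift f + drift g) u"
    unfolding drift_apply plus_bcontfun.rep_eq integral_add[OF drift_integrable[OF u] drift_integrable[OF u], symmetric]
    by (simp add: algebra_simps)
qed

lemma drift_scaleR: "drift (r *\<^sub>R f) = r *\<^sub>R drift f"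
proof (rule bcontfun_eqI)
  fix u
  show "apply_bcontfun (drift (r *\<^sub>R f)) u = apply_bcontfun (r *\<^sub>R drift f) u"
    unfolding drift_apply scaleR_bcontfun.rep_eq integral_cmul[symmetric]
    by (simp add: algebra_simps)
qed

lemma drift_power_add: "(drift ^^ n) (f + g) = (drift ^^ n) f + (drift ^^ n) g"
  by (induction n) (auto simp: drift_add)

lemma drift_power_scaleR: "(drift ^^ n) (r *\<^sub>R f) = r *\<^sub>R (drift ^^ n) f"
  by (induction n) (auto simp: drift_scaleR)

lemma norm_drift_power_le: "norm ((drift ^^ n) f) \<le> (2 * \<Lambda>) ^ n * norm f"
proof (induction n)
  case (Suc n)
  have "norm (drift ((drift ^^ n) f)) \<le> 2 * \<Lambda> * norm ((drift ^^ n) f)" by (rule norm_drift_le)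
  also have "\<dots> \<le> 2 * \<Lambda> * ((2 * \<Lambda>) ^ n * norm f)"
    using Suc Lam_nonneg by (intro mult_left_mono) auto
  finally show ?case by simp
qed simp

definition init :: "C01 \<Rightarrow> C01 \<Rightarrow> real"
  where "init \<phi> f = integral {0..1} (\<lambda>x. apply_bcontfun f (pt x) * apply_bcontfun \<phi> (pt x))"

lemma init_integrable:
  "(\<lambda>x. apply_bcontfun f (pt x) * apply_bcontfun \<phi> (pt x)) integrable_on {0..1}" for f \<phi> :: C01
  by (intro integrable_continuous_interval continuous_intros continuous_on_bcontfun_pt)

lemma init_add: "init \<phi> (f + g) = init \<phi> f + init \<phi> g"
  unfolding init_def integral_add[OF init_integrable init_integrable, symmetric]
  by (simp add: plus_bcontfun.rep_eq algebra_simps)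

lemma init_scaleR: "init \<phi> (r *\<^sub>R f) = r * init \<phi> f"
  unfolding init_def real_scaleR_def[symmetric] integral_cmul[symmetric]
  by (simp add: scaleR_bcontfun.rep_eq algebra_simps)

lemma init_le: "\<bar>init \<phi> f\<bar> \<le> norm \<phi> * norm f"
proof -
  have "norm (init \<phi> f) \<le> integral {0..1} (\<lambda>y::real. norm f * norm \<phi>)"
    unfolding init_def
    by (rule integral_norm_bound_integral[OF init_integrable])
      (use norm_bounded[of f] norm_bounded[of \<phi>] in \<open>auto simp: abs_mult intro!: mult_mono\<close>)
  then show ?thesis by (simp add: mult.commute)
qed

lemma exp_type_init: "exp_type (norm \<phi> * norm f) (2 * \<Lambda>) (\<lambda>n. init \<phi> ((drift ^^ n) f))"
  unfolding exp_type_def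
proof (intro conjI allI)
  fix n
  have "\<bar>init \<phi> ((drift ^^ n) f)\<bar> \<le> norm \<phi> * norm ((drift ^^ n) f)" by (rule init_le)
  also have "\<dots> \<le> norm \<phi> * ((2 * \<Lambda>) ^ n * norm f)"
    by (intro mult_left_mono norm_drift_power_le) simp
  finally show "\<bar>init \<phi> ((drift ^^ n) f)\<bar> \<le> norm \<phi> * norm f * (2 * \<Lambda>) ^ n" by (simp add: mult_ac)
qed (use Lam_nonneg in auto)

definition flow :: "C01 \<Rightarrow> real \<Rightarrow> dual_C01"
  where "flow \<phi> t = Blinfun (\<lambda>f. exp_series (\<lambda>n. init \<phi> ((drift ^^ n) f)) t)"

lemma flow_apply: "(flow \<phi> t) f = exp_series (\<lambda>n. init \<phi> ((drift ^^ n) f)) t"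
proof -
  have "bounded_linear (\<lambda>f. exp_series (\<lambda>n. init \<phi> ((drift ^^ n) f)) t)"
  proof (rule bounded_linear_intro)
    fix f g r
    show "exp_series (\<lambda>n. init \<phi> ((drift ^^ n) (f + g))) t =
        exp_series (\<lambda>n. init \<phi> ((drift ^^ n) f)) t + exp_series (\<lambda>n. init \<phi> ((drift ^^ n) g)) t"
      using exp_series_linear[OF exp_type_init exp_type_init, of 1 \<phi> f 1 \<phi> g t]
      by (simp add: drift_power_add init_add)
    show "exp_series (\<lambda>n. init \<phi> ((drift ^^ n) (r *\<^sub>R f))) t =
        r *\<^sub>R exp_series (\<lambda>n. init \<phi> ((drift ^^ n) f)) t"
      using exp_series_linear[OF exp_type_init exp_type_init, of r \<phi> f 0 \<phi> f t]
      by (simp add: drift_power_scaleR init_scaleR)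
    show "norm (exp_series (\<lambda>n. init \<phi> ((drift ^^ n) f)) t) \<le> norm f * (norm \<phi> * exp (2 * \<Lambda> * \<bar>t\<bar>))"
      using exp_series_bound[OF exp_type_init, of \<phi> f t] by (simp add: mult_ac)
  qed
  then show ?thesis unfolding flow_def by (simp add: bounded_linear_Blinfun_apply)
qed

text \<open>The extra application of \<open>drift\<close> is moved from the outside of the iterate
  onto the test function, which is the form required by the weak equation.\<close>

lemma flow_has_derivative:
  "((\<lambda>t. (flow \<phi> t) f) has_real_derivative (flow \<phi> t) (drift f)) (at t)"
  using exp_series_has_derivative[OF exp_type_init, of \<phi> f t]
  by (simp add: flow_apply funpow_swap1)

lemma flow_weak_solution: "weak_solution lam \<phi> T (\<lambda>t\<in>{0..T}. flow \<phi> t)"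
  unfolding weak_solution_def
proof (intro ballI allI)
  fix t f assume t: "t \<in> {0..T}"
  have "((\<lambda>s. (flow \<phi> s) (drift f)) has_integral
      (flow \<phi> t) f - (flow \<phi> 0) f) {0..t}"
    using t by (intro fundamental_theorem_of_calculus)
      (auto simp: has_real_derivative_iff_has_vector_derivative[symmetric]
        intro: has_field_derivative_at_within flow_has_derivative)
  then have "integral {0..t} (\<lambda>s. (flow \<phi> s) (drift f)) =
      (flow \<phi> t) f - init \<phi> f"
    by (simp add: integral_unique flow_apply exp_series_0)
  moreover have "integral {0..t} (\<lambda>s. blinfun_apply ((\<lambda>t\<in>{0..T}. flow \<phi> t) s) (drift f)) =
      integral {0..t} (\<lambda>s. (flow \<phi> s) (drift f))"
    using t by (intro integral_cong) auto
  ultimately show "blinfun_apply ((\<lambda>t\<in>{0..T}. flow \<phi> t) t) f =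
      integral {0..1} (\<lambda>x. apply_bcontfun f (pt x) * apply_bcontfun \<phi> (pt x)) +
      integral {0..t} (\<lambda>s. blinfun_apply ((\<lambda>t\<in>{0..T}. flow \<phi> t) s) (P1 lam f - P2 lam f))"
    using t by (simp add: init_def drift_def)
qed

text \<open>The flow is continuous on the whole real line, but the restricted path is
  \<open>undefined\<close> off \<open>{0..T}\<close>. Limits are therefore transferred along times
  that eventually lie inside the interval.\<close>

lemma flow_cadlag: "(\<lambda>t\<in>{0..T}. flow \<phi> t) \<in> cadlag_paths T"
proof -
  have lim: "((\<lambda>s. (flow \<phi> s) f) \<longlongrightarrow> (flow \<phi> t) f) (at t within S)" for f t S
    using DERIV_isCont[OF flow_has_derivative] tendsto_within_subset[OF _ subset_UNIV]
    unfolding isCont_def by blast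
  have "limitin weak_star (\<lambda>t\<in>{0..T}. flow \<phi> t) (flow \<phi> t) (at_right t)" if "t \<in> {0..<T}" for t
    unfolding limitin_weak_star
  proof
    fix f
    have "\<forall>\<^sub>F s in at_right t. t < s \<and> s < T"
      using that by (auto simp: eventually_at_right_field)
    then have "\<forall>\<^sub>F s in at_right t. (flow \<phi> s) f = blinfun_apply ((\<lambda>t\<in>{0..T}. flow \<phi> t) s) f"
      by eventually_elim (use that in auto)
    then show "((\<lambda>s. blinfun_apply ((\<lambda>t\<in>{0..T}. flow \<phi> t) s) f) \<longlongrightarrow> (flow \<phi> t) f) (at_right t)"
      by (rule Lim_transform_eventually[OF lim])
  qed
  moreover have "limitin weak_star (\<lambda>t\<in>{0..T}. flow \<phi> t) (flow \<phi> t) (at_left t)" if "t \<in> {0<..T}" for t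
    unfolding limitin_weak_star
  proof
    fix f
    have "\<forall>\<^sub>F s in at_left t. 0 < s \<and> s < t"
      using that by (auto simp: eventually_at_left_field)
    then have "\<forall>\<^sub>F s in at_left t. (flow \<phi> s) f = blinfun_apply ((\<lambda>t\<in>{0..T}. flow \<phi> t) s) f"
      by eventually_elim (use that in auto)
    then show "((\<lambda>s. blinfun_apply ((\<lambda>t\<in>{0..T}. flow \<phi> t) s) f) \<longlongrightarrow> (flow \<phi> t) f) (at_left t)"
      by (rule Lim_transform_eventually[OF lim])
  qed
  ultimately show ?thesis unfolding cadlag_paths_def by (simp, blast)
qed

text \<open>The difference of two solutions satisfies the homogeneous equation. Each use of it costs
  one integration and one \<open>drift\<close>, giving (2 Lambda t)^n / n!. The induction quantifies
  over all test functions instead of working with the operator norm of \<open>\<delta> s\<close>,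
  whose integrability in \<open>s\<close> is not at hand.\<close>

lemma weak_solution_unique:
  assumes T: "0 < T"
    and mu: "\<mu> \<in> cadlag_paths T" "weak_solution lam \<phi> T \<mu>"
    and nu: "\<nu> \<in> cadlag_paths T" "weak_solution lam \<phi> T \<nu>"
  shows "\<mu> = \<nu>"
proof -
  have reg: "(\<lambda>s. blinfun_apply (\<xi> s) f) integrable_on {0..T}" "\<exists>B. \<forall>t\<in>{0..T}. \<bar>blinfun_apply (\<xi> t) f\<bar> \<le> B"
    if "\<xi> \<in> cadlag_paths T" for \<xi> f
    using regulated_integrable_bounded[of T "\<lambda>s. blinfun_apply (\<xi> s) f"] that T
    unfolding cadlag_paths_def by (fastforce simp: limitin_weak_star)+
  define \<delta> where "\<delta> s = \<mu> s - \<nu> s" for s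
  have "\<exists>B. \<forall>t\<in>{0..T}. norm (\<delta> t f) \<le> B" for f
  proof -
    obtain B C where "\<And>t. t \<in> {0..T} \<Longrightarrow> \<bar>blinfun_apply (\<mu> t) f\<bar> \<le> B"
      "\<And>t. t \<in> {0..T} \<Longrightarrow> \<bar>blinfun_apply (\<nu> t) f\<bar> \<le> C"
      using reg(2)[OF mu(1), of f] reg(2)[OF nu(1), of f] by blast
    then have "norm (\<delta> t f) \<le> B + C" if "t \<in> {0..T}" for t
      using that by (fastforce simp: \<delta>_def blinfun.diff_left intro: order_trans[OF abs_triangle_ineq4])
    then show ?thesis by blast
  qed
  then obtain B where B: "\<And>t. t \<in> {0..T} \<Longrightarrow> norm (\<delta> t) \<le> B"
    using banach_steinhaus[of "{0..T}" \<delta>] by blast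
  have B0: "0 \<le> B" using B[of 0] T by (auto intro: order_trans[OF norm_ge_zero])
  have int: "(\<lambda>s. \<delta> s f) integrable_on {0..t}" if "t \<in> {0..T}" for t f
    unfolding \<delta>_def blinfun.diff_left using that
    by (intro integrable_diff integrable_on_subinterval[OF reg(1)] mu nu) auto
  have eq: "\<delta> t f = integral {0..t} (\<lambda>s. \<delta> s (drift f))"
    if t: "t \<in> {0..T}" for t f
  proof -
    have "(\<lambda>s. blinfun_apply (\<xi> s) g) integrable_on {0..t}" if "\<xi> \<in> cadlag_paths T" for \<xi> g
      using t by (intro integrable_on_subinterval[OF reg(1)[OF that]]) auto
    note integral_diff[OF this[OF mu(1)] this[OF nu(1)]]
    then show ?thesis
      using mu(2) nu(2) t unfolding weak_solution_def drift_def[symmetric] \<delta>_def blinfun.diff_left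
      by simp
  qed
  have bound: "\<bar>\<delta> t f\<bar> \<le> B * norm f * ((2 * \<Lambda> * t) ^ n / fact n)" if "t \<in> {0..T}" for n t f
    using that
  proof (induction n arbitrary: t f)
    case 0
    then show ?case
      using norm_blinfun[of "\<delta> t" f] B[of t] by (simp add: order_trans[OF _ mult_right_mono])
  next
    case (Suc n)
    have "((\<lambda>s. B * norm (drift f) * (2 * \<Lambda>) ^ n * (s ^ n / fact n)) has_integral
        B * norm (drift f) * (2 * \<Lambda>) ^ n * (t ^ Suc n / fact (Suc n) - 0 ^ Suc n / fact (Suc n))) {0..t}"
    proof (intro has_integral_mult_right fundamental_theorem_of_calculus)
      fix s
      have "((\<lambda>s. s ^ Suc n / fact (Suc n)) has_real_derivative s ^ n / fact n) (at s within {0..t})"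
        by (rule derivative_eq_intros refl | simp)+ 
      then show "((\<lambda>s. s ^ Suc n / fact (Suc n)) has_vector_derivative s ^ n / fact n) (at s within {0..t})"
        by (simp add: has_real_derivative_iff_has_vector_derivative)
    qed (use Suc in auto)
    then have I: "((\<lambda>s. B * norm (drift f) * ((2 * \<Lambda> * s) ^ n / fact n)) has_integral
        B * norm (drift f) * (2 * \<Lambda>) ^ n * (t ^ Suc n / fact (Suc n))) {0..t}"
      by (simp add: power_mult_distrib mult_ac)
    have "norm (integral {0..t} (\<lambda>s. \<delta> s (drift f))) \<le>
        integral {0..t} (\<lambda>s. B * norm (drift f) * ((2 * \<Lambda> * s) ^ n / fact n))"
      using Suc int I by (intro integral_norm_bound_integral) (auto simp: has_integral_integrable)
    then have "\<bar>\<delta> t f\<bar> \<le> B * norm (drift f) * (2 * \<Lambda>) ^ n * (t ^ Suc n / fact (Suc n))"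
      unfolding integral_unique[OF I] eq[OF Suc.prems, symmetric] by simp
    also have "\<dots> \<le> B * (2 * \<Lambda> * norm f) * (2 * \<Lambda>) ^ n * (t ^ Suc n / fact (Suc n))"
      using B0 Suc.prems Lam_nonneg norm_drift_le
      by (intro mult_right_mono mult_left_mono) auto
    finally show ?case by (simp add: power_mult_distrib mult_ac)
  qed
  have "\<delta> t f = 0" if "t \<in> {0..T}" for t f
  proof -
    have "(\<lambda>n. (2 * \<Lambda> * t) ^ n / fact n) \<longlonglongrightarrow> 0"
      using summable_LIMSEQ_zero[OF summable_exp[of "2 * \<Lambda> * t"]] by (simp add: divide_inverse mult.commute)
    then have "(\<lambda>n. B * norm f * ((2 * \<Lambda> * t) ^ n / fact n)) \<longlonglongrightarrow> B * norm f * 0"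
      by (rule tendsto_mult_left)
    then have "\<bar>\<delta> t f\<bar> \<le> B * norm f * 0"
      by (rule LIMSEQ_le_const) (use bound[OF that] in blast)
    then show ?thesis by simp
  qed
  then have "\<mu> t = \<nu> t" if "t \<in> {0..T}" for t
    using that by (intro blinfun_eqI) (auto simp: \<delta>_def blinfun.diff_left)
  then show ?thesis
    using mu(1) nu(1) unfolding cadlag_paths_def by (auto intro: extensionalityI)
qed

end


section \<open>Continuous-time chains on a finite closed set\<close>

text \<open>\<open>Q\<close> is the rate matrix on \<open>S\<close>, read off from the generator at
  indicators of points. Vanishing row sums over \<open>S\<close> express that no jump leads out of
  \<open>S\<close>; that the semigroup stays in \<open>S\<close> is then a consequence
  (\<open>closed\<close>).\<close>

locale finite_chain =
  fixes E :: "'s set" and p :: "real \<Rightarrow> 's \<Rightarrow> 's pmf" and L :: "('s \<Rightarrow> real) \<Rightarrow> 's \<Rightarrow> real"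
    and S :: "'s set" and Q :: "'s \<Rightarrow> 's \<Rightarrow> real"
  assumes semigroup: "transition_semigroup E p"
    and generator: "has_generator E p L"
    and fin: "finite S" and sub: "S \<subseteq> E"
    and rates: "\<And>x y. x \<in> S \<Longrightarrow> y \<in> S \<Longrightarrow> L (indicator {y}) x = Q x y"
    and rates_sum: "\<And>x. x \<in> S \<Longrightarrow> (\<Sum>y\<in>S. Q x y) = 0"
begin

text \<open>The generator at an indicator is the derivative at time 0 of one matrix entry; as
  \<open>S\<close> is finite, the error o(h) can be taken uniform over all entries.\<close>

lemma transition_expansion:
  assumes "0 < \<epsilon>"
  shows "\<exists>h0>0. \<forall>h. 0 < h \<and> h < h0 \<longrightarrow>
    (\<forall>x\<in>S. \<forall>y\<in>S. \<bar>pmf (p h x) y - of_bool (x = y) - h * Q x y\<bar> \<le> \<epsilon> * h)"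
proof -
  have "\<forall>\<^sub>F h in at_right 0. \<bar>pmf (p h x) y - of_bool (x = y) - h * Q x y\<bar> \<le> \<epsilon> * h"
    if "x \<in> S" "y \<in> S" for x y
  proof -
    have "bounded (range (indicator {y} :: 's \<Rightarrow> real))"
      by (auto simp: bounded_iff indicator_def intro!: exI[of _ 1])
    then have "bounded ((indicator {y} :: 's \<Rightarrow> real) ` E)" by (rule bounded_subset) auto
    then have "((\<lambda>h. (measure_pmf.expectation (p h x) (indicator {y}) - indicator {y} x) / h)
        \<longlongrightarrow> L (indicator {y}) x) (at_right 0)"
      using generator that sub unfolding has_generator_def by blast
    then have "((\<lambda>h. (pmf (p h x) y - of_bool (x = y)) / h) \<longlongrightarrow> Q x y) (at_right 0)"
      using rates[OF that] by (simp add: measure_pmf_single indicator_def)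
    from tendstoD[OF this assms] have
      "\<forall>\<^sub>F h in at_right 0. \<bar>(pmf (p h x) y - of_bool (x = y)) / h - Q x y\<bar> < \<epsilon>"
      by (simp add: dist_real_def)
    moreover have "\<forall>\<^sub>F h in at_right 0. (0 :: real) < h" by (simp add: eventually_at_right_less)
    ultimately show ?thesis
    proof eventually_elim
      case (elim h)
      have "pmf (p h x) y - of_bool (x = y) - h * Q x y = h * ((pmf (p h x) y - of_bool (x = y)) / h - Q x y)"
        using elim by (simp add: field_simps)
      then show ?case using elim by (simp add: abs_mult mult.commute)
    qed
  qed
  then have "\<forall>\<^sub>F h in at_right 0. \<forall>x\<in>S. \<forall>y\<in>S. \<bar>pmf (p h x) y - of_bool (x = y) - h * Q x y\<bar> \<le> \<epsilon> * h"
    using fin by (intro eventually_ball_finite ballI) blast+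
  then show ?thesis unfolding eventually_at_right_field by blast
qed

lemma semigroup_0: "x \<in> S \<Longrightarrow> p 0 x = return_pmf x"
  using semigroup sub unfolding transition_semigroup_def by blast

lemma chapman_kolmogorov: "0 \<le> s \<Longrightarrow> 0 \<le> t \<Longrightarrow> x \<in> S \<Longrightarrow> p (s + t) x = bind_pmf (p s x) (p t)"
  using semigroup sub unfolding transition_semigroup_def by blast

lemma measure_escape: "measure (measure_pmf (p t x)) (- S) = 1 - (\<Sum>y\<in>S. pmf (p t x) y)"
  using measure_pmf.prob_compl[of S "p t x"] fin
  by (simp add: Compl_eq_Diff_UNIV measure_measure_pmf_finite)

text \<open>Condition on the state at time \<open>s\<close>: if it lies outside \<open>S\<close>,
  the later escape probability is bounded by 1; otherwise it is kept.\<close>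

lemma measure_escape_add:
  assumes "0 \<le> s" "0 \<le> t" "x \<in> S"
  shows "measure (measure_pmf (p (s + t) x)) (- S) \<le> measure (measure_pmf (p s x)) (- S) +
    (\<Sum>y\<in>S. pmf (p s x) y * measure (measure_pmf (p t y)) (- S))"
proof -
  let ?q = "\<lambda>y. measure (measure_pmf (p t y)) (- S)"
  have q: "integrable (measure_pmf (p s x)) (\<lambda>y. indicator S y * ?q y)"
    by (rule measure_pmf.integrable_const_bound[where B = 1])
      (auto simp: indicator_def measure_pmf.prob_le_1)
  have i: "integrable (measure_pmf (p s x)) (indicator (- S) :: 's \<Rightarrow> real)"
    by (rule measure_pmf.integrable_const_bound[where B = 1]) (auto simp: indicator_def)
  have "measure (measure_pmf (p (s + t) x)) (- S) = measure_pmf.expectation (p s x) ?q"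
    unfolding chapman_kolmogorov[OF assms] measure_pmf_bind
    by (rule measure_pmf.measure_bind[where N = "count_space UNIV"])
      (use measurable_measure_pmf[of "p t"] in auto)
  also have "\<dots> \<le> measure_pmf.expectation (p s x) (\<lambda>y. indicator (- S) y + indicator S y * ?q y)"
    by (intro integral_mono measure_pmf.integrable_const_bound[where B = 1]
        Bochner_Integration.integrable_add q i)
      (auto simp: indicator_def measure_pmf.prob_le_1)
  also have "\<dots> = measure (measure_pmf (p s x)) (- S) + measure_pmf.expectation (p s x) (\<lambda>y. indicator S y * ?q y)"
    using q i by (subst Bochner_Integration.integral_add) auto
  also have "measure_pmf.expectation (p s x) (\<lambda>y. indicator S y * ?q y) = (\<Sum>y\<in>S. pmf (p s x) y * ?q y)"
    by (subst integral_measure_pmf_real[of S]) (use fin in \<open>auto simp: indicator_def mult.commute split: if_splits\<close>)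
  finally show ?thesis .
qed

text \<open>The escape probability over a time step \<open>h\<close> is \<open>o(h)\<close>, and it is subadditive in time.\<close>

lemma closed:
  assumes x: "x \<in> S" and t: "0 \<le> t"
  shows "set_pmf (p t x) \<subseteq> S"
proof (cases "t = 0")
  case False
  define n where "n = real (card S)"
  have n: "0 < n" unfolding n_def using fin x by (simp add: card_gt_0_iff) blast
  have le: "measure (measure_pmf (p t x)) (- S) \<le> t * \<epsilon>" if "0 < \<epsilon>" for \<epsilon>
  proof -
    have "0 < \<epsilon> / n" using that n by simp
    from transition_expansion[OF this] obtain h0 where h0: "0 < h0"
      "\<And>h x y. 0 < h \<Longrightarrow> h < h0 \<Longrightarrow> x \<in> S \<Longrightarrow> y \<in> S \<Longrightarrow>
        \<bar>pmf (p h x) y - of_bool (x = y) - h * Q x y\<bar> \<le> \<epsilon> / n * h" by metis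
    obtain k where k: "t / h0 < real k" using reals_Archimedean2 by blast
    have k0: "0 < real k" using k h0 t False by (meson divide_nonneg_pos le_less_trans)
    define h where "h = t / real k"
    have h: "0 < h" "h < h0" using k k0 h0 t False unfolding h_def by (auto simp: field_simps)
    have step: "measure (measure_pmf (p h y)) (- S) \<le> h * \<epsilon>" if y: "y \<in> S" for y
    proof -
      have "(\<Sum>z\<in>S. of_bool (y = z) + h * Q y z - \<epsilon> / n * h) \<le> (\<Sum>z\<in>S. pmf (p h y) z)"
        using h0(2)[OF h y] by (intro sum_mono) fastforce
      \<comment> \<open>The terms of first order in \<open>h\<close> cancel because the row of
        \<open>Q\<close> sums to 0, and the \<open>n\<close> errors of size
        \<open>\<epsilon> / n * h\<close> add up to \<open>\<epsilon> * h\<close>.\<close>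
      moreover have "(\<Sum>z\<in>S. of_bool (y = z) + h * Q y z - \<epsilon> / n * h) = 1 - \<epsilon> * h"
        using rates_sum[OF y] y fin n
        by (auto simp: sum.distrib sum_subtractf sum_distrib_left[symmetric] n_def of_bool_def)
      ultimately show ?thesis unfolding measure_escape by (simp add: mult.commute)
    qed
    have "measure (measure_pmf (p (real j * h) y)) (- S) \<le> real j * (h * \<epsilon>)" if "y \<in> S" for j y
      using that
    proof (induction j arbitrary: y)
      case 0
      then show ?case by (simp add: semigroup_0)
    next
      case (Suc j)
      have "measure (measure_pmf (p (h + real j * h) y)) (- S) \<le> measure (measure_pmf (p h y)) (- S) +
          (\<Sum>z\<in>S. pmf (p h y) z * measure (measure_pmf (p (real j * h) z)) (- S))"
        using h Suc.prems by (intro measure_escape_add) auto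
      also have "\<dots> \<le> h * \<epsilon> + (\<Sum>z\<in>S. pmf (p h y) z * (real j * (h * \<epsilon>)))"
        using step Suc by (intro add_mono sum_mono mult_left_mono) auto
      also have "\<dots> = h * \<epsilon> + (\<Sum>z\<in>S. pmf (p h y) z) * (real j * (h * \<epsilon>))"
        by (simp add: sum_distrib_right)
      also have "\<dots> \<le> h * \<epsilon> + 1 * (real j * (h * \<epsilon>))"
      proof (intro add_left_mono mult_right_mono)
        show "(\<Sum>z\<in>S. pmf (p h y) z) \<le> 1"
          using fin by (simp add: measure_measure_pmf_finite[symmetric] measure_pmf.prob_le_1)
      qed (use h \<open>0 < \<epsilon>\<close> in auto)
      finally show ?case by (simp add: algebra_simps)
    qed
    from this[OF x, of k] show ?thesis using k0 by (simp add: h_def)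
  qed
  have "measure (measure_pmf (p t x)) (- S) \<le> 0"
  proof (rule field_le_epsilon)
    fix e :: real assume "0 < e"
    then show "measure (measure_pmf (p t x)) (- S) \<le> 0 + e"
      using le[of "e / t"] t False by simp
  qed
  then have "measure (measure_pmf (p t x)) (- S) = 0" by (simp add: measure_le_0_iff)
  then show ?thesis by (auto simp: measure_pmf_zero_iff)
qed (use assms in \<open>auto simp: semigroup_0\<close>)

text \<open>For \<open>x\<close> in \<open>S\<close> and nonnegative \<open>t\<close> this is the
  full expectation of \<open>f\<close> under \<open>p t x\<close>, since \<open>closed\<close>
  confines the law to \<open>S\<close>; as a finite sum it needs no integrability.\<close>

definition ev :: "real \<Rightarrow> 's \<Rightarrow> ('s \<Rightarrow> real) \<Rightarrow> real"
  where "ev t x f = (\<Sum>y\<in>S. pmf (p t x) y * f y)"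

lemma pmf_sum: "x \<in> S \<Longrightarrow> 0 \<le> t \<Longrightarrow> (\<Sum>y\<in>S. pmf (p t x) y) = 1"
  using sum_pmf_eq_1[OF fin closed] .

lemma ev_0: "x \<in> S \<Longrightarrow> ev 0 x f = f x"
  using fin by (simp add: ev_def semigroup_0 indicator_def if_distrib[of "\<lambda>c. c * _"] cong: if_cong)

lemma ev_add:
  assumes "0 \<le> s" "0 \<le> t" "x \<in> S"
  shows "ev (s + t) x f = ev s x (\<lambda>y. ev t y f)"
proof -
  have "pmf (p (s + t) x) z = (\<Sum>y\<in>S. pmf (p s x) y * pmf (p t y) z)" for z
    unfolding chapman_kolmogorov[OF assms] pmf_bind
    by (subst integral_measure_pmf_real[OF fin]) (use closed[OF assms(3,1)] in \<open>auto simp: mult.commute\<close>)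
  then show ?thesis
    unfolding ev_def by (simp add: sum_distrib_left sum_distrib_right mult.assoc) (rule sum.swap)
qed

lemma ev_abs_le:
  assumes "x \<in> S" "0 \<le> t" "\<And>y. y \<in> S \<Longrightarrow> \<bar>f y\<bar> \<le> B"
  shows "\<bar>ev t x f\<bar> \<le> B"
proof -
  have "\<bar>ev t x f\<bar> \<le> (\<Sum>y\<in>S. pmf (p t x) y * B)"
    unfolding ev_def by (rule order_trans[OF sum_abs sum_mono]) (use assms in \<open>auto simp: abs_mult intro: mult_left_mono\<close>)
  also have "\<dots> = B" using pmf_sum[OF assms(1,2)] by (simp add: sum_distrib_right[symmetric])
  finally show ?thesis .
qed

lemma ev_diff: "ev t x (\<lambda>y. f y - g y) = ev t x f - ev t x g"
  by (simp add: ev_def right_diff_distrib sum_subtractf)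

text \<open>Telescoping over a time grid of mesh \<open>h\<close>, each step contributes an error \<open>o(h)\<close>.\<close>

lemma backward_equation:
  assumes u: "\<And>t x. x \<in> S \<Longrightarrow> ((\<lambda>t. u t x) has_real_derivative (\<Sum>y\<in>S. Q x y * u t y)) (at t)"
    and x: "x \<in> S" and t: "0 \<le> t"
  shows "ev t x (u 0) = u t x"
proof (cases "t = 0")
  case False
  define u' where "u' t x = (\<Sum>y\<in>S. Q x y * u t y)" for t x
  have cont: "continuous_on {0..t} (\<lambda>s. u s y)" if "y \<in> S" for y
    using DERIV_isCont[OF u[OF that]] by (intro continuous_at_imp_continuous_on) auto
  have cont': "continuous_on {0..t} (\<lambda>s. u' s y)" for y
    unfolding u'_def by (intro continuous_intros cont)
  have "\<exists>B. \<forall>s\<in>{0..t}. \<bar>u s y\<bar> \<le> B" if "y \<in> S" for y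
    using compact_imp_bounded[OF compact_continuous_image[OF cont[OF that]]] by (auto simp: bounded_iff)
  then obtain b where b: "\<And>y s. y \<in> S \<Longrightarrow> s \<in> {0..t} \<Longrightarrow> \<bar>u s y\<bar> \<le> b y" by metis
  define B where "B = (\<Sum>y\<in>S. \<bar>b y\<bar>)"
  have B0: "0 \<le> B" unfolding B_def by (rule sum_nonneg) simp
  have le: "\<bar>u t x - ev t x (u 0)\<bar> \<le> t * ((1 + B) * \<epsilon>)" if \<epsilon>: "0 < \<epsilon>" for \<epsilon>
  proof -
    obtain h0 where h0: "0 < h0"
      "\<And>h x y. 0 < h \<Longrightarrow> h < h0 \<Longrightarrow> x \<in> S \<Longrightarrow> y \<in> S \<Longrightarrow>
        \<bar>pmf (p h x) y - of_bool (x = y) - h * Q x y\<bar> \<le> \<epsilon> * h"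
      using transition_expansion[OF \<epsilon>] by metis
    have "\<exists>d>0. \<forall>r\<in>{0..t}. \<forall>s\<in>{0..t}. \<bar>s - r\<bar> < d \<longrightarrow> \<bar>u' s y - u' r y\<bar> < \<epsilon>" for y
      using compact_uniformly_continuous[OF cont'[of y]] \<epsilon>
      unfolding uniformly_continuous_on_def by (simp add: dist_real_def)
    then obtain d where d: "\<And>y. 0 < d y"
      "\<And>y r s. r \<in> {0..t} \<Longrightarrow> s \<in> {0..t} \<Longrightarrow> \<bar>s - r\<bar> < d y \<Longrightarrow> \<bar>u' s y - u' r y\<bar> < \<epsilon>" by metis
    define h1 where "h1 = Min (insert h0 (d ` S))"
    have h1: "0 < h1" "h1 \<le> h0" "\<And>y. y \<in> S \<Longrightarrow> h1 \<le> d y"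
      unfolding h1_def using fin d(1) h0(1) by (auto simp: Min_gr_iff)
    obtain k where k: "t / h1 < real k" using reals_Archimedean2 by blast
    have k0: "0 < real k" using k h1 t False by (meson divide_nonneg_pos le_less_trans)
    define h where "h = t / real k"
    have h: "0 < h" "h < h1" using k k0 h1 t False unfolding h_def by (auto simp: field_simps)
    \<comment> \<open>The \<open>\<epsilon>\<close> in the factor comes from replacing the slope of
      \<open>u\<close> between \<open>r\<close> and \<open>r + h\<close> by the slope at
      \<open>r\<close>, the \<open>B * \<epsilon>\<close> from the error of the transition matrix
      tested against \<open>u r\<close>.\<close>
    have local: "\<bar>u (r + h) y - ev h y (u r)\<bar> \<le> h * ((1 + B) * \<epsilon>)" if y: "y \<in> S" and r: "0 \<le> r" "r + h \<le> t" for y r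
    proof -
      obtain z where z: "r < z" "z < r + h" "u (r + h) y - u r y = (r + h - r) * u' z y"
        using MVT2[of r "r + h" "\<lambda>s. u s y" "\<lambda>s. u' s y"] u[OF y] h unfolding u'_def by auto
      have "\<bar>u' z y - u' r y\<bar> < \<epsilon>"
        using z r h h1(3)[OF y] by (intro d(2)) auto
      then have 1: "\<bar>h * (u' z y - u' r y)\<bar> \<le> h * \<epsilon>"
        using h by (simp add: abs_mult)
      have 2: "\<bar>\<Sum>w\<in>S. (pmf (p h y) w - of_bool (y = w) - h * Q y w) * u r w\<bar> \<le> h * (B * \<epsilon>)"
      proof -
        have "\<bar>\<Sum>w\<in>S. (pmf (p h y) w - of_bool (y = w) - h * Q y w) * u r w\<bar> \<le>
            (\<Sum>w\<in>S. \<epsilon> * h * \<bar>b w\<bar>)"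
        proof (rule order_trans[OF sum_abs sum_mono])
          fix w assume w: "w \<in> S"
          have "\<bar>u r w\<bar> \<le> \<bar>b w\<bar>" using b[OF w, of r] r h by auto
          then show "\<bar>(pmf (p h y) w - of_bool (y = w) - h * Q y w) * u r w\<bar> \<le> \<epsilon> * h * \<bar>b w\<bar>"
            unfolding abs_mult using h0(2)[OF h(1) _ y w] h h1 \<epsilon> by (intro mult_mono) auto
        qed
        then show ?thesis by (simp add: B_def sum_distrib_left[symmetric] mult_ac)
      qed
      have "u (r + h) y - ev h y (u r) = h * (u' z y - u' r y) -
          (\<Sum>w\<in>S. (pmf (p h y) w - of_bool (y = w) - h * Q y w) * u r w)"
      proof -
        have "(\<Sum>w\<in>S. (pmf (p h y) w - of_bool (y = w) - h * Q y w) * u r w) = ev h y (u r) - u r y - h * u' r y"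
          using y fin by (simp add: left_diff_distrib sum_subtractf ev_def u'_def sum_distrib_left mult.assoc of_bool_def
              if_distrib[of "\<lambda>c. c * _"] cong: if_cong)
        then show ?thesis using z(3) by (simp add: algebra_simps)
      qed
      then show ?thesis using 1 2 by (simp add: algebra_simps)
    qed
    have "\<bar>u (real j * h) y - ev (real j * h) y (u 0)\<bar> \<le> real j * (h * ((1 + B) * \<epsilon>))"
      if "y \<in> S" "real j * h \<le> t" for j y
      using that
    proof (induction j arbitrary: y)
      case 0
      then show ?case by (simp add: ev_0)
    next
      case (Suc j)
      have jh: "real (Suc j) * h = real j * h + h" by (simp add: algebra_simps)
      have "real j * h \<le> t" using Suc.prems jh h by simp
      note IH = Suc.IH[OF _ this]
      \<comment> \<open>Averaging with a probability law does not increase the maximum of the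
        accumulated error, so the errors of the steps merely add up.\<close>
      have "\<bar>ev h y (\<lambda>z. u (real j * h) z - ev (real j * h) z (u 0))\<bar> \<le> real j * (h * ((1 + B) * \<epsilon>))"
        by (rule ev_abs_le) (use Suc.prems h IH in auto)
      moreover have "ev (real (Suc j) * h) y (u 0) = ev h y (\<lambda>z. ev (real j * h) z (u 0))"
        unfolding jh using ev_add[of h "real j * h" y] h Suc.prems by (simp add: add.commute)
      moreover have "\<bar>u (real j * h + h) y - ev h y (u (real j * h))\<bar> \<le> h * ((1 + B) * \<epsilon>)"
        using Suc.prems jh h by (intro local) auto
      ultimately show ?case unfolding ev_diff jh by (simp add: algebra_simps)
    qed
    from this[OF x, of k] show ?thesis using k0 by (simp add: h_def)
  qed
  have "\<bar>u t x - ev t x (u 0)\<bar> \<le> 0"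
  proof (rule field_le_epsilon)
    fix e :: real assume "0 < e"
    moreover have "0 < t * (1 + B)" using t False B0 by simp
    moreover from this have "t * ((1 + B) * (e / (t * (1 + B)))) = e" using t False B0 by auto
    ultimately show "\<bar>u t x - ev t x (u 0)\<bar> \<le> 0 + e"
      using le[of "e / (t * (1 + B))"] by simp
  qed
  then show ?thesis by simp
qed (use x in \<open>simp add: ev_0\<close>)

end


section \<open>Doob's maximal inequality for a process on a finite closed set\<close>

locale chain_process = finite_chain E p L S Q + prob_space M
  for E :: "'s set" and p L S Q and M :: "'w measure" +
  fixes X :: "real \<Rightarrow> 'w \<Rightarrow> 's"
  assumes X_meas: "\<And>t. 0 \<le> t \<Longrightarrow> X t \<in> measurable M (count_space E)"
    and X_right: "\<And>w t. w \<in> space M \<Longrightarrow> 0 \<le> t \<Longrightarrow> \<forall>\<^sub>F s in at_right t. X s w = X t w"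
    and X_fdd: "\<And>n t x. 0 \<le> t 0 \<Longrightarrow> (\<And>k. k < n \<Longrightarrow> t k \<le> t (Suc k)) \<Longrightarrow> (\<And>k. k \<le> n \<Longrightarrow> x k \<in> E) \<Longrightarrow>
        measure M {w \<in> space M. \<forall>k\<le>n. X (t k) w = x k} =
        measure M {w \<in> space M. X (t 0) w = x 0} *
          (\<Prod>k<n. pmf (p (t (Suc k) - t k) (x k)) (x (Suc k)))"
begin

lemma X_sets: "0 \<le> t \<Longrightarrow> {w \<in> space M. P (X t w)} \<in> sets M"
proof -
  assume t: "0 \<le> t"
  have "X t -` {x \<in> E. P x} \<inter> space M \<in> sets M"
    by (rule measurable_sets[OF X_meas[OF t]]) auto
  also have "X t -` {x \<in> E. P x} \<inter> space M = {w \<in> space M. P (X t w)}"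
    using measurable_space[OF X_meas[OF t]] by auto
  finally show ?thesis .
qed

text \<open>Jensen's inequality, read off from the nonnegativity of the variance of \<open>f\<close>
  under the transition law.\<close>

lemma square_ev_le:
  assumes "x \<in> S" "0 \<le> t"
  shows "(ev t x f - c)\<^sup>2 \<le> ev t x (\<lambda>y. (f y - c)\<^sup>2)"
proof -
  define m where "m = ev t x f"
  have "0 \<le> ev t x (\<lambda>y. (f y - m)\<^sup>2)"
    unfolding ev_def by (intro sum_nonneg) auto
  also have "\<dots> = (\<Sum>y\<in>S. pmf (p t x) y * (f y - c)\<^sup>2 - 2 * (m - c) * (pmf (p t x) y * f y)
      + (m\<^sup>2 - c\<^sup>2) * pmf (p t x) y)"
    unfolding ev_def by (intro sum.cong) (auto simp: power2_eq_square algebra_simps)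
  also have "\<dots> = ev t x (\<lambda>y. (f y - c)\<^sup>2) - 2 * (m - c) * m + (m\<^sup>2 - c\<^sup>2) * 1"
    using pmf_sum[OF assms]
    by (simp add: sum.distrib sum_subtractf sum_distrib_left[symmetric] ev_def[symmetric] m_def[symmetric])
  also have "\<dots> = ev t x (\<lambda>y. (f y - c)\<^sup>2) - (m - c)\<^sup>2"
    by (simp add: power2_eq_square algebra_simps)
  finally show ?thesis by (simp add: m_def)
qed

text \<open>\<open>ev (t - s) (X s w) f\<close> is the conditional expectation of the terminal value
  given the state at time \<open>s\<close>, as long as that state lies in \<open>S\<close>. Leaving
  \<open>S\<close> is therefore counted as bad; from a start in \<open>S\<close> this adds only a
  null event on each grid.\<close>

definition bad :: "('s \<Rightarrow> real) \<Rightarrow> real \<Rightarrow> real \<Rightarrow> real \<Rightarrow> real \<Rightarrow> 'w \<Rightarrow> bool"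
  where "bad f c \<epsilon> t s w \<longleftrightarrow> X s w \<notin> S \<or> \<epsilon> \<le> \<bar>ev (t - s) (X s w) f - c\<bar>"

text \<open>Doob's maximal inequality for the martingale \<open>ev (t - s) (X s) f\<close>, by backward induction over
  the grid: once the martingale is \<open>\<epsilon>\<close>-far from \<open>c\<close>, Jensen's inequality bounds the
  conditional expectation of \<open>(f (X t) - c)\<^sup>2\<close> below by \<open>\<epsilon>\<^sup>2\<close>.\<close>

lemma maximal_inequality_grid_aux:
  assumes \<epsilon>: "0 < \<epsilon>" and t: "0 < t" and m: "0 < m"
    and "k + d = m" and x: "\<And>l. l \<le> k \<Longrightarrow> x l \<in> S"
  defines "g \<equiv> \<lambda>l :: nat. real l * t / real m"
  shows "prob {w \<in> space M. (\<forall>l\<le>k. X (g l) w = x l) \<and> (\<exists>l\<in>{k..m}. bad f c \<epsilon> t (g l) w)} \<le>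
    prob {w \<in> space M. \<forall>l\<le>k. X (g l) w = x l} * ev (t - g k) (x k) (\<lambda>y. (f y - c)\<^sup>2) / \<epsilon>\<^sup>2"
proof -
  have g0: "0 \<le> g l" for l using t m by (simp add: g_def)
  have meas: "{w \<in> space M. \<forall>l\<le>k. X (g l) w = x l} \<in> sets M" for k x
    using X_sets[OF g0] by (intro sets.sets_Collect_countable_All' sets.sets_Collect_countable_All) auto
  show ?thesis
    using assms(4,5)
  proof (induction d arbitrary: k x)
    case 0
    have km: "k = m" and gk: "t - g k = 0" using 0 m by (auto simp: g_def)
    have xk: "x k \<in> S" using 0 by simp
    show ?case
    proof (cases "\<epsilon> \<le> \<bar>f (x k) - c\<bar>")
      case True
      then have "1 \<le> (f (x k) - c)\<^sup>2 / \<epsilon>\<^sup>2"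
        using \<epsilon> power_mono[OF True, of 2] by simp
      then have "prob {w \<in> space M. \<forall>l\<le>k. X (g l) w = x l} * 1 \<le>
          prob {w \<in> space M. \<forall>l\<le>k. X (g l) w = x l} * ((f (x k) - c)\<^sup>2 / \<epsilon>\<^sup>2)"
        by (intro mult_left_mono) auto
      moreover have "prob {w \<in> space M. (\<forall>l\<le>k. X (g l) w = x l) \<and> (\<exists>l\<in>{k..m}. bad f c \<epsilon> t (g l) w)} \<le>
          prob {w \<in> space M. \<forall>l\<le>k. X (g l) w = x l}"
        by (rule finite_measure_mono[OF _ meas]) blast
      ultimately show ?thesis unfolding gk ev_0[OF xk] by simp
    next
      case False
      have "\<not> bad f c \<epsilon> t (g k) w" if "X (g k) w = x k" for w
        unfolding bad_def that gk ev_0[OF xk] using False xk by blast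
      then have empty: "{w \<in> space M. (\<forall>l\<le>k. X (g l) w = x l) \<and> (\<exists>l\<in>{k..m}. bad f c \<epsilon> t (g l) w)} = {}"
        unfolding km by fastforce
      show ?thesis unfolding empty gk ev_0[OF xk] by simp
    qed
  next
    case (Suc d)
    define h where "h = t / real m"
    have h: "0 < h" using t m by (simp add: h_def)
    have gS: "g (Suc l) = g l + h" for l using m by (simp add: g_def h_def field_simps)
    have meas_bad: "{w \<in> space M. \<exists>l\<in>{j..m}. bad f c \<epsilon> t (g l) w} \<in> sets M" for j
      unfolding bad_def
      using X_sets[OF g0] by (intro sets.sets_Collect_finite_Ex) auto
    have xk: "x k \<in> S" using Suc by simp
    have "g (Suc k) \<le> t" using Suc.prems(1) t m by (auto simp: g_def field_simps mult_right_mono)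
    then have gt: "g k + h \<le> t" by (simp add: gS)
    define V where "V s y = ev s y (\<lambda>y. (f y - c)\<^sup>2)" for s y
    define C where "C = {w \<in> space M. \<forall>l\<le>k. X (g l) w = x l}"
    define D where "D j = {w \<in> space M. \<exists>l\<in>{j..m}. bad f c \<epsilon> t (g l) w}" for j
    define Y where "Y y = {w \<in> space M. X (g (Suc k)) w = y}" for y
    have CM: "C \<in> sets M" unfolding C_def by (rule meas)
    have DM: "D j \<in> sets M" for j unfolding D_def by (rule meas_bad)
    have YM: "Y y \<in> sets M" for y unfolding Y_def by (rule X_sets[OF g0])
    have goal_set: "{w \<in> space M. (\<forall>l\<le>k. X (g l) w = x l) \<and> (\<exists>l\<in>{k..m}. bad f c \<epsilon> t (g l) w)} = C \<inter> D k"
      unfolding C_def D_def by auto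
    have "prob (C \<inter> D k) \<le> prob C * V (t - g k) (x k) / \<epsilon>\<^sup>2"
    proof (cases "\<epsilon> \<le> \<bar>ev (t - g k) (x k) f - c\<bar>")
      case True
      \<comment> \<open>The martingale is already far from \<open>c\<close> at step
        \<open>k\<close>, so the right-hand side exceeds the probability of the whole cylinder and
        the future is irrelevant.\<close>
      have "\<epsilon>\<^sup>2 \<le> (ev (t - g k) (x k) f - c)\<^sup>2" using \<epsilon> power_mono[OF True, of 2] by simp
      also have "\<dots> \<le> V (t - g k) (x k)" unfolding V_def using xk gt h by (intro square_ev_le) auto
      finally have "1 \<le> V (t - g k) (x k) / \<epsilon>\<^sup>2" using \<epsilon> by simp
      then have "prob C * 1 \<le> prob C * (V (t - g k) (x k) / \<epsilon>\<^sup>2)" by (intro mult_left_mono) auto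
      moreover have "prob (C \<inter> D k) \<le> prob C" by (rule finite_measure_mono[OF _ CM]) blast
      ultimately show ?thesis by simp
    next
      case False
      have "{k..m} = insert k {Suc k..m}" using Suc.prems(1) by auto
      then have CD: "C \<inter> D k = C \<inter> D (Suc k)"
        using False xk unfolding C_def D_def bad_def by auto
      have cyl: "C \<inter> Y y = {w \<in> space M. \<forall>l\<le>Suc k. X (g l) w = (x(Suc k := y)) l}" for y
        unfolding C_def Y_def by (auto simp: le_Suc_eq)
      have step: "prob (C \<inter> Y y) = prob C * pmf (p h (x k)) y" if y: "y \<in> S" for y
      proof -
        have "prob {w \<in> space M. \<forall>l\<le>Suc k. X (g l) w = (x(Suc k := y)) l} =
            prob {w \<in> space M. X (g 0) w = (x(Suc k := y)) 0} *
            (\<Prod>l<Suc k. pmf (p (g (Suc l) - g l) ((x(Suc k := y)) l)) ((x(Suc k := y)) (Suc l)))"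
          using Suc.prems(2) sub y h g0 by (intro X_fdd) (auto simp: gS)
        moreover have "prob {w \<in> space M. \<forall>l\<le>k. X (g l) w = x l} =
            prob {w \<in> space M. X (g 0) w = x 0} *
            (\<Prod>l<k. pmf (p (g (Suc l) - g l) (x l)) (x (Suc l)))"
          using Suc.prems(2) sub h g0 by (intro X_fdd) (auto simp: gS)
        moreover have "(\<Prod>l<k. pmf (p (g (Suc l) - g l) ((x(Suc k := y)) l)) ((x(Suc k := y)) (Suc l))) =
            (\<Prod>l<k. pmf (p (g (Suc l) - g l) (x l)) (x (Suc l)))"
          by (intro prod.cong) auto
        ultimately show ?thesis unfolding cyl unfolding C_def by (simp add: gS)
      qed
      have disj: "disjoint_family_on (\<lambda>y. C \<inter> Y y) S"
        by (auto simp: disjoint_family_on_def Y_def)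
      \<comment> \<open>Step \<open>k\<close> itself is not bad, so the cylinder is split by the
        next state. The pieces over \<open>S\<close> carry all its probability by
        \<open>pmf_sum\<close>; the rest is null.\<close>
      have "prob (\<Union>y\<in>S. C \<inter> Y y) = (\<Sum>y\<in>S. prob (C \<inter> Y y))"
        using CM YM by (intro finite_measure_finite_Union fin disj) (auto intro: sets.Int)
      also have "\<dots> = (\<Sum>y\<in>S. prob C * pmf (p h (x k)) y)" using step by simp
      also have "\<dots> = prob C" using pmf_sum[OF xk, of h] h by (simp add: sum_distrib_left[symmetric])
      finally have U: "prob (\<Union>y\<in>S. C \<inter> Y y) = prob C" .
      have UM: "(\<Union>y\<in>S. C \<inter> Y y) \<in> sets M" using CM YM fin by auto
      have "prob (C - (\<Union>y\<in>S. C \<inter> Y y)) = prob C - prob (\<Union>y\<in>S. C \<inter> Y y)"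
        using CM UM by (intro finite_measure_Diff) auto
      then have null: "prob (C - (\<Union>y\<in>S. C \<inter> Y y)) = 0" using U by simp
      have "prob (C \<inter> D k) \<le> prob ((C - (\<Union>y\<in>S. C \<inter> Y y)) \<union> (\<Union>y\<in>S. C \<inter> Y y \<inter> D (Suc k)))"
        unfolding CD
      proof (rule finite_measure_mono)
        show "(C - (\<Union>y\<in>S. C \<inter> Y y)) \<union> (\<Union>y\<in>S. C \<inter> Y y \<inter> D (Suc k)) \<in> sets M"
          using CM UM DM YM fin by (intro sets.Un sets.Diff sets.finite_UN sets.Int) auto
      qed blast
      also have "\<dots> \<le> prob (C - (\<Union>y\<in>S. C \<inter> Y y)) + prob (\<Union>y\<in>S. C \<inter> Y y \<inter> D (Suc k))"
        using CM UM DM YM fin by (intro measure_Un_le sets.Diff sets.finite_UN sets.Int) auto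
      also have "\<dots> \<le> 0 + (\<Sum>y\<in>S. prob (C \<inter> Y y \<inter> D (Suc k)))"
        unfolding null using CM DM YM fin by (intro add_left_mono measure_UNION_le sets.Int) auto
      also have "(\<Sum>y\<in>S. prob (C \<inter> Y y \<inter> D (Suc k))) \<le>
          (\<Sum>y\<in>S. prob C * pmf (p h (x k)) y * V (t - g (Suc k)) y / \<epsilon>\<^sup>2)"
      proof (rule sum_mono)
        fix y assume y: "y \<in> S"
        have CYD: "C \<inter> Y y \<inter> D (Suc k) = {w \<in> space M. (\<forall>l\<le>Suc k. X (g l) w = (x(Suc k := y)) l) \<and>
            (\<exists>l\<in>{Suc k..m}. bad f c \<epsilon> t (g l) w)}"
          unfolding cyl D_def by blast
        have "prob (C \<inter> Y y \<inter> D (Suc k)) \<le> prob (C \<inter> Y y) *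
            ev (t - g (Suc k)) ((x(Suc k := y)) (Suc k)) (\<lambda>y. (f y - c)\<^sup>2) / \<epsilon>\<^sup>2"
          unfolding CYD unfolding cyl
          by (rule Suc.IH) (use Suc.prems y in auto)
        then show "prob (C \<inter> Y y \<inter> D (Suc k)) \<le>
            prob C * pmf (p h (x k)) y * V (t - g (Suc k)) y / \<epsilon>\<^sup>2"
          unfolding step[OF y] V_def by simp
      qed
      also have "\<dots> = prob C * ev h (x k) (\<lambda>y. V (t - g (Suc k)) y) / \<epsilon>\<^sup>2"
        unfolding ev_def by (simp add: sum_distrib_left sum_divide_distrib mult.assoc)
      \<comment> \<open>The bounds of the induction hypothesis, averaged over one step, recombine by
        Chapman-Kolmogorov.\<close>
      also have "ev h (x k) (\<lambda>y. V (t - g (Suc k)) y) = V (t - g k) (x k)"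
        unfolding V_def using ev_add[of h "t - g (Suc k)" "x k"] h xk gt by (simp add: gS)
      finally show ?thesis by simp
    qed
    then show ?case unfolding goal_set unfolding C_def V_def .
  qed
qed

lemma maximal_inequality_grid:
  assumes \<epsilon>: "0 < \<epsilon>" and t: "0 < t" and m: "0 < m" and x: "x \<in> S"
  shows "prob {w \<in> space M. X 0 w = x \<and> (\<exists>l\<le>m. bad f c \<epsilon> t (real l * t / real m) w)} \<le>
    prob {w \<in> space M. X 0 w = x} * ev t x (\<lambda>y. (f y - c)\<^sup>2) / \<epsilon>\<^sup>2"
proof -
  have "{w \<in> space M. X 0 w = x \<and> (\<exists>l\<le>m. bad f c \<epsilon> t (real l * t / real m) w)} =
      {w \<in> space M. (\<forall>l\<le>0. X (real l * t / real m) w = x) \<and>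
        (\<exists>l\<in>{0..m}. bad f c \<epsilon> t (real l * t / real m) w)}"
    by auto
  moreover have "{w \<in> space M. X 0 w = x} = {w \<in> space M. \<forall>l\<le>0. X (real l * t / real m) w = x}"
    by simp
  ultimately show ?thesis
    using maximal_inequality_grid_aux[OF \<epsilon> t m, of 0 m "\<lambda>_. x" f c, OF _ x] by simp
qed

text \<open>The strict inequality makes the exceptional condition persist for a short time to the
  right: the path is locally constant there and \<open>ev\<close> is continuous in time. Some dyadic
  grid point therefore detects it. The event is an uncountable union over \<open>s\<close>, hence
  the measurable cover \<open>B\<close>.\<close>

lemma maximal_inequality:
  assumes \<epsilon>: "0 < \<epsilon>" and t: "0 < t" and x: "x \<in> S"
    and cont: "\<And>y. y \<in> S \<Longrightarrow> continuous_on {0..t} (\<lambda>s. ev s y f)"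
  shows "\<exists>B\<in>sets M. {w \<in> space M. X 0 w = x \<and>
      (\<exists>s\<in>{0..t}. X s w \<notin> S \<or> \<epsilon> < \<bar>ev (t - s) (X s w) f - c\<bar>)} \<subseteq> B \<and>
    prob B \<le> prob {w \<in> space M. X 0 w = x} * ev t x (\<lambda>y. (f y - c)\<^sup>2) / \<epsilon>\<^sup>2"
proof -
  define B where "B j = {w \<in> space M. X 0 w = x \<and>
    (\<exists>l\<le>2 ^ j. bad f c \<epsilon> t (real l * t / real (2 ^ j)) w)}" for j :: nat
  have BM: "B j \<in> sets M" for j
  proof -
    have "{w \<in> space M. \<exists>l\<in>{..2 ^ j}. bad f c \<epsilon> t (real l * t / real (2 ^ j)) w} \<in> sets M"
      unfolding bad_def using t by (intro sets.sets_Collect_finite_Ex X_sets) auto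
    from sets.sets_Collect_conj[OF X_sets[of 0 "\<lambda>y. y = x", OF order_refl] this]
    show ?thesis unfolding B_def by (simp only: Bex_def atMost_iff conj_commute)
  qed
  have inc: "incseq B"
  proof (rule incseq_SucI)
    fix j
    show "B j \<subseteq> B (Suc j)"
    proof
      fix w assume "w \<in> B j"
      then obtain l where l: "w \<in> space M" "X 0 w = x" "l \<le> 2 ^ j" "bad f c \<epsilon> t (real l * t / real (2 ^ j)) w"
        unfolding B_def by blast
      have "real l * t / real (2 ^ j) = real (2 * l) * t / real (2 ^ Suc j)" by simp
      then show "w \<in> B (Suc j)"
        unfolding B_def using l by (auto intro!: exI[of _ "2 * l"])
    qed
  qed
  have "prob (\<Union>j. B j) \<le> prob {w \<in> space M. X 0 w = x} * ev t x (\<lambda>y. (f y - c)\<^sup>2) / \<epsilon>\<^sup>2"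
  proof (rule LIMSEQ_le_const2)
    show "(\<lambda>j. prob (B j)) \<longlonglongrightarrow> prob (\<Union>j. B j)"
      using BM inc by (intro finite_Lim_measure_incseq) auto
    show "\<exists>n. \<forall>j\<ge>n. prob (B j) \<le> prob {w \<in> space M. X 0 w = x} * ev t x (\<lambda>y. (f y - c)\<^sup>2) / \<epsilon>\<^sup>2"
      using maximal_inequality_grid[OF \<epsilon> t, of "2 ^ _" x f c] x unfolding B_def by auto
  qed
  moreover have "{w \<in> space M. X 0 w = x \<and>
      (\<exists>s\<in>{0..t}. X s w \<notin> S \<or> \<epsilon> < \<bar>ev (t - s) (X s w) f - c\<bar>)} \<subseteq> (\<Union>j. B j)"
  proof (clarify)
    fix w s assume w: "w \<in> space M" "x = X 0 w" and s: "s \<in> {0..t}"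
      and b: "X s w \<notin> S \<or> \<epsilon> < \<bar>ev (t - s) (X s w) f - c\<bar>"
    show "w \<in> (\<Union>j. B j)"
    proof (cases "s = t")
      case True
      \<comment> \<open>At \<open>s = t\<close> there is no room to the right, but \<open>t\<close>
        is itself a point of the coarsest grid.\<close>
      then have "bad f c \<epsilon> t (real 1 * t / real (2 ^ 0)) w" using b by (auto simp: bad_def)
      then have "w \<in> B 0" unfolding B_def using w by (auto intro!: exI[of _ 1])
      then show ?thesis by blast
    next
      case False
      then have st: "0 \<le> s" "s < t" using s by auto
      have "\<forall>\<^sub>F r in at_right s. bad f c \<epsilon> t r w"
      proof (cases "X s w \<in> S")
        case True
        have "continuous_on {0..t} (\<lambda>r. ev (t - r) (X s w) f)"
          by (rule continuous_on_compose2[OF cont[OF True]]) (auto intro!: continuous_intros)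
        then have "((\<lambda>r. ev (t - r) (X s w) f) \<longlongrightarrow> ev (t - s) (X s w) f) (at s within {0..t})"
          using s by (auto simp: continuous_on_def)
        then have "((\<lambda>r. ev (t - r) (X s w) f) \<longlongrightarrow> ev (t - s) (X s w) f) (at s within {s..t})"
          by (rule tendsto_within_subset) (use st in auto)
        then have "((\<lambda>r. ev (t - r) (X s w) f) \<longlongrightarrow> ev (t - s) (X s w) f) (at_right s)"
          by (simp add: at_within_Icc_at_right[OF st(2)])
        then have "((\<lambda>r. \<bar>ev (t - r) (X s w) f - c\<bar>) \<longlongrightarrow> \<bar>ev (t - s) (X s w) f - c\<bar>) (at_right s)"
          by (intro tendsto_intros)
        from order_tendstoD(1)[OF this] b True
        have "\<forall>\<^sub>F r in at_right s. \<epsilon> < \<bar>ev (t - r) (X s w) f - c\<bar>" by blast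
        with X_right[OF w(1) st(1)] show ?thesis
          by eventually_elim (auto simp: bad_def)
      next
        case False
        show ?thesis
          using X_right[OF w(1) st(1)] by eventually_elim (use False in \<open>auto simp: bad_def\<close>)
      qed
      then obtain r where r: "s < r" "\<And>q. s < q \<Longrightarrow> q < r \<Longrightarrow> bad f c \<epsilon> t q w"
        unfolding eventually_at_right_field by blast
      \<comment> \<open>On a grid of mesh below \<open>\<delta>\<close>, the first grid point
        strictly after \<open>s\<close> lies before \<open>min r t\<close>, where the path is still
        bad; \<open>l\<close> is its index.\<close>
      define \<delta> where "\<delta> = min r t - s"
      have \<delta>: "0 < \<delta>" using r st by (simp add: \<delta>_def)
      obtain j where j: "t / \<delta> < 2 ^ j" using real_arch_pow[of 2 "t / \<delta>"] by auto
      then have j': "t / 2 ^ j < \<delta>" using \<delta> by (simp add: field_simps)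
      define l where "l = nat \<lfloor>s * 2 ^ j / t\<rfloor> + 1"
      have l: "real l = of_int \<lfloor>s * 2 ^ j / t\<rfloor> + 1" unfolding l_def using st t by simp
      have "s * 2 ^ j / t < real l" "real l \<le> s * 2 ^ j / t + 1" unfolding l by linarith+
      then have "s < real l * t / 2 ^ j" "real l * t / 2 ^ j \<le> s + t / 2 ^ j"
        using t by (auto simp: field_simps)
      then have ll: "s < real l * t / 2 ^ j" "real l * t / 2 ^ j < min r t"
        using j' by (auto simp: \<delta>_def)
      then have "bad f c \<epsilon> t (real l * t / real (2 ^ j)) w" using r(2) by auto
      moreover have "real l < 2 ^ j" using ll(2) t by (simp add: field_simps)
      then have "l \<le> 2 ^ j" by (metis less_imp_le of_nat_less_iff of_nat_numeral of_nat_power)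
      ultimately have "w \<in> B j" unfolding B_def using w by auto
      then show ?thesis by blast
    qed
  qed
  ultimately show ?thesis using BM by (intro bexI[of _ "\<Union>j. B j"]) auto
qed

end


section \<open>Moments of the urn process\<close>

locale urn_boxes = urn_rates +
  fixes N :: nat
  assumes N_pos: "1 \<le> N"
begin

definition rate :: "nat \<Rightarrow> nat \<Rightarrow> real"
  where "rate i j = lam (real i / real N) (real j / real N) / real N"

definition box_drift :: "(nat \<Rightarrow> real) \<Rightarrow> nat \<Rightarrow> real"
  where "box_drift h i = (\<Sum>j=1..N. rate i j * (h j - h i))"

definition lin :: "(nat \<Rightarrow> real) \<Rightarrow> (nat \<Rightarrow> nat) \<Rightarrow> real"
  where "lin h x = (\<Sum>i=1..N. real (x i) * h i)"

definition states :: "nat \<Rightarrow> (nat \<Rightarrow> nat) set"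
  where "states n = {x \<in> urn_states N. (\<Sum>i=1..N. x i) = n}"

abbreviation gen :: "((nat \<Rightarrow> nat) \<Rightarrow> real) \<Rightarrow> (nat \<Rightarrow> nat) \<Rightarrow> real"
  where "gen \<equiv> ehrenfest_generator N lam"

lemma gen_eq: "gen f x = (\<Sum>i=1..N. \<Sum>j=1..N. real (x i) * rate i j * (f (move_ball i j x) - f x))"
  by (simp add: ehrenfest_generator_def rate_def)

lemma box_in_interval: "i \<in> {1..N} \<Longrightarrow> real i / real N \<in> {0..1}"
  by (auto simp: field_simps)

lemma rate_abs_le: "i \<in> {1..N} \<Longrightarrow> j \<in> {1..N} \<Longrightarrow> \<bar>rate i j\<bar> \<le> \<Lambda> / real N"
  using lam_bound[OF box_in_interval box_in_interval] by (simp add: rate_def divide_right_mono)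

lemma box_drift_abs_le:
  assumes "i \<in> {1..N}" "\<And>j. j \<in> {1..N} \<Longrightarrow> \<bar>h j\<bar> \<le> H"
  shows "\<bar>box_drift h i\<bar> \<le> 2 * \<Lambda> * H"
proof -
  have "\<bar>box_drift h i\<bar> \<le> (\<Sum>j=1..N. \<Lambda> / real N * (2 * H))"
    unfolding box_drift_def
  proof (rule order_trans[OF sum_abs sum_mono])
    fix j assume j: "j \<in> {1..N}"
    have "\<bar>h j - h i\<bar> \<le> 2 * H" using assms(2)[OF j] assms(2)[OF assms(1)] by linarith
    then show "\<bar>rate i j * (h j - h i)\<bar> \<le> \<Lambda> / real N * (2 * H)"
      unfolding abs_mult using rate_abs_le[OF assms(1) j] by (intro mult_mono) (auto intro: order_trans[OF abs_ge_zero])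
  qed
  also have "\<dots> = 2 * \<Lambda> * H" using N_pos by simp
  finally show ?thesis .
qed

lemma box_drift_power_abs_le:
  assumes "\<And>j. j \<in> {1..N} \<Longrightarrow> \<bar>h j\<bar> \<le> H" and "i \<in> {1..N}"
  shows "\<bar>(box_drift ^^ n) h i\<bar> \<le> H * (2 * \<Lambda>) ^ n"
  using assms(2)
proof (induction n arbitrary: i)
  case (Suc n)
  show ?case
    using box_drift_abs_le[OF Suc.prems, of "(box_drift ^^ n) h" "H * (2 * \<Lambda>) ^ n"] Suc.IH
    by (simp add: mult_ac)
qed (use assms in simp)

lemma exp_type_box_drift:
  assumes "\<And>j. j \<in> {1..N} \<Longrightarrow> \<bar>h j\<bar> \<le> H" and "i \<in> {1..N}"
  shows "exp_type H (2 * \<Lambda>) (\<lambda>n. (box_drift ^^ n) h i)"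
  using box_drift_power_abs_le[OF assms] Lam_nonneg order_trans[OF abs_ge_zero assms(1)[OF assms(2)]]
  by (simp add: exp_type_def)

text \<open>Coordinate \<open>i\<close> of the exponential of \<open>t\<close> times
  \<open>box_drift\<close>, applied to \<open>h\<close>.\<close>

definition box_flow :: "(nat \<Rightarrow> real) \<Rightarrow> real \<Rightarrow> nat \<Rightarrow> real"
  where "box_flow h t i = exp_series (\<lambda>n. (box_drift ^^ n) h i) t"

lemma box_flow_0 [simp]: "box_flow h 0 = h"
  by (auto simp: box_flow_def exp_series_0)

lemma bounded_on_boxes: obtains H where "\<And>j. j \<in> {1..N} \<Longrightarrow> \<bar>h j\<bar> \<le> (H :: real)"
proof
  show "\<bar>h j\<bar> \<le> (\<Sum>j=1..N. \<bar>h j\<bar>)" if "j \<in> {1..N}" for j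
    using that by (intro member_le_sum) auto
qed

lemma box_flow_has_derivative:
  assumes i: "i \<in> {1..N}"
  shows "((\<lambda>t. box_flow h t i) has_real_derivative box_drift (box_flow h t) i) (at t)"
proof -
  obtain H where H: "\<And>j. j \<in> {1..N} \<Longrightarrow> \<bar>h j\<bar> \<le> H" using bounded_on_boxes by blast
  note e = exp_type_box_drift[of h H, OF H]
  have "exp_series (\<lambda>n. (box_drift ^^ Suc n) h i) t =
      exp_series (\<lambda>n. \<Sum>j=1..N. rate i j * (1 * (box_drift ^^ n) h j + (- 1) * (box_drift ^^ n) h i)) t"
    by (simp add: box_drift_def)
  also have "\<dots> = (\<Sum>j=1..N. rate i j * exp_series (\<lambda>n. 1 * (box_drift ^^ n) h j + (- 1) * (box_drift ^^ n) h i) t)"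
  proof (rule exp_series_sum)
    fix j assume j: "j \<in> {1..N}"
    have "\<bar>1 * (box_drift ^^ n) h j + (- 1) * (box_drift ^^ n) h i\<bar> \<le> 2 * H * (2 * \<Lambda>) ^ n" for n
      using box_drift_power_abs_le[of h H j n, OF H j] box_drift_power_abs_le[of h H i n, OF H i] by linarith
    then show "exp_type (2 * H) (2 * \<Lambda>) (\<lambda>n. 1 * (box_drift ^^ n) h j + (- 1) * (box_drift ^^ n) h i)"
      using Lam_nonneg order_trans[OF abs_ge_zero H[OF i]] by (simp add: exp_type_def)
  qed simp
  also have "\<dots> = (\<Sum>j=1..N. rate i j * (1 * box_flow h t j + (- 1) * box_flow h t i))"
    unfolding box_flow_def
    by (intro sum.cong refl arg_cong2[where f = "(*)"] exp_series_linear[OF e e]) (use i in auto)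
  also have "\<dots> = box_drift (box_flow h t) i"
    by (simp add: box_drift_def)
  finally show ?thesis
    using exp_series_has_derivative[OF e[OF _ i], of t] H unfolding box_flow_def by simp
qed

lemma finite_states: "finite (states n)"
proof (rule finite_subset)
  show "states n \<subseteq> {1..N} \<rightarrow>\<^sub>E {..n}"
  proof
    fix x assume x: "x \<in> states n"
    then have "x i \<le> n" if "i \<in> {1..N}" for i
      using that member_le_sum[of i "{1..N}" x] by (simp add: states_def)
    then show "x \<in> {1..N} \<rightarrow>\<^sub>E {..n}"
      using x by (auto simp: states_def urn_states_def PiE_iff)
  qed
qed (intro finite_PiE; simp)

lemma states_subset: "states n \<subseteq> urn_states N"
  by (auto simp: states_def)

lemma real_move_ball:
  assumes "x i > 0"
  shows "real (move_ball i j x k) = real (x k) + of_bool (k = j) - of_bool (k = i)"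
  using assms by (auto simp: move_ball_def)

lemma lin_move_ball:
  assumes "x i > 0" "i \<in> {1..N}" "j \<in> {1..N}"
  shows "lin h (move_ball i j x) = lin h x + h j - h i"
  using assms(2,3) unfolding lin_def real_move_ball[where x = x and i = i, OF assms(1)]
  by (simp add: left_diff_distrib distrib_right sum.distrib sum_subtractf of_bool_def
      if_distrib[of "\<lambda>c. c * _"] cong: if_cong)

lemma move_ball_states:
  assumes "x i > 0" "i \<in> {1..N}" "j \<in> {1..N}" "x \<in> states n"
  shows "move_ball i j x \<in> states n"
proof -
  have "real (\<Sum>k=1..N. move_ball i j x k) = real (\<Sum>k=1..N. x k)"
    using lin_move_ball[where x = x and i = i and h = "\<lambda>_. 1", OF assms(1-3)] by (simp add: lin_def)
  then have "(\<Sum>k=1..N. move_ball i j x k) = (\<Sum>k=1..N. x k)" by (simp only: of_nat_eq_iff)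
  moreover have "move_ball i j x \<in> urn_states N"
    using assms by (auto simp: states_def urn_states_def move_ball_def PiE_iff extensional_def)
  ultimately show ?thesis using assms(4) by (simp add: states_def)
qed

text \<open>On \<open>states n\<close> a function is a combination of indicators of points, and
  moves out of an occupied box preserve \<open>n\<close>. A move out of an empty box would create a
  ball through the truncated subtraction, but its rate is 0.\<close>

lemma gen_states:
  assumes x: "x \<in> states n"
  shows "(\<Sum>y\<in>states n. gen (indicator {y}) x * u y) = gen u x"
proof -
  have ind: "(\<Sum>y\<in>states n. indicator {y} z * u y) = u z" if "z \<in> states n" for z
    using that finite_states by (simp add: indicator_def if_distrib[of "\<lambda>c. c * _"] cong: if_cong)
  have "(\<Sum>y\<in>states n. gen (indicator {y}) x * u y) = (\<Sum>i=1..N. \<Sum>j=1..N. \<Sum>y\<in>states n.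
      real (x i) * rate i j * (indicator {y} (move_ball i j x) - indicator {y} x) * u y)"
    unfolding gen_eq sum_distrib_right
    by (subst sum.swap, intro sum.cong refl, subst sum.swap) simp
  also have "\<dots> = (\<Sum>i=1..N. \<Sum>j=1..N. real (x i) * rate i j *
      ((\<Sum>y\<in>states n. indicator {y} (move_ball i j x) * u y) - (\<Sum>y\<in>states n. indicator {y} x * u y)))"
    by (simp add: sum_subtractf[symmetric] sum_distrib_left algebra_simps)
  also have "\<dots> = gen u x"
    unfolding gen_eq
  proof (intro sum.cong refl)
    fix i j assume ij: "i \<in> {1..N}" "j \<in> {1..N}"
    show "real (x i) * rate i j * ((\<Sum>y\<in>states n. indicator {y} (move_ball i j x) * u y) -
        (\<Sum>y\<in>states n. indicator {y} x * u y)) = real (x i) * rate i j * (u (move_ball i j x) - u x)"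
      using ind[OF x] ind[OF move_ball_states[OF _ ij x]] by (cases "x i = 0") auto
  qed
  finally show ?thesis .
qed

lemma gen_lin: "gen (lin h) x = lin (box_drift h) x"
proof -
  have "gen (lin h) x = (\<Sum>i=1..N. \<Sum>j=1..N. real (x i) * rate i j * (h j - h i))"
    unfolding gen_eq
  proof (intro sum.cong refl)
    fix i j assume ij: "i \<in> {1..N}" "j \<in> {1..N}"
    show "real (x i) * rate i j * (lin h (move_ball i j x) - lin h x) = real (x i) * rate i j * (h j - h i)"
      using lin_move_ball[OF _ ij] by (cases "x i = 0") auto
  qed
  then show ?thesis by (simp add: lin_def box_drift_def sum_distrib_left mult.assoc)
qed

lemma gen_add: "gen (\<lambda>x. f x + g x) x = gen f x + gen g x"
  unfolding gen_eq by (simp add: sum.distrib[symmetric] algebra_simps)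

text \<open>The last term is the carre du champ of \<open>lin h\<close>; it is again linear in the
  configuration, which closes the equation for second moments.\<close>

lemma gen_lin_square:
  "gen (\<lambda>x. (lin h x)\<^sup>2) x = 2 * lin h x * lin (box_drift h) x +
    lin (\<lambda>i. \<Sum>j=1..N. rate i j * (h j - h i)\<^sup>2) x"
proof -
  have "gen (\<lambda>x. (lin h x)\<^sup>2) x = (\<Sum>i=1..N. \<Sum>j=1..N.
      2 * lin h x * (real (x i) * rate i j * (h j - h i)) + real (x i) * rate i j * (h j - h i)\<^sup>2)"
    unfolding gen_eq
  proof (intro sum.cong refl)
    fix i j assume ij: "i \<in> {1..N}" "j \<in> {1..N}"
    show "real (x i) * rate i j * ((lin h (move_ball i j x))\<^sup>2 - (lin h x)\<^sup>2) =
        2 * lin h x * (real (x i) * rate i j * (h j - h i)) + real (x i) * rate i j * (h j - h i)\<^sup>2"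
    proof (cases "x i = 0")
      case False
      then have "lin h (move_ball i j x) = lin h x + h j - h i" using lin_move_ball[OF _ ij, of x h] by simp
      then show ?thesis by (simp only: power2_eq_square) (simp add: algebra_simps)
    qed simp
  qed
  moreover have "lin (box_drift h) x = (\<Sum>i=1..N. \<Sum>j=1..N. real (x i) * rate i j * (h j - h i))"
    by (simp add: lin_def box_drift_def sum_distrib_left mult.assoc)
  moreover have "lin (\<lambda>i. \<Sum>j=1..N. rate i j * (h j - h i)\<^sup>2) x =
      (\<Sum>i=1..N. \<Sum>j=1..N. real (x i) * rate i j * (h j - h i)\<^sup>2)"
    by (simp add: lin_def sum_distrib_left mult.assoc)
  ultimately show ?thesis by (simp add: sum.distrib sum_distrib_left)
qed

lemma lin_has_derivative:
  assumes "\<And>i. i \<in> {1..N} \<Longrightarrow> ((\<lambda>t. h t i) has_real_derivative h' i) (at t)"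
  shows "((\<lambda>t. lin (h t) x) has_real_derivative lin h' x) (at t)"
  unfolding lin_def by (intro DERIV_sum DERIV_cmult) (use assms in auto)

lemma lin_abs_le:
  assumes "\<And>i. i \<in> {1..N} \<Longrightarrow> \<bar>h i\<bar> \<le> H" and "x \<in> states n"
  shows "\<bar>lin h x\<bar> \<le> real n * H"
proof -
  have "\<bar>lin h x\<bar> \<le> (\<Sum>i=1..N. real (x i) * H)"
    unfolding lin_def by (rule order_trans[OF sum_abs sum_mono]) (use assms(1) in \<open>auto simp: abs_mult intro!: mult_left_mono\<close>)
  also have "\<dots> = real n * H"
    using assms(2) by (simp add: states_def sum_distrib_right[symmetric] of_nat_sum[symmetric] del: of_nat_sum)
  finally show ?thesis .
qed

lemma box_flow_abs_le:
  assumes "\<And>j. j \<in> {1..N} \<Longrightarrow> \<bar>h j\<bar> \<le> H" "i \<in> {1..N}"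
  shows "\<bar>box_flow h t i\<bar> \<le> H * exp (2 * \<Lambda> * \<bar>t\<bar>)"
  unfolding box_flow_def by (rule exp_series_bound[OF exp_type_box_drift[OF assms]])

context
  fixes p :: "real \<Rightarrow> (nat \<Rightarrow> nat) \<Rightarrow> (nat \<Rightarrow> nat) pmf" and n :: nat
  assumes sg: "transition_semigroup (urn_states N) p" and gen: "has_generator (urn_states N) p gen"
begin

interpretation finite_chain "urn_states N" p gen "states n" "\<lambda>x y. gen (indicator {y}) x"
proof
  show "(\<Sum>y\<in>states n. gen (indicator {y}) x) = 0" if "x \<in> states n" for x
    using gen_states[OF that, of "\<lambda>_. 1"] by (simp add: gen_eq)
qed (use sg gen finite_states states_subset in auto)

text \<open>Makes the interpretation, which is local to this context, available for building
  \<open>chain_process\<close> later.\<close>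

lemma urn_finite_chain:
  "finite_chain (urn_states N) p gen (states n) (\<lambda>x y. gen (indicator {y}) x)"
  by (rule finite_chain_axioms)

text \<open>By \<open>gen_lin\<close> linear functions are mapped to linear functions, so the
  backward equation reduces to the one for \<open>box_flow\<close>. Consequently
  \<open>lin (box_flow h (t - s))\<close> at the state of time \<open>s\<close> is the martingale to
  be controlled.\<close>

lemma ev_lin:
  assumes x: "x \<in> states n" and t: "0 \<le> t"
  shows "ev t x (lin h) = lin (box_flow h t) x"
proof -
  have "ev t x (\<lambda>x. lin (box_flow h 0) x) = lin (box_flow h t) x"
  proof (rule backward_equation[OF _ x t])
    fix t x assume "x \<in> states n"
    then have "(\<Sum>y\<in>states n. gen (indicator {y}) x * lin (box_flow h t) y) = lin (box_drift (box_flow h t)) x"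
      by (simp add: gen_states gen_lin)
    then show "((\<lambda>t. lin (box_flow h t) x) has_real_derivative
        (\<Sum>y\<in>states n. gen (indicator {y}) x * lin (box_flow h t) y)) (at t)"
      using lin_has_derivative[OF box_flow_has_derivative] by simp
  qed
  then show ?thesis by simp
qed

text \<open>The balls move independently, which gives the second moment in closed form.\<close>

lemma ev_lin_square:
  assumes x: "x \<in> states n" and t: "0 \<le> t"
  shows "ev t x (\<lambda>y. (lin h y)\<^sup>2) =
    (lin (box_flow h t) x)\<^sup>2 + lin (\<lambda>i. box_flow (\<lambda>i. (h i)\<^sup>2) t i - (box_flow h t i)\<^sup>2) x"
proof -
  \<comment> \<open>The summand \<open>box_flow (\<lambda>i. (h i)\<^sup>2) t i - (box_flow h t
    i)\<^sup>2\<close> is the variance of \<open>h\<close> at the box reached after time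
    \<open>t\<close> by one ball started in box \<open>i\<close>; the variances of the balls
    add.\<close>
  define u where "u t x = (lin (box_flow h t) x)\<^sup>2 +
    lin (\<lambda>i. box_flow (\<lambda>i. (h i)\<^sup>2) t i - (box_flow h t i)\<^sup>2) x" for t x
  have "ev t x (u 0) = u t x"
  proof (rule backward_equation[OF _ x t])
    fix t x assume x: "x \<in> states n"
    let ?w = "box_flow h t" and ?z = "box_flow (\<lambda>i. (h i)\<^sup>2) t"
    define d where "d = 2 * lin ?w x * lin (box_drift ?w) x + lin (\<lambda>i. box_drift ?z i - 2 * ?w i * box_drift ?w i) x"
    have "(\<Sum>y\<in>states n. gen (indicator {y}) x * u t y) = gen (u t) x"
      by (rule gen_states[OF x])
    also have "\<dots> = gen (\<lambda>x. (lin ?w x)\<^sup>2) x + gen (lin (\<lambda>i. ?z i - (?w i)\<^sup>2)) x"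
      unfolding u_def by (rule gen_add)
    also have "\<dots> = 2 * lin ?w x * lin (box_drift ?w) x +
        lin (\<lambda>i. (\<Sum>j=1..N. rate i j * (?w j - ?w i)\<^sup>2) + box_drift (\<lambda>i. ?z i - (?w i)\<^sup>2) i) x"
      unfolding gen_lin_square gen_lin by (simp add: lin_def sum.distrib distrib_left)
    \<comment> \<open>With \<open>w\<close> short for \<open>?w\<close>, the sum over
      \<open>j\<close> equals the drift of \<open>w\<close> squared minus \<open>2 w\<close> times
      the drift of \<open>w\<close>, so the drift of \<open>w\<close> squared cancels.\<close>
    also have "(\<lambda>i. (\<Sum>j=1..N. rate i j * (?w j - ?w i)\<^sup>2) + box_drift (\<lambda>i. ?z i - (?w i)\<^sup>2) i) =
        (\<lambda>i. box_drift ?z i - 2 * ?w i * box_drift ?w i)"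
    proof
      fix i
      show "(\<Sum>j=1..N. rate i j * (?w j - ?w i)\<^sup>2) + box_drift (\<lambda>i. ?z i - (?w i)\<^sup>2) i =
          box_drift ?z i - 2 * ?w i * box_drift ?w i"
        unfolding box_drift_def sum_distrib_left sum.distrib[symmetric] sum_subtractf[symmetric]
        by (intro sum.cong refl) (simp add: power2_eq_square algebra_simps)
    qed
    finally have eq: "(\<Sum>y\<in>states n. gen (indicator {y}) x * u t y) = d" unfolding d_def .
    have "((\<lambda>t. (lin (box_flow h t) x)\<^sup>2) has_real_derivative 2 * lin ?w x * lin (box_drift ?w) x) (at t)"
    proof -
      have "((\<lambda>t. lin (box_flow h t) x) has_real_derivative lin (box_drift ?w) x) (at t)"
        by (rule lin_has_derivative[OF box_flow_has_derivative])
      from DERIV_power[OF this, where n = 2] show ?thesis by (simp add: mult_ac)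
    qed
    moreover have "((\<lambda>t. lin (\<lambda>i. box_flow (\<lambda>i. (h i)\<^sup>2) t i - (box_flow h t i)\<^sup>2) x) has_real_derivative
        lin (\<lambda>i. box_drift ?z i - 2 * ?w i * box_drift ?w i) x) (at t)"
    proof (rule lin_has_derivative)
      fix i assume i: "i \<in> {1..N}"
      show "((\<lambda>t. box_flow (\<lambda>i. (h i)\<^sup>2) t i - (box_flow h t i)\<^sup>2) has_real_derivative
          box_drift ?z i - 2 * ?w i * box_drift ?w i) (at t)"
        using DERIV_power[OF box_flow_has_derivative[OF i, of h t], where n = 2]
        by (intro DERIV_diff box_flow_has_derivative i) (simp add: mult_ac)
    qed
    ultimately show "((\<lambda>t. u t x) has_real_derivative (\<Sum>y\<in>states n. gen (indicator {y}) x * u t y)) (at t)"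
      unfolding eq unfolding d_def u_def by (rule DERIV_add)
  qed
  moreover have "u 0 = (\<lambda>y. (lin h y)\<^sup>2)" by (auto simp: u_def lin_def)
  ultimately show ?thesis by (simp add: u_def)
qed

text \<open>A sum of \<open>n\<close> single-ball variances, each bounded by the second moment of
  one ball. The exponential factor is the price of the series bound for
  \<open>box_flow\<close>.\<close>

lemma ev_variance_le:
  assumes x: "x \<in> states n" and t: "0 \<le> t" and H: "\<And>j. j \<in> {1..N} \<Longrightarrow> \<bar>h j\<bar> \<le> H"
  shows "ev t x (\<lambda>y. (lin h y - lin (box_flow h t) x)\<^sup>2) \<le> real n * (H\<^sup>2 * exp (2 * \<Lambda> * t))"
proof -
  define m where "m = lin (box_flow h t) x"
  have "ev t x (\<lambda>y. (lin h y - m)\<^sup>2) = ev t x (\<lambda>y. (lin h y)\<^sup>2) - 2 * m * ev t x (lin h) + m\<^sup>2 * (\<Sum>y\<in>states n. pmf (p t x) y)"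
    unfolding ev_def
    by (simp add: power2_eq_square algebra_simps sum.distrib sum_subtractf sum_distrib_left)
  also have "\<dots> = lin (\<lambda>i. box_flow (\<lambda>i. (h i)\<^sup>2) t i - (box_flow h t i)\<^sup>2) x"
    unfolding ev_lin_square[OF x t] ev_lin[OF x t] pmf_sum[OF x t] m_def by (simp add: power2_eq_square)
  also have "\<dots> \<le> lin (\<lambda>i. box_flow (\<lambda>i. (h i)\<^sup>2) t i) x"
    unfolding lin_def by (intro sum_mono mult_left_mono) auto
  also have "\<dots> \<le> real n * (H\<^sup>2 * exp (2 * \<Lambda> * \<bar>t\<bar>))"
  proof (rule order_trans[OF abs_ge_self lin_abs_le[OF box_flow_abs_le x]])
    fix j assume "j \<in> {1..N}"
    then show "\<bar>(h j)\<^sup>2\<bar> \<le> H\<^sup>2" using power_mono[OF H, of j 2] by simp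
  qed
  finally show ?thesis using t by (simp add: m_def)
qed

end

end


section \<open>Poisson weights and Riemann sums\<close>

context prob_space
begin

text \<open>The law of \<open>Y\<close> has the density \<open>q\<close> with respect to counting
  measure, and for nonnegative \<open>g\<close> summability is integrability. Mean 0 is
  included.\<close>

lemma poisson_integral:
  assumes Y: "poisson_distributed M Y m" and S: "(\<lambda>k. exp (- m) * m ^ k / fact k * g k) sums s"
    and g: "\<And>k. 0 \<le> g k"
  shows "integrable M (\<lambda>\<omega>. g (Y \<omega>) :: real)" "expectation (\<lambda>\<omega>. g (Y \<omega>)) = s"
proof -
  define q where "q k = exp (- m) * m ^ k / fact k" for k
  have m: "0 \<le> m" and Ym: "Y \<in> measurable M (count_space UNIV)"
    and Yq: "\<And>k. measure M {\<omega> \<in> space M. Y \<omega> = k} = q k"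
    using Y unfolding poisson_distributed_def q_def by auto
  have q0: "0 \<le> q k" for k using m by (simp add: q_def)
  have D: "distr M (count_space UNIV) Y = density (count_space UNIV) (\<lambda>k. ennreal (q k))"
  proof (rule measure_eqI_countable[of _ UNIV])
    fix k
    have "emeasure (distr M (count_space UNIV) Y) {k} = emeasure M {\<omega> \<in> space M. Y \<omega> = k}"
      using Ym by (subst emeasure_distr) (auto intro!: arg_cong[where f = "emeasure M"])
    also have "\<dots> = ennreal (q k)" by (simp add: emeasure_eq_measure Yq)
    also have "\<dots> = emeasure (density (count_space UNIV) (\<lambda>k. ennreal (q k))) {k}"
      by (subst emeasure_density) (auto simp: nn_integral_count_space_indicator[symmetric]
        nn_integral_indicator_singleton)
    finally show "emeasure (distr M (count_space UNIV) Y) {k} =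
      emeasure (density (count_space UNIV) (\<lambda>k. ennreal (q k))) {k}" .
  qed auto
  have qg: "(\<lambda>k. q k * g k) sums s" using S by (simp add: q_def)
  have I: "integrable (count_space UNIV) (\<lambda>k. q k * g k)"
    using qg q0 g by (simp add: integrable_count_space_nat_iff abs_mult sums_iff)
  have ID: "integrable (distr M (count_space UNIV) Y) g"
    unfolding D using I q0 by (subst integrable_real_density) auto
  show "integrable M (\<lambda>\<omega>. g (Y \<omega>))"
    using integrable_distr[OF Ym ID] .
  have "expectation (\<lambda>\<omega>. g (Y \<omega>)) = integral\<^sup>L (distr M (count_space UNIV) Y) g"
    using Ym by (subst integral_distr) auto
  also have "\<dots> = integral\<^sup>L (count_space UNIV) (\<lambda>k. q k * g k)"
    unfolding D using q0 by (subst integral_real_density) auto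
  also have "\<dots> = s" using integral_count_space_nat[OF I] qg by (simp add: sums_iff)
  finally show "expectation (\<lambda>\<omega>. g (Y \<omega>)) = s" .
qed

lemma poisson_moments:
  assumes Y: "poisson_distributed M Y m"
  shows "integrable M (\<lambda>\<omega>. real (Y \<omega>))" "expectation (\<lambda>\<omega>. real (Y \<omega>)) = m"
    "integrable M (\<lambda>\<omega>. (real (Y \<omega>))\<^sup>2)" "expectation (\<lambda>\<omega>. (real (Y \<omega>))\<^sup>2) = m\<^sup>2 + m"
proof -
  have e0: "(\<lambda>k. exp (- m) * m ^ k / fact k) sums 1"
    using sums_mult[OF exp_converges[of m], of "exp (- m)"]
    by (simp add: exp_minus field_simps)
  \<comment> \<open>The identity k p_k = m p_(k-1) for Poisson weights reduces each moment to the
    previous ones; the term \<open>k = 0\<close> vanishes, so \<open>sums_Suc\<close> restores the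
    full series.\<close>
  have shift: "exp (- m) * m ^ Suc k / fact (Suc k) * real (Suc k) = m * (exp (- m) * m ^ k / fact k)" for k
    by (simp del: of_nat_Suc)
  have e1: "(\<lambda>k. exp (- m) * m ^ k / fact k * real k) sums m"
  proof -
    have "(\<lambda>k. exp (- m) * m ^ Suc k / fact (Suc k) * real (Suc k)) = (\<lambda>k. m * (exp (- m) * m ^ k / fact k))"
      unfolding shift ..
    then have "(\<lambda>k. exp (- m) * m ^ Suc k / fact (Suc k) * real (Suc k)) sums m"
      using sums_mult[OF e0, of m] by simp
    from sums_Suc[OF this] show ?thesis by simp
  qed
  have e2: "(\<lambda>k. exp (- m) * m ^ k / fact k * (real k)\<^sup>2) sums (m\<^sup>2 + m)"
  proof -
    have "(\<lambda>k. exp (- m) * m ^ Suc k / fact (Suc k) * (real (Suc k))\<^sup>2) =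
        (\<lambda>k. m * (exp (- m) * m ^ k / fact k * real k + exp (- m) * m ^ k / fact k))"
      unfolding power2_eq_square mult.assoc[symmetric] shift by (auto simp: algebra_simps add_divide_distrib)
    then have "(\<lambda>k. exp (- m) * m ^ Suc k / fact (Suc k) * (real (Suc k))\<^sup>2) sums (m\<^sup>2 + m)"
      using sums_mult[OF sums_add[OF e1 e0], of m] by (simp add: power2_eq_square algebra_simps)
    from sums_Suc[OF this] show ?thesis by simp
  qed
  show "integrable M (\<lambda>\<omega>. real (Y \<omega>))" "expectation (\<lambda>\<omega>. real (Y \<omega>)) = m"
    "integrable M (\<lambda>\<omega>. (real (Y \<omega>))\<^sup>2)" "expectation (\<lambda>\<omega>. (real (Y \<omega>))\<^sup>2) = m\<^sup>2 + m"
    using poisson_integral[OF Y e1] poisson_integral[OF Y e2] by auto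
qed

text \<open>Chebyshev's inequality: independence removes the mixed terms, and the variance of a
  Poisson variable is its mean.\<close>

lemma poisson_weighted_sum_deviation:
  assumes indep: "indep_vars (\<lambda>_. count_space UNIV) Y I" and I: "finite I"
    and Y: "\<And>i. i \<in> I \<Longrightarrow> poisson_distributed M (Y i) (m i)" and a: "0 < a"
  shows "measure M {\<omega> \<in> space M. a \<le> \<bar>(\<Sum>i\<in>I. w i * (real (Y i \<omega>) - m i))\<bar>} \<le> (\<Sum>i\<in>I. (w i)\<^sup>2 * m i) / a\<^sup>2"
proof -
  define Z where "Z i \<omega> = real (Y i \<omega>) - m i" for i \<omega>
  have mom: "integrable M (Z i)" "expectation (Z i) = 0"
    "integrable M (\<lambda>\<omega>. (Z i \<omega>)\<^sup>2)" "expectation (\<lambda>\<omega>. (Z i \<omega>)\<^sup>2) = m i" if "i \<in> I" for i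
  proof -
    note p = poisson_moments[OF Y[OF that]]
    have sq: "(\<lambda>\<omega>. (Z i \<omega>)\<^sup>2) = (\<lambda>\<omega>. (real (Y i \<omega>))\<^sup>2 - 2 * m i * real (Y i \<omega>) + (m i)\<^sup>2)"
      by (auto simp: Z_def power2_eq_square algebra_simps)
    show "integrable M (Z i)" "expectation (Z i) = 0"
      unfolding Z_def using p by (auto simp: prob_space)
    show "integrable M (\<lambda>\<omega>. (Z i \<omega>)\<^sup>2)"
      unfolding sq using p by auto
    show "expectation (\<lambda>\<omega>. (Z i \<omega>)\<^sup>2) = m i"
      unfolding sq using p by (simp add: prob_space power2_eq_square)
  qed
  have indZ: "indep_vars (\<lambda>_. borel) Z I"
    unfolding Z_def using indep by (rule indep_vars_compose2) auto
  have prodZ: "integrable M (\<lambda>\<omega>. Z i \<omega> * Z j \<omega>)"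
    "expectation (\<lambda>\<omega>. Z i \<omega> * Z j \<omega>) = (if i = j then m i else 0)" if ij: "i \<in> I" "j \<in> I" for i j
  proof -
    have "integrable M (\<lambda>\<omega>. Z i \<omega> * Z j \<omega>) \<and> expectation (\<lambda>\<omega>. Z i \<omega> * Z j \<omega>) = (if i = j then m i else 0)"
    proof (cases "i = j")
      case True
      then show ?thesis using mom(3,4)[OF ij(1)] by (simp add: power2_eq_square)
    next
      case False
      have "indep_vars (\<lambda>_. borel) Z {i, j}" by (rule indep_vars_subset[OF indZ]) (use ij in auto)
      from indep_vars_lebesgue_integral[OF _ this] indep_vars_integrable[OF _ this]
      show ?thesis using mom ij False by auto
    qed
    then show "integrable M (\<lambda>\<omega>. Z i \<omega> * Z j \<omega>)"
      "expectation (\<lambda>\<omega>. Z i \<omega> * Z j \<omega>) = (if i = j then m i else 0)" by auto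
  qed
  define W where "W \<omega> = (\<Sum>i\<in>I. w i * Z i \<omega>)" for \<omega>
  have sq: "(\<lambda>\<omega>. (W \<omega>)\<^sup>2) = (\<lambda>\<omega>. \<Sum>i\<in>I. \<Sum>j\<in>I. w i * w j * (Z i \<omega> * Z j \<omega>))"
    unfolding W_def power2_eq_square sum_product by (auto simp: mult_ac)
  have int: "integrable M (\<lambda>\<omega>. (W \<omega>)\<^sup>2)"
    unfolding sq by (intro Bochner_Integration.integrable_sum integrable_mult_right prodZ)
  have "expectation (\<lambda>\<omega>. (W \<omega>)\<^sup>2) = (\<Sum>i\<in>I. \<Sum>j\<in>I. w i * w j * (if i = j then m i else 0))"
    unfolding sq using prodZ by (simp add: Bochner_Integration.integral_sum)
  also have "\<dots> = (\<Sum>i\<in>I. (w i)\<^sup>2 * m i)"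
    using I by (intro sum.cong refl) (simp add: if_distrib power2_eq_square cong: if_cong)
  finally have E2: "expectation (\<lambda>\<omega>. (W \<omega>)\<^sup>2) = (\<Sum>i\<in>I. (w i)\<^sup>2 * m i)" .
  have E1: "expectation W = 0"
    unfolding W_def using mom by (simp add: Bochner_Integration.integral_sum)
  have "W \<in> borel_measurable M"
    unfolding W_def by (intro borel_measurable_sum borel_measurable_times) (use mom(1) in auto)
  note Chebyshev_inequality[OF this _ a]
  then have "measure M {\<omega> \<in> space M. a \<le> \<bar>W \<omega>\<bar>} \<le> (\<Sum>i\<in>I. (w i)\<^sup>2 * m i) / a\<^sup>2"
    using int by (simp add: E1 E2)
  then show ?thesis by (simp add: W_def Z_def)
qed

end

text \<open>Uniform continuity on the compact square yields one threshold for all \<open>x\<close>,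
  which is needed because \<open>x\<close> will be the grid point \<open>i / N\<close> itself and so
  moves with \<open>N\<close>.\<close>

lemma riemann_sum_uniform:
  fixes F :: "real \<Rightarrow> real \<Rightarrow> real"
  assumes F: "continuous_on ({0..1} \<times> {0..1}) (\<lambda>(x, y). F x y)" and \<epsilon>: "0 < \<epsilon>"
  shows "\<exists>N0. \<forall>N\<ge>N0. 1 \<le> N \<longrightarrow> (\<forall>x\<in>{0..1}.
    \<bar>(\<Sum>j=1..N. F x (real j / real N)) / real N - integral {0..1} (F x)\<bar> \<le> \<epsilon>)"
proof -
  have "uniformly_continuous_on ({0..1} \<times> {0..1}) (\<lambda>(x, y). F x y)"
    by (rule compact_uniformly_continuous[OF F]) (intro compact_Times; simp)
  then obtain d where d: "0 < d" "\<And>z z'. z \<in> {0..1} \<times> {0..1} \<Longrightarrow> z' \<in> {0..1} \<times> {0..1} \<Longrightarrow> dist z' z < d \<Longrightarrow>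
      dist ((\<lambda>(x, y). F x y) z') ((\<lambda>(x, y). F x y) z) < \<epsilon>"
    using \<epsilon> unfolding uniformly_continuous_on_def by metis
  obtain N0 where N0: "1 / d < real N0" using reals_Archimedean2 by blast
  have "\<bar>(\<Sum>j=1..N. F x (real j / real N)) / real N - integral {0..1} (F x)\<bar> \<le> \<epsilon>"
    if N: "N \<ge> N0" "1 \<le> N" and x: "x \<in> {0..1}" for N x
  proof -
    have Nd: "1 / real N < d"
    proof -
      have "1 / d < real N" using N0 N(1) by linarith
      then show ?thesis using d(1) N(2) by (simp add: field_simps)
    qed
    have "continuous_on {0..1} (\<lambda>y. (\<lambda>(x, y). F x y) (x, y))"
      by (rule continuous_on_compose2[OF F]) (use x in \<open>auto intro!: continuous_intros\<close>)
    then have int: "F x integrable_on {a..b}" if "0 \<le> a" "b \<le> 1" for a b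
      using that by (intro integrable_on_subinterval[OF integrable_continuous_interval]) auto
    \<comment> \<open>Cell by cell: on a cell of length \<open>1 / N\<close> the function differs
      from its value at the right end by at most \<open>\<epsilon>\<close>.\<close>
    have "\<bar>(\<Sum>j=1..k. F x (real j / real N)) / real N - integral {0..real k / real N} (F x)\<bar> \<le> real k * (\<epsilon> / real N)"
      if "k \<le> N" for k
      using that
    proof (induction k)
      case (Suc k)
      let ?a = "real k / real N" and ?b = "real (Suc k) / real N"
      have ab: "0 \<le> ?a" "?a \<le> ?b" "?b \<le> 1" "?b - ?a = 1 / real N"
        using Suc.prems N by (auto simp: field_simps)
      have "integral {0..?b} (F x) = integral {0..?a} (F x) + integral {?a..?b} (F x)"
        using ab by (intro Henstock_Kurzweil_Integration.integral_combine[symmetric] int) auto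
      moreover have "\<bar>F x ?b / real N - integral {?a..?b} (F x)\<bar> \<le> \<epsilon> / real N"
      proof -
        have "F x ?b / real N = integral {?a..?b} (\<lambda>_. F x ?b)"
          using ab by (simp del: of_nat_Suc)
        then have "F x ?b / real N - integral {?a..?b} (F x) = integral {?a..?b} (\<lambda>y. F x ?b - F x y)"
          using ab int by (subst integral_diff) auto
        moreover have "norm (integral {?a..?b} (\<lambda>y. F x ?b - F x y)) \<le> integral {?a..?b} (\<lambda>_. \<epsilon>)"
        proof (rule integral_norm_bound_integral)
          show "(\<lambda>y. F x ?b - F x y) integrable_on {?a..?b}"
            using ab int by (intro integrable_diff) auto
          fix y assume y: "y \<in> {?a..?b}"
          have "0 \<le> y" "y \<le> 1" using y ab(1,3) unfolding atLeastAtMost_iff by linarith+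
          have "dist (x, ?b) (x, y) < d" using y ab Nd by (auto simp: dist_Pair_Pair dist_real_def)
          then show "norm (F x ?b - F x y) \<le> \<epsilon>"
            using d(2)[of "(x, y)" "(x, ?b)"] x \<open>0 \<le> y\<close> \<open>y \<le> 1\<close> y ab by (auto simp: dist_real_def)
        qed (rule integrable_const_ivl)
        ultimately show ?thesis using ab by (simp del: of_nat_Suc)
      qed
      ultimately show ?case using Suc by (simp add: add_divide_distrib distrib_right)
    qed simp
    from this[of N] show ?thesis using N by simp
  qed
  then show ?thesis by blast
qed


section \<open>Convergence of the discretised flow\<close>

definition sample :: "nat \<Rightarrow> C01 \<Rightarrow> nat \<Rightarrow> real"
  where "sample N f i = apply_bcontfun f (pt (real i / real N))"

lemma sample_abs_le: "\<bar>sample N f i\<bar> \<le> norm f"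
  using norm_bounded[of f] by (simp add: sample_def)

context urn_rates
begin

lemma urn_boxes: "1 \<le> N \<Longrightarrow> urn_boxes lam \<Lambda> N"
  by (intro urn_boxes.intro urn_rates_axioms urn_boxes_axioms.intro)

lemma box_drift_sample_approx:
  assumes \<epsilon>: "0 < \<epsilon>"
  shows "\<exists>N0. \<forall>N\<ge>N0. 1 \<le> N \<longrightarrow> (\<forall>i\<in>{1..N}.
    \<bar>urn_boxes.box_drift lam N (sample N f) i - sample N (drift f) i\<bar> \<le> \<epsilon>)"
proof -
  define F where "F x y = lam x y * (apply_bcontfun f (pt y) - apply_bcontfun f (pt x))" for x y
  have cont: "continuous_on ({0..1} \<times> {0..1}) (\<lambda>(x, y). F x y)"
  proof -
    have "continuous_on ({0..1} \<times> {0..1})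
        (\<lambda>z. lam (fst z) (snd z) * (apply_bcontfun f (pt (snd z)) - apply_bcontfun f (pt (fst z))))"
    proof (intro continuous_on_mult continuous_on_diff)
      show "continuous_on ({0..1} \<times> {0..1}) (\<lambda>z. lam (fst z) (snd z))"
        using lam_cont by (simp add: case_prod_beta)
      show "continuous_on ({0..1} \<times> {0..1}) (\<lambda>z. apply_bcontfun f (pt (snd z)))"
        by (rule continuous_on_compose2[OF continuous_on_bcontfun_pt continuous_on_snd[OF continuous_on_id]]) auto
      show "continuous_on ({0..1} \<times> {0..1}) (\<lambda>z. apply_bcontfun f (pt (fst z)))"
        by (rule continuous_on_compose2[OF continuous_on_bcontfun_pt continuous_on_fst[OF continuous_on_id]]) auto
    qed
    then show ?thesis by (simp add: F_def case_prod_beta)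
  qed
  obtain N0 where N0: "\<And>N x. N \<ge> N0 \<Longrightarrow> 1 \<le> N \<Longrightarrow> x \<in> {0..1} \<Longrightarrow>
    \<bar>(\<Sum>j=1..N. F x (real j / real N)) / real N - integral {0..1} (F x)\<bar> \<le> \<epsilon>"
    using riemann_sum_uniform[OF cont \<epsilon>] by blast
  have "\<bar>urn_boxes.box_drift lam N (sample N f) i - sample N (drift f) i\<bar> \<le> \<epsilon>"
    if N: "N \<ge> N0" "1 \<le> N" and i: "i \<in> {1..N}" for N i
  proof -
    interpret urn_boxes lam \<Lambda> N by (rule urn_boxes[OF N(2)])
    have x: "real i / real N \<in> {0..1}" by (rule box_in_interval[OF i])
    have "box_drift (sample N f) i = (\<Sum>j=1..N. F (real i / real N) (real j / real N)) / real N"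
      by (simp add: box_drift_def rate_def F_def sample_def sum_divide_distrib)
    moreover have "F (real i / real N) = (\<lambda>y. lam (real i / real N) y *
        (apply_bcontfun f (pt y) - apply_bcontfun f (pt (real i / real N))))"
      by (simp add: F_def fun_eq_iff)
    then have "sample N (drift f) i = integral {0..1} (F (real i / real N))"
      using x by (simp add: sample_def drift_apply)
    ultimately show ?thesis using N0[OF N x] by simp
  qed
  then show ?thesis by blast
qed

text \<open>One more application of \<open>box_drift\<close> multiplies the old error by at most
  \<open>2 * \<Lambda>\<close> and adds a new Riemann sum error. The threshold may depend on
  \<open>n\<close>, since the coefficients of the series are compared one at a time.\<close>

lemma box_drift_power_approx:
  assumes \<epsilon>: "0 < \<epsilon>"
  shows "\<exists>N0. \<forall>N\<ge>N0. 1 \<le> N \<longrightarrow> (\<forall>i\<in>{1..N}.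
    \<bar>(urn_boxes.box_drift lam N ^^ n) (sample N f) i - sample N ((drift ^^ n) f) i\<bar> \<le> \<epsilon>)"
  using \<epsilon>
proof (induction n arbitrary: \<epsilon>)
  case (Suc n)
  have K: "0 < 2 * \<Lambda> + 1" using Lam_nonneg by simp
  \<comment> \<open>Half of \<open>\<epsilon>\<close> is left for the new Riemann sum error; the
    summand 1 prevents division by 0 when \<open>\<Lambda>\<close> vanishes.\<close>
  define \<delta> where "\<delta> = \<epsilon> / 2 / (2 * \<Lambda> + 1)"
  have \<delta>: "0 < \<delta>" "2 * \<Lambda> * \<delta> \<le> \<epsilon> / 2"
    using Suc.prems K unfolding \<delta>_def by (auto simp: field_simps)
  obtain N1 where N1: "\<And>N i. N \<ge> N1 \<Longrightarrow> 1 \<le> N \<Longrightarrow> i \<in> {1..N} \<Longrightarrow>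
    \<bar>(urn_boxes.box_drift lam N ^^ n) (sample N f) i - sample N ((drift ^^ n) f) i\<bar> \<le> \<delta>"
    using Suc.IH[OF \<delta>(1)] by blast
  obtain N2 where N2: "\<And>N i. N \<ge> N2 \<Longrightarrow> 1 \<le> N \<Longrightarrow> i \<in> {1..N} \<Longrightarrow>
    \<bar>urn_boxes.box_drift lam N (sample N ((drift ^^ n) f)) i - sample N (drift ((drift ^^ n) f)) i\<bar> \<le> \<epsilon> / 2"
    using box_drift_sample_approx[OF half_gt_zero[OF Suc.prems], of "(drift ^^ n) f"] by blast
  have "\<bar>(urn_boxes.box_drift lam N ^^ Suc n) (sample N f) i - sample N ((drift ^^ Suc n) f) i\<bar> \<le> \<epsilon>"
    if N: "N \<ge> max N1 N2" "1 \<le> N" and i: "i \<in> {1..N}" for N i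
  proof -
    interpret urn_boxes lam \<Lambda> N by (rule urn_boxes[OF N(2)])
    let ?g = "(box_drift ^^ n) (sample N f)" and ?h = "sample N ((drift ^^ n) f)"
    have "\<bar>box_drift (\<lambda>i. ?g i - ?h i) i\<bar> \<le> 2 * \<Lambda> * \<delta>"
      by (rule box_drift_abs_le[OF i]) (use N1 N in auto)
    moreover have "box_drift (\<lambda>i. ?g i - ?h i) i = box_drift ?g i - box_drift ?h i"
      unfolding box_drift_def sum_subtractf[symmetric] by (simp add: algebra_simps)
    moreover have "\<bar>box_drift ?h i - sample N (drift ((drift ^^ n) f)) i\<bar> \<le> \<epsilon> / 2"
      by (rule N2) (use N i in auto)
    ultimately have "\<bar>box_drift ?g i - sample N (drift ((drift ^^ n) f)) i\<bar> \<le> \<epsilon>"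
      using \<delta>(2) by linarith
    then show ?thesis by simp
  qed
  then show ?case by blast
qed (simp add: exI[of _ 0])

lemma init_riemann:
  "(\<lambda>N. (\<Sum>i=1..N. sample N \<phi> i * sample N f i) / real N) \<longlonglongrightarrow> init \<phi> f"
proof (rule LIMSEQ_I)
  fix r :: real assume r: "0 < r"
  \<comment> \<open>The first variable is a dummy that allows \<open>riemann_sum_uniform\<close> to
    be reused.\<close>
  have cont: "continuous_on ({0..1} \<times> {0..1}) (\<lambda>(x :: real, y). apply_bcontfun f (pt y) * apply_bcontfun \<phi> (pt y))"
  proof -
    have "continuous_on ({0..1} \<times> {0..1}) (\<lambda>z :: real \<times> real. apply_bcontfun f (pt (snd z)) * apply_bcontfun \<phi> (pt (snd z)))"
      by (intro continuous_on_mult)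
        (rule continuous_on_compose2[OF continuous_on_bcontfun_pt continuous_on_snd[OF continuous_on_id]], force)+
    then show ?thesis by (simp add: case_prod_beta)
  qed
  obtain N0 where N0: "\<And>N x :: real. N \<ge> N0 \<Longrightarrow> 1 \<le> N \<Longrightarrow> x \<in> {0..1} \<Longrightarrow>
    \<bar>(\<Sum>j=1..N. apply_bcontfun f (pt (real j / real N)) * apply_bcontfun \<phi> (pt (real j / real N))) / real N
      - init \<phi> f\<bar> \<le> r / 2"
    using riemann_sum_uniform[OF cont half_gt_zero[OF r]] unfolding init_def by blast
  have "norm ((\<Sum>i=1..N. sample N \<phi> i * sample N f i) / real N - init \<phi> f) < r" if "N \<ge> max N0 1" for N
    using N0[of N 0] that r by (simp add: sample_def mult.commute)
  then show "\<exists>N0. \<forall>N\<ge>N0. norm ((\<Sum>i=1..N. sample N \<phi> i * sample N f i) / real N - init \<phi> f) < r"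
    by blast
qed

text \<open>The left-hand side is the mean of the empirical measure at time \<open>t\<close>, tested
  with \<open>f\<close>. Exchanging the finite sum with the series turns it into one exponential
  series, to which \<open>tendsto_exp_series\<close> applies.\<close>

lemma sample_flow_tendsto:
  "(\<lambda>N. (\<Sum>i=1..N. sample N \<phi> i * urn_boxes.box_flow lam N (sample N f) t i) / real N)
    \<longlonglongrightarrow> (flow \<phi> t) f"
proof -
  define a where "a N n = (\<Sum>i=1..N. sample N \<phi> i / real N * (urn_boxes.box_drift lam N ^^ n) (sample N f) i)" for N n
  have a_type: "exp_type (norm \<phi> * norm f) (2 * \<Lambda>) (a N)" if N: "1 \<le> N" for N
    unfolding exp_type_def
  proof (intro conjI allI)
    fix n
    interpret urn_boxes lam \<Lambda> N by (rule urn_boxes[OF N])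
    have "\<bar>a N n\<bar> \<le> (\<Sum>i=1..N. norm \<phi> / real N * (norm f * (2 * \<Lambda>) ^ n))"
      unfolding a_def
    proof (rule order_trans[OF sum_abs sum_mono])
      fix i assume "i \<in> {1..N}"
      then have "\<bar>(box_drift ^^ n) (sample N f) i\<bar> \<le> norm f * (2 * \<Lambda>) ^ n"
        using box_drift_power_abs_le[of "sample N f" "norm f" i n] sample_abs_le by blast
      then show "\<bar>sample N \<phi> i / real N * (box_drift ^^ n) (sample N f) i\<bar> \<le> norm \<phi> / real N * (norm f * (2 * \<Lambda>) ^ n)"
        unfolding abs_mult using sample_abs_le[of N \<phi> i] N by (intro mult_mono) (auto simp: divide_right_mono)
    qed
    also have "\<dots> = norm \<phi> * norm f * (2 * \<Lambda>) ^ n" using N by simp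
    finally show "\<bar>a N n\<bar> \<le> norm \<phi> * norm f * (2 * \<Lambda>) ^ n" .
  qed (use Lam_nonneg in auto)
  have a_lim: "(\<lambda>N. a N n) \<longlonglongrightarrow> init \<phi> ((drift ^^ n) f)" for n
  proof -
    \<comment> \<open>\<open>b N\<close> replaces the discrete iterate by samples of the continuous
      one; what remains is a plain Riemann sum of the initial profile against
      \<open>(drift ^^ n) f\<close>.\<close>
    define b where "b N = (\<Sum>i=1..N. sample N \<phi> i * sample N ((drift ^^ n) f) i) / real N" for N
    have "(\<lambda>N. a N n - b N) \<longlonglongrightarrow> 0"
    proof (rule LIMSEQ_I)
      fix r :: real assume r: "0 < r"
      define \<delta> where "\<delta> = r / (norm \<phi> + 1)"
      have p: "0 < norm \<phi> + 1" by (simp add: add_nonneg_pos)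
      have \<delta>: "0 < \<delta>" "norm \<phi> * \<delta> < r"
        using p r unfolding \<delta>_def by (auto simp: field_simps)
      obtain N0 where N0: "\<And>N i. N \<ge> N0 \<Longrightarrow> 1 \<le> N \<Longrightarrow> i \<in> {1..N} \<Longrightarrow>
        \<bar>(urn_boxes.box_drift lam N ^^ n) (sample N f) i - sample N ((drift ^^ n) f) i\<bar> \<le> \<delta>"
        using box_drift_power_approx[OF \<delta>(1), of n f] by blast
      have "\<bar>a N n - b N\<bar> < r" if N: "N \<ge> max N0 1" for N
      proof -
        have "a N n - b N = (\<Sum>i=1..N. sample N \<phi> i / real N *
            ((urn_boxes.box_drift lam N ^^ n) (sample N f) i - sample N ((drift ^^ n) f) i))"
          by (simp add: a_def b_def sum_divide_distrib sum_subtractf right_diff_distrib)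
        also have "\<bar>\<dots>\<bar> \<le> (\<Sum>i=1..N. norm \<phi> / real N * \<delta>)"
        proof (rule order_trans[OF sum_abs sum_mono])
          fix i assume i: "i \<in> {1..N}"
          show "\<bar>sample N \<phi> i / real N *
            ((urn_boxes.box_drift lam N ^^ n) (sample N f) i - sample N ((drift ^^ n) f) i)\<bar> \<le> norm \<phi> / real N * \<delta>"
            unfolding abs_mult using sample_abs_le[of N \<phi> i] N0[OF _ _ i] N
            by (intro mult_mono) (auto simp: divide_right_mono)
        qed
        also have "\<dots> = norm \<phi> * \<delta>" using N by simp
        finally show ?thesis using \<delta>(2) by simp
      qed
      then show "\<exists>N0. \<forall>N\<ge>N0. norm (a N n - b N - 0) < r" by (intro exI[of _ "max N0 1"]) simp
    qed
    from tendsto_add[OF this init_riemann[of \<phi> "(drift ^^ n) f"]] show ?thesis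
      by (simp add: b_def)
  qed
  have "exp_series (a N) t = (\<Sum>i=1..N. sample N \<phi> i * urn_boxes.box_flow lam N (sample N f) t i) / real N"
    if N: "1 \<le> N" for N
  proof -
    interpret urn_boxes lam \<Lambda> N by (rule urn_boxes[OF N])
    have "exp_series (a N) t = (\<Sum>i=1..N. sample N \<phi> i / real N * exp_series (\<lambda>n. (box_drift ^^ n) (sample N f) i) t)"
      unfolding a_def by (rule exp_series_sum) (auto intro: exp_type_box_drift[OF sample_abs_le])
    then show ?thesis by (simp add: box_flow_def sum_divide_distrib)
  qed
  then have "\<forall>\<^sub>F N in sequentially. exp_series (a N) t =
      (\<Sum>i=1..N. sample N \<phi> i * urn_boxes.box_flow lam N (sample N f) t i) / real N"
    by (intro eventually_sequentiallyI[of 1]) blast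
  with tendsto_exp_series[OF a_type a_lim, of t] show ?thesis
    unfolding flow_apply by (rule Lim_transform_eventually)
qed

end


section \<open>Deviation of the empirical measure from its mean\<close>

context urn_boxes
begin

lemma lin_box_flow_continuous: "continuous_on A (\<lambda>s. lin (box_flow h s) x)"
proof -
  have "isCont (\<lambda>s. lin (box_flow h s) x) s" for s
    by (rule DERIV_isCont[OF lin_has_derivative]) (rule box_flow_has_derivative)
  then show ?thesis by (simp add: continuous_at_imp_continuous_on)
qed

lemma chain_process_states:
  assumes proc: "ehrenfest_process N lam M X"
  obtains p where "transition_semigroup (urn_states N) p" "has_generator (urn_states N) p gen"
    "\<And>n. chain_process (urn_states N) p gen (states n) (\<lambda>x y. gen (indicator {y}) x) M X"
proof -
  from proc obtain p where p: "transition_semigroup (urn_states N) p" "has_generator (urn_states N) p gen"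
    and fdd: "\<And>n t x. 0 \<le> t 0 \<and> (\<forall>k<n. t k \<le> t (Suc k)) \<and> (\<forall>k\<le>n. x k \<in> urn_states N) \<Longrightarrow>
        measure M {\<omega> \<in> space M. \<forall>k\<le>n. X (t k) \<omega> = x k} =
        measure M {\<omega> \<in> space M. X (t 0) \<omega> = x 0} *
          (\<Prod>k<n. pmf (p (t (Suc k) - t k) (x k)) (x (Suc k)))"
    unfolding ehrenfest_process_def markov_process_def by (elim conjE exE) blast
  have "chain_process (urn_states N) p gen (states n) (\<lambda>x y. gen (indicator {y}) x) M X" for n
    using proc unfolding ehrenfest_process_def markov_process_def
    by (intro chain_process.intro chain_process_axioms.intro urn_finite_chain p fdd) auto
  with p that show ?thesis by blast
qed

text \<open>The factor \<open>measure M {\<omega> \<in> space M. X 0 \<omega> = x}\<close> is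
  retained so that the bounds can be summed over all initial states without loss.\<close>

lemma path_deviation_from_state:
  assumes proc: "ehrenfest_process N lam M X" and t: "0 < t" and a: "0 < a" and x: "x \<in> states n"
    and H: "\<And>j. j \<in> {1..N} \<Longrightarrow> \<bar>h j\<bar> \<le> H"
  shows "\<exists>B\<in>sets M. {\<omega> \<in> space M. X 0 \<omega> = x \<and> (\<exists>s\<in>{0..t}. X s \<omega> \<notin> states n \<or>
      a < \<bar>lin (box_flow h (t - s)) (X s \<omega>) - lin (box_flow h t) x\<bar>)} \<subseteq> B \<and>
    measure M B \<le> measure M {\<omega> \<in> space M. X 0 \<omega> = x} * (real n * (H\<^sup>2 * exp (2 * \<Lambda> * t)) / a\<^sup>2)"
proof -
  obtain p where p: "transition_semigroup (urn_states N) p" "has_generator (urn_states N) p gen"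
    "chain_process (urn_states N) p gen (states n) (\<lambda>x y. gen (indicator {y}) x) M X"
    using chain_process_states[OF proc] by metis
  interpret C: chain_process "urn_states N" p gen "states n" "\<lambda>x y. gen (indicator {y}) x" M X
    by (rule p(3))
  note ev = ev_lin[OF p(1,2)]
  have "continuous_on {0..t} (\<lambda>s. C.ev s y (lin h))" if "y \<in> states n" for y
    using lin_box_flow_continuous by (rule continuous_on_eq) (simp add: ev[OF that])
  from C.maximal_inequality[OF a t x this, of "lin (box_flow h t) x"]
  obtain B where B: "B \<in> sets M" "{\<omega> \<in> space M. X 0 \<omega> = x \<and>
      (\<exists>s\<in>{0..t}. X s \<omega> \<notin> states n \<or> a < \<bar>C.ev (t - s) (X s \<omega>) (lin h) - lin (box_flow h t) x\<bar>)} \<subseteq> B"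
    "measure M B \<le> measure M {\<omega> \<in> space M. X 0 \<omega> = x} *
      C.ev t x (\<lambda>y. (lin h y - lin (box_flow h t) x)\<^sup>2) / a\<^sup>2" by blast
  have "{\<omega> \<in> space M. X 0 \<omega> = x \<and> (\<exists>s\<in>{0..t}. X s \<omega> \<notin> states n \<or>
      a < \<bar>lin (box_flow h (t - s)) (X s \<omega>) - lin (box_flow h t) x\<bar>)} \<subseteq> B"
  proof
    fix \<omega> assume \<omega>: "\<omega> \<in> {\<omega> \<in> space M. X 0 \<omega> = x \<and> (\<exists>s\<in>{0..t}. X s \<omega> \<notin> states n \<or>
      a < \<bar>lin (box_flow h (t - s)) (X s \<omega>) - lin (box_flow h t) x\<bar>)}"
    then obtain s where s: "s \<in> {0..t}" "X s \<omega> \<notin> states n \<or>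
      a < \<bar>lin (box_flow h (t - s)) (X s \<omega>) - lin (box_flow h t) x\<bar>" by blast
    then have "X s \<omega> \<notin> states n \<or> a < \<bar>C.ev (t - s) (X s \<omega>) (lin h) - lin (box_flow h t) x\<bar>"
      using ev[of "X s \<omega>" n "t - s" h] by (cases "X s \<omega> \<in> states n") auto
    then show "\<omega> \<in> B" using B(2) \<omega> s(1) by blast
  qed
  moreover have "measure M B \<le> measure M {\<omega> \<in> space M. X 0 \<omega> = x} * (real n * (H\<^sup>2 * exp (2 * \<Lambda> * t)) / a\<^sup>2)"
  proof (rule order_trans[OF B(3)])
    have "C.ev t x (\<lambda>y. (lin h y - lin (box_flow h t) x)\<^sup>2) \<le> real n * (H\<^sup>2 * exp (2 * \<Lambda> * t))"
      using t by (intro ev_variance_le[OF p(1,2) x _ H]) auto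
    then have "C.ev t x (\<lambda>y. (lin h y - lin (box_flow h t) x)\<^sup>2) / a\<^sup>2 \<le>
        real n * (H\<^sup>2 * exp (2 * \<Lambda> * t)) / a\<^sup>2"
      by (rule divide_right_mono) simp
    from mult_left_mono[OF this measure_nonneg]
    show "measure M {\<omega> \<in> space M. X 0 \<omega> = x} * C.ev t x (\<lambda>y. (lin h y - lin (box_flow h t) x)\<^sup>2) / a\<^sup>2
        \<le> measure M {\<omega> \<in> space M. X 0 \<omega> = x} * (real n * (H\<^sup>2 * exp (2 * \<Lambda> * t)) / a\<^sup>2)"
      by (simp only: times_divide_eq_right)
  qed
  ultimately show ?thesis using B(1) by blast
qed

text \<open>There are three sources of failure, one for each term of the bound: \<open>B1\<close>,
  too many balls; \<open>B2\<close>, an initial weighted sum far from its Poisson mean;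
  \<open>B3\<close>, a large martingale fluctuation after time 0. Off these sets the last two
  deviations contribute \<open>a\<close> each, hence \<open>2 * a\<close>.\<close>

lemma path_deviation:
  fixes \<phi> f :: C01
  assumes proc: "ehrenfest_process N lam M X"
    and indep: "prob_space.indep_vars M (\<lambda>_. count_space UNIV) (\<lambda>i \<omega>. X 0 \<omega> i) {1..N}"
    and pois: "\<And>i. i \<in> {1..N} \<Longrightarrow> poisson_distributed M (\<lambda>\<omega>. X 0 \<omega> i) (sample N \<phi> i)"
    and t: "0 < t" and a: "0 < a"
  defines "h \<equiv> sample N f"
  defines "m \<equiv> (\<Sum>i=1..N. sample N \<phi> i * box_flow h t i) / real N"
  shows "\<exists>B\<in>sets M. measure M B \<le>
      (norm \<phi> + norm \<phi> * (norm f * exp (2 * \<Lambda> * t))\<^sup>2 / a\<^sup>2 + (norm \<phi> + 1) * ((norm f)\<^sup>2 * exp (2 * \<Lambda> * t)) / a\<^sup>2) / real N \<and>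
    (\<forall>\<omega>\<in>space M - B. \<exists>n. real n \<le> (norm \<phi> + 1) * real N \<and>
      (\<forall>s\<in>{0..t}. X s \<omega> \<in> states n \<and> \<bar>lin (box_flow h (t - s)) (X s \<omega>) / real N - m\<bar> \<le> 2 * a))"
proof -
  interpret prob_space M using proc by (simp add: ehrenfest_process_def markov_process_def)
  have X0: "X 0 \<in> measurable M (count_space (urn_states N))"
    using proc by (simp add: ehrenfest_process_def markov_process_def)
  have X0_sets: "{\<omega> \<in> space M. X 0 \<omega> = x} \<in> sets M" for x
  proof -
    have "X 0 -` {x} \<inter> space M = X 0 -` ({x} \<inter> urn_states N) \<inter> space M"
      using measurable_space[OF X0] by auto
    moreover have "X 0 -` ({x} \<inter> urn_states N) \<inter> space M \<in> sets M"
      by (rule measurable_sets[OF X0]) auto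
    moreover have "X 0 -` {x} \<inter> space M = {\<omega> \<in> space M. X 0 \<omega> = x}" by auto
    ultimately show ?thesis by simp
  qed
  have X0i: "(\<lambda>\<omega>. X 0 \<omega> i) \<in> measurable M (count_space UNIV)" if "i \<in> {1..N}" for i
    using pois[OF that] by (simp add: poisson_distributed_def)
  have N0: "0 < real N" using N_pos by simp
  define w where "w = box_flow h t"
  define W where "W = norm f * exp (2 * \<Lambda> * t)"
  have hH: "\<bar>h j\<bar> \<le> norm f" for j unfolding h_def by (rule sample_abs_le)
  have wW: "\<bar>w i\<bar> \<le> W" if "i \<in> {1..N}" for i
    unfolding w_def W_def using box_flow_abs_le[of h "norm f" i t] hH that t by simp
  define D where "D v \<omega> = (\<Sum>i=1..N. v i * (real (X 0 \<omega> i) - sample N \<phi> i))" for v \<omega>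
  have D_meas: "D v \<in> borel_measurable M" for v
    unfolding D_def
    by (intro borel_measurable_sum borel_measurable_times borel_measurable_diff borel_measurable_const
        measurable_compose[OF X0i]) auto
  define B1 where "B1 = {\<omega> \<in> space M. real N \<le> \<bar>D (\<lambda>_. 1) \<omega>\<bar>}"
  define B2 where "B2 = {\<omega> \<in> space M. real N * a \<le> \<bar>D w \<omega>\<bar>}"
  have BM: "B1 \<in> sets M" "B2 \<in> sets M"
    unfolding B1_def B2_def using D_meas by measurable
  have "measure M B1 \<le> (\<Sum>i=1..N. 1\<^sup>2 * sample N \<phi> i) / (real N)\<^sup>2"
    unfolding B1_def D_def by (rule poisson_weighted_sum_deviation[OF indep _ pois N0]) auto
  also have "\<dots> \<le> (\<Sum>i=1..N. norm \<phi>) / (real N)\<^sup>2"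
    using sample_abs_le[of N \<phi>] by (intro divide_right_mono sum_mono) (auto intro: order_trans[OF abs_ge_self])
  also have "\<dots> = norm \<phi> / real N" using N0 by (simp add: power2_eq_square)
  finally have B1: "measure M B1 \<le> norm \<phi> / real N" .
  have "measure M B2 \<le> (\<Sum>i=1..N. (w i)\<^sup>2 * sample N \<phi> i) / (real N * a)\<^sup>2"
    unfolding B2_def D_def using N0 a by (intro poisson_weighted_sum_deviation indep pois) auto
  also have "\<dots> \<le> (\<Sum>i=1..N. W\<^sup>2 * norm \<phi>) / (real N * a)\<^sup>2"
  proof (intro divide_right_mono sum_mono)
    fix i assume i: "i \<in> {1..N}"
    have "(w i)\<^sup>2 \<le> W\<^sup>2" using power_mono[OF wW[OF i], of 2] by simp
    moreover have "0 \<le> sample N \<phi> i" using pois[OF i] by (simp add: poisson_distributed_def)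
    moreover have "sample N \<phi> i \<le> norm \<phi>" using sample_abs_le[of N \<phi> i] by linarith
    ultimately show "(w i)\<^sup>2 * sample N \<phi> i \<le> W\<^sup>2 * norm \<phi>" by (intro mult_mono) auto
  qed simp
  also have "\<dots> = norm \<phi> * W\<^sup>2 / a\<^sup>2 / real N" using N0 a by (simp add: power2_eq_square field_simps)
  finally have B2: "measure M B2 \<le> norm \<phi> * W\<^sup>2 / a\<^sup>2 / real N" .
  \<comment> \<open>The maximal inequality at level \<open>N * a\<close> with at most (norm of phi +
    1) times \<open>N\<close> balls: the variance is of order \<open>N\<close> and the squared level
    of order N^2.\<close>
  define K where "K = (norm \<phi> + 1) * ((norm f)\<^sup>2 * exp (2 * \<Lambda> * t)) / a\<^sup>2 / real N"
  define I where "I = {n. real n \<le> (norm \<phi> + 1) * real N}"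
  have I: "finite I" unfolding I_def by (rule finite_nat_iff_bounded_le[THEN iffD2])
      (auto intro!: exI[of _ "nat \<lfloor>(norm \<phi> + 1) * real N\<rfloor>"] simp: le_nat_floor)
  define good where "good = (\<Union>n\<in>I. states n)"
  have good: "finite good" unfolding good_def using I finite_states by blast
  define dev where "dev x n = {\<omega> \<in> space M. X 0 \<omega> = x \<and> (\<exists>s\<in>{0..t}. X s \<omega> \<notin> states n \<or>
      real N * a < \<bar>lin (box_flow h (t - s)) (X s \<omega>) - lin w x\<bar>)}" for x n
  have "\<exists>B\<in>sets M. dev x n \<subseteq> B \<and>
    measure M B \<le> measure M {\<omega> \<in> space M. X 0 \<omega> = x} * K" if x: "x \<in> states n" "n \<in> I" for x n
  proof -
    have "0 < real N * a" using N0 a by simp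
    from path_deviation_from_state[OF proc t this x(1), of h "norm f"] hH obtain B where B: "B \<in> sets M"
      "dev x n \<subseteq> B"
      "measure M B \<le> measure M {\<omega> \<in> space M. X 0 \<omega> = x} *
        (real n * ((norm f)\<^sup>2 * exp (2 * \<Lambda> * t)) / (real N * a)\<^sup>2)"
      unfolding dev_def w_def by blast
    have "real n * ((norm f)\<^sup>2 * exp (2 * \<Lambda> * t)) / (real N * a)\<^sup>2 \<le>
        (norm \<phi> + 1) * real N * ((norm f)\<^sup>2 * exp (2 * \<Lambda> * t)) / (real N * a)\<^sup>2"
      using x(2) by (intro divide_right_mono mult_right_mono) (auto simp: I_def)
    also have "\<dots> = K" unfolding K_def using N0 a by (simp add: power2_eq_square field_simps)
    finally have "measure M B \<le> measure M {\<omega> \<in> space M. X 0 \<omega> = x} * K"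
      using B(3) by (meson measure_nonneg mult_left_mono order_trans)
    with B show ?thesis by blast
  qed
  then have "\<exists>B. B \<in> sets M \<and> (\<forall>n\<in>I. x \<in> states n \<longrightarrow> dev x n \<subseteq> B) \<and>
    measure M B \<le> measure M {\<omega> \<in> space M. X 0 \<omega> = x} * K" if "x \<in> good" for x
  proof -
    from that obtain n where n: "n \<in> I" "x \<in> states n" unfolding good_def by blast
    \<comment> \<open>The initial state determines the number of balls, so a single cover
      \<open>B x\<close> serves all \<open>n\<close>.\<close>
    have "k = n" if "x \<in> states k" for k using that n by (simp add: states_def)
    then show ?thesis using \<open>\<And>x n. x \<in> states n \<Longrightarrow> n \<in> I \<Longrightarrow> _\<close>[OF n(2,1)] by blast
  qed
  then have "\<forall>x\<in>good. \<exists>B. B \<in> sets M \<and> (\<forall>n\<in>I. x \<in> states n \<longrightarrow> dev x n \<subseteq> B) \<and>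
    measure M B \<le> measure M {\<omega> \<in> space M. X 0 \<omega> = x} * K" by blast
  from bchoice[OF this] obtain B where B0: "\<forall>x\<in>good. B x \<in> sets M \<and> (\<forall>n\<in>I. x \<in> states n \<longrightarrow>
      dev x n \<subseteq> B x) \<and>
    measure M (B x) \<le> measure M {\<omega> \<in> space M. X 0 \<omega> = x} * K" ..
  have B: "B x \<in> sets M"
    "n \<in> I \<Longrightarrow> x \<in> states n \<Longrightarrow> dev x n \<subseteq> B x"
    "measure M (B x) \<le> measure M {\<omega> \<in> space M. X 0 \<omega> = x} * K" if "x \<in> good" for x n
    using conjunct1[OF bspec[OF B0 that]] mp[OF bspec[OF conjunct1[OF conjunct2[OF bspec[OF B0 that]]]]]
      conjunct2[OF conjunct2[OF bspec[OF B0 that]]] by blast+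
  define B3 where "B3 = (\<Union>x\<in>good. B x)"
  have B3M: "B3 \<in> sets M" unfolding B3_def using good B(1) by (intro sets.finite_UN)
  have "measure M B3 \<le> (\<Sum>x\<in>good. measure M (B x))"
    unfolding B3_def using good B(1) by (intro measure_UNION_le) auto
  also have "\<dots> \<le> (\<Sum>x\<in>good. measure M {\<omega> \<in> space M. X 0 \<omega> = x}) * K"
    unfolding sum_distrib_right by (intro sum_mono B(3))
  \<comment> \<open>The events of different initial states are disjoint, so their probabilities sum
    to at most 1 no matter how many states there are.\<close>
  also have "(\<Sum>x\<in>good. measure M {\<omega> \<in> space M. X 0 \<omega> = x}) = measure M (\<Union>x\<in>good. {\<omega> \<in> space M. X 0 \<omega> = x})"
    using X0_sets by (intro finite_measure_finite_Union[symmetric] good) (auto simp: disjoint_family_on_def)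
  also have "\<dots> * K \<le> 1 * K"
    using N0 by (intro mult_right_mono prob_le_1) (auto simp: K_def)
  finally have B3: "measure M B3 \<le> K" by simp
  show ?thesis
  proof (intro bexI[of _ "B1 \<union> B2 \<union> B3"] conjI ballI)
    have "measure M (B1 \<union> B2 \<union> B3) \<le> measure M B1 + measure M B2 + measure M B3"
      using measure_Un_le[of "B1 \<union> B2" M B3] measure_Un_le[of B1 M B2] BM B3M by auto
    also have "\<dots> \<le> norm \<phi> / real N + norm \<phi> * W\<^sup>2 / a\<^sup>2 / real N + K"
      by (intro add_mono B1 B2 B3)
    finally show "measure M (B1 \<union> B2 \<union> B3) \<le> (norm \<phi> + norm \<phi> * (norm f * exp (2 * \<Lambda> * t))\<^sup>2 / a\<^sup>2 +
        (norm \<phi> + 1) * ((norm f)\<^sup>2 * exp (2 * \<Lambda> * t)) / a\<^sup>2) / real N"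
      by (simp add: W_def K_def add_divide_distrib)
    fix \<omega> assume "\<omega> \<in> space M - (B1 \<union> B2 \<union> B3)"
    then have \<omega>: "\<omega> \<in> space M" "\<bar>D (\<lambda>_. 1) \<omega>\<bar> < real N" "\<bar>D w \<omega>\<bar> < real N * a" "\<omega> \<notin> B3"
      unfolding B1_def B2_def by auto
    define n where "n = (\<Sum>i=1..N. X 0 \<omega> i)"
    have "(\<Sum>i=1..N. sample N \<phi> i) \<le> (\<Sum>i=1..N. norm \<phi>)"
      using sample_abs_le[of N \<phi>] by (intro sum_mono) (auto intro: order_trans[OF abs_ge_self])
    moreover have "real n - (\<Sum>i=1..N. sample N \<phi> i) = D (\<lambda>_. 1) \<omega>"
      by (simp add: n_def D_def sum_subtractf)
    ultimately have nN: "real n \<le> (norm \<phi> + 1) * real N"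
      using \<omega>(2) by (simp add: algebra_simps)
    have xn: "X 0 \<omega> \<in> states n"
      using measurable_space[OF X0 \<omega>(1)] by (simp add: states_def n_def)
    have nI: "n \<in> I" using nN by (simp add: I_def)
    then have xg: "X 0 \<omega> \<in> good" unfolding good_def using xn by blast
    have "\<omega> \<notin> B (X 0 \<omega>)" using \<omega>(4) xg unfolding B3_def by blast
    have dyn: "X s \<omega> \<in> states n \<and> \<bar>lin (box_flow h (t - s)) (X s \<omega>) - lin w (X 0 \<omega>)\<bar> \<le> real N * a"
      if "s \<in> {0..t}" for s
    proof (rule ccontr)
      assume "\<not> ?thesis"
      then have "X s \<omega> \<notin> states n \<or> real N * a < \<bar>lin (box_flow h (t - s)) (X s \<omega>) - lin w (X 0 \<omega>)\<bar>"
        by (simp add: not_le)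
      then have "\<omega> \<in> B (X 0 \<omega>)" using B(2)[OF xg nI xn] \<omega>(1) that unfolding dev_def by blast
      with \<open>\<omega> \<notin> B (X 0 \<omega>)\<close> show False by contradiction
    qed
    have "lin w (X 0 \<omega>) / real N - m = D w \<omega> / real N"
      unfolding lin_def m_def D_def w_def[symmetric] diff_divide_distrib[symmetric] sum_subtractf[symmetric]
      by (simp add: algebra_simps)
    also have "\<bar>\<dots>\<bar> \<le> a" using \<omega>(3) N0 by (simp add: field_simps)
    finally have init: "\<bar>lin w (X 0 \<omega>) / real N - m\<bar> \<le> a" .
    have "\<bar>lin (box_flow h (t - s)) (X s \<omega>) / real N - m\<bar> \<le> 2 * a" if "s \<in> {0..t}" for s
    proof -
      have "\<bar>(lin (box_flow h (t - s)) (X s \<omega>) - lin w (X 0 \<omega>)) / real N\<bar> \<le> a"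
        using dyn[OF that] N0 by (simp add: field_simps)
      then have "\<bar>lin (box_flow h (t - s)) (X s \<omega>) / real N - lin w (X 0 \<omega>) / real N\<bar> \<le> a"
        by (simp add: diff_divide_distrib)
      then show ?thesis using init by linarith
    qed
    then show "\<exists>n. real n \<le> (norm \<phi> + 1) * real N \<and>
      (\<forall>s\<in>{0..t}. X s \<omega> \<in> states n \<and> \<bar>lin (box_flow h (t - s)) (X s \<omega>) / real N - m\<bar> \<le> 2 * a)"
      using nN dyn by blast
  qed (use BM B3M in auto)
qed

text \<open>Compares the martingale with horizon \<open>r\<close> ahead to the present value of the
  linear functional; the error per ball is of order \<open>r\<close>.\<close>

lemma lin_box_flow_increment:
  assumes x: "x \<in> states n" and r: "0 \<le> r" and H: "\<And>j. j \<in> {1..N} \<Longrightarrow> \<bar>h j\<bar> \<le> H"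
  shows "\<bar>lin (box_flow h r) x - lin h x\<bar> \<le> real n * (r * (H * (2 * \<Lambda>) * exp (2 * \<Lambda> * r)))"
proof -
  have "lin (box_flow h r) x - lin h x = lin (\<lambda>i. box_flow h r i - h i) x"
    by (simp add: lin_def sum_subtractf right_diff_distrib)
  also have "\<bar>\<dots>\<bar> \<le> real n * (r * (H * (2 * \<Lambda>) * exp (2 * \<Lambda> * r)))"
  proof (rule lin_abs_le[OF _ x])
    fix i assume i: "i \<in> {1..N}"
    from exp_series_increment[OF exp_type_box_drift[of h H, OF H i] r]
    show "\<bar>box_flow h r i - h i\<bar> \<le> r * (H * (2 * \<Lambda>) * exp (2 * \<Lambda> * r))"
      by (simp add: box_flow_def)
  qed
  finally show ?thesis .
qed

lemma empirical_functional_apply: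
  "(empirical_functional N x) f = lin (sample N f) x / real N"
  by (simp add: empirical_functional_def lin_def sample_def blinfun.scaleR_left blinfun.sum_left)

end


section \<open>Measurability of step processes in the Skorokhod space\<close>

text \<open>\<open>J\<close> contains all jump times. The interval \<open>{s<..t}\<close> excludes
  \<open>s\<close> because right continuity makes a jump at \<open>s\<close> already visible there.
  Both end points belong to \<open>J\<close> so that the time change built from \<open>J\<close>
  fixes them.\<close>

definition step_path :: "real \<Rightarrow> real set \<Rightarrow> (real \<Rightarrow> 's) \<Rightarrow> bool"
  where "step_path T J x \<longleftrightarrow> finite J \<and> J \<subseteq> {0..T} \<and> 0 \<in> J \<and> T \<in> J \<and>
    (\<forall>s t. 0 \<le> s \<and> s \<le> t \<and> t \<le> T \<and> J \<inter> {s<..t} = {} \<longrightarrow> x s = x t)"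

text \<open>In the discrete topology one-sided limits mean local constancy, so near each
  \<open>p\<close> the only possible jump is at \<open>p\<close>; compactness through
  \<open>Bolzano\<close> leaves finitely many.\<close>

lemma step_path_exists:
  fixes x :: "real \<Rightarrow> 's"
  assumes "0 \<le> T"
    and right: "\<And>t. 0 \<le> t \<Longrightarrow> \<forall>\<^sub>F s in at_right t. x s = x t"
    and left: "\<And>t. 0 < t \<Longrightarrow> \<exists>c. \<forall>\<^sub>F s in at_left t. x s = c"
  shows "\<exists>J. step_path T J x"
proof -
  define P where "P a b \<longleftrightarrow> (0 \<le> a \<longrightarrow> (\<exists>J. finite J \<and> J \<subseteq> {a..b} \<and>
    (\<forall>s t. a \<le> s \<and> s \<le> t \<and> t \<le> b \<and> J \<inter> {s<..t} = {} \<longrightarrow> x s = x t)))" for a b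
  have "P 0 T"
    using assms(1)
  proof (induction rule: Bolzano)
    case (trans a b c)
    show ?case
      unfolding P_def
    proof
      assume "0 \<le> a"
      then have "0 \<le> b" using trans(3) by simp
      from trans(1) \<open>0 \<le> a\<close> obtain J where J1: "finite J" "J \<subseteq> {a..b}"
        "\<And>s t. a \<le> s \<and> s \<le> t \<and> t \<le> b \<and> J \<inter> {s<..t} = {} \<Longrightarrow> x s = x t"
        unfolding P_def by blast
      from trans(2) \<open>0 \<le> b\<close> obtain K where K1: "finite K" "K \<subseteq> {b..c}"
        "\<And>s t. b \<le> s \<and> s \<le> t \<and> t \<le> c \<and> K \<inter> {s<..t} = {} \<Longrightarrow> x s = x t"
        unfolding P_def by blast
      note J = J1(1,2) K1(1,2) J1(3) K1(3)
      have "x s = x t" if "a \<le> s" "s \<le> t" "t \<le> c" "(J \<union> K) \<inter> {s<..t} = {}" for s t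
      proof (cases "t \<le> b \<or> b \<le> s")
        case True
        then show ?thesis using J(5)[of s t] J(6)[of s t] that by blast
      next
        case False
        then have "J \<inter> {s<..b} = {}" "K \<inter> {b<..t} = {}"
          using that(4) by (auto simp: disjoint_iff)
        then show ?thesis using False J(5)[of s b] J(6)[of b t] that by simp
      qed
      moreover have "finite (J \<union> K)" "J \<union> K \<subseteq> {a..c}"
        using J trans(3,4) by auto
      ultimately show "\<exists>J. finite J \<and> J \<subseteq> {a..c} \<and>
        (\<forall>s t. a \<le> s \<and> s \<le> t \<and> t \<le> c \<and> J \<inter> {s<..t} = {} \<longrightarrow> x s = x t)"
        by (intro exI[of _ "J \<union> K"]) blast
    qed
  next
    case (local p)
    obtain d1 where d1: "d1 > 0" "\<And>s. p < s \<Longrightarrow> s < p + d1 \<Longrightarrow> x s = x p"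
      using right[OF local(1)] unfolding eventually_at_right_field
      by (metis add_diff_cancel_left' add.commute diff_add_cancel diff_gt_0_iff_gt)
    have "\<exists>d2>0. \<exists>c. 0 < p \<longrightarrow> (\<forall>s. p - d2 < s \<and> s < p \<longrightarrow> x s = c)"
    proof (cases "0 < p")
      case True
      then obtain c b where "b < p" "\<And>s. b < s \<Longrightarrow> s < p \<Longrightarrow> x s = c"
        using left[of p] unfolding eventually_at_left_field by blast
      then show ?thesis by (intro exI[of _ "p - b"]) auto
    qed (auto intro: exI[of _ 1])
    then obtain d2 c where d2: "d2 > 0" "\<And>s. 0 < p \<Longrightarrow> p - d2 < s \<Longrightarrow> s < p \<Longrightarrow> x s = c"
      by blast
    have "P a b" if "a \<le> p" "p \<le> b" "b - a < min d1 d2" for a b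
      unfolding P_def
    proof
      assume "0 \<le> a"
      have R: "x s = x p" if "p \<le> s" "s \<le> b" for s
        using that \<open>a \<le> p\<close> \<open>b - a < min d1 d2\<close> d1(2)[of s] by (cases "s = p") auto
      have L: "x s = c" if "s < p" "a \<le> s" for s
        using that \<open>p \<le> b\<close> \<open>0 \<le> a\<close> \<open>b - a < min d1 d2\<close> d2(2)[of s] by auto
      have "x s = x t" if "a \<le> s" "s \<le> t" "t \<le> b" "{p} \<inter> {s<..t} = {}" for s t
      proof (cases "t < p")
        case True
        then show ?thesis using L[of s] L[of t] that by auto
      next
        case False
        then have "p \<le> s" using that by auto
        then show ?thesis using R[of s] R[of t] that by auto
      qed
      then show "\<exists>J. finite J \<and> J \<subseteq> {a..b} \<and>
        (\<forall>s t. a \<le> s \<and> s \<le> t \<and> t \<le> b \<and> J \<inter> {s<..t} = {} \<longrightarrow> x s = x t)"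
        using \<open>a \<le> p\<close> \<open>p \<le> b\<close> by (intro exI[of _ "{p}"]) auto
    qed
    then show ?case using d1(1) d2(1) by (intro exI[of _ "min d1 d2"]) auto
  qed
  then obtain J where "finite J" "J \<subseteq> {0..T}"
    "\<And>s t. 0 \<le> s \<and> s \<le> t \<and> t \<le> T \<and> J \<inter> {s<..t} = {} \<Longrightarrow> x s = x t"
    unfolding P_def by auto
  then have "step_path T (insert 0 (insert T J)) x"
    using assms(1) unfolding step_path_def by auto
  then show ?thesis ..
qed

text \<open>Skorokhod closeness for the discrete topology on the state space: after the time change
  the values agree exactly. It therefore implies closeness for every finite set of test functions
  simultaneously, whatever map into the dual is applied.\<close>

definition discrete_near :: "real \<Rightarrow> real \<Rightarrow> (real \<Rightarrow> 's) \<Rightarrow> (real \<Rightarrow> 's) \<Rightarrow> bool"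
  where "discrete_near T \<delta> x y \<longleftrightarrow>
    (\<exists>\<tau>\<in>time_changes T. \<forall>t\<in>{0..T}. \<bar>\<tau> t - t\<bar> < \<delta> \<and> x t = y (\<tau> t))"

lemma discrete_near_mono:
  assumes "discrete_near T \<delta> x y" "\<delta> \<le> \<epsilon>"
  shows "discrete_near T \<epsilon> x y"
  using assms unfolding discrete_near_def by (meson less_le_trans)

lemma discrete_near_sym:
  assumes "discrete_near T \<delta> x y"
  shows "discrete_near T \<delta> y x"
proof -
  obtain \<tau> where \<tau>: "continuous_on {0..T} \<tau>" "strict_mono_on {0..T} \<tau>" "\<tau> ` {0..T} = {0..T}"
    "\<And>t. t \<in> {0..T} \<Longrightarrow> \<bar>\<tau> t - t\<bar> < \<delta> \<and> x t = y (\<tau> t)"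
    using assms unfolding discrete_near_def time_changes_def by blast
  have inj: "inj_on \<tau> {0..T}" using \<tau>(2) strict_mono_on_imp_inj_on by blast
  define \<sigma> where "\<sigma> = the_inv_into {0..T} \<tau>"
  have \<sigma>\<tau>: "\<sigma> (\<tau> t) = t" if "t \<in> {0..T}" for t
    unfolding \<sigma>_def by (rule the_inv_into_f_f[OF inj that])
  have \<tau>\<sigma>: "\<tau> (\<sigma> t) = t" "\<sigma> t \<in> {0..T}" if "t \<in> {0..T}" for t
    using f_the_inv_into_f[OF inj] the_inv_into_into[OF inj, of t "{0..T}"] that \<tau>(3)
    unfolding \<sigma>_def by auto
  have "continuous_on (\<tau> ` {0..T}) \<sigma>"
    by (rule continuous_on_inv[OF \<tau>(1)]) (use \<sigma>\<tau> in auto)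
  moreover have "strict_mono_on {0..T} \<sigma>"
  proof (rule strict_mono_onI)
    fix r s assume rs: "r \<in> {0..T}" "s \<in> {0..T}" "r < s"
    show "\<sigma> r < \<sigma> s"
    proof (rule ccontr)
      assume "\<not> \<sigma> r < \<sigma> s"
      then have "\<tau> (\<sigma> s) \<le> \<tau> (\<sigma> r)"
        using \<tau>(2) \<tau>\<sigma>(2) rs strict_mono_on_leD by (metis linorder_not_less)
      then show False using \<tau>\<sigma> rs by auto
    qed
  qed
  moreover have "\<sigma> ` {0..T} = {0..T}"
  proof
    show "\<sigma> ` {0..T} \<subseteq> {0..T}" using \<tau>\<sigma>(2) by blast
    show "{0..T} \<subseteq> \<sigma> ` {0..T}"
    proof
      fix t assume t: "t \<in> {0..T}"
      then have "t = \<sigma> (\<tau> t)" "\<tau> t \<in> {0..T}" using \<sigma>\<tau> \<tau>(3) by auto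
      then show "t \<in> \<sigma> ` {0..T}" by blast
    qed
  qed
  ultimately have "\<sigma> \<in> time_changes T" using \<tau>(3) by (simp add: time_changes_def)
  moreover have "\<bar>\<sigma> t - t\<bar> < \<delta> \<and> y t = x (\<sigma> t)" if "t \<in> {0..T}" for t
    using \<tau>(4)[OF \<tau>\<sigma>(2)[OF that]] \<tau>\<sigma>(1)[OF that] by (auto simp: abs_minus_commute)
  ultimately show ?thesis unfolding discrete_near_def by blast
qed

lemma discrete_near_trans:
  assumes "discrete_near T \<delta> x y" "discrete_near T \<epsilon> y z"
  shows "discrete_near T (\<delta> + \<epsilon>) x z"
proof -
  obtain \<tau> where \<tau>: "continuous_on {0..T} \<tau>" "strict_mono_on {0..T} \<tau>" "\<tau> ` {0..T} = {0..T}"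
    "\<And>t. t \<in> {0..T} \<Longrightarrow> \<bar>\<tau> t - t\<bar> < \<delta> \<and> x t = y (\<tau> t)"
    using assms(1) unfolding discrete_near_def time_changes_def by blast
  obtain \<sigma> where \<sigma>: "continuous_on {0..T} \<sigma>" "strict_mono_on {0..T} \<sigma>" "\<sigma> ` {0..T} = {0..T}"
    "\<And>t. t \<in> {0..T} \<Longrightarrow> \<bar>\<sigma> t - t\<bar> < \<epsilon> \<and> y t = z (\<sigma> t)"
    using assms(2) unfolding discrete_near_def time_changes_def by blast
  have \<tau>in: "\<tau> t \<in> {0..T}" if "t \<in> {0..T}" for t using \<tau>(3) that by blast
  have "\<sigma> \<circ> \<tau> \<in> time_changes T"
    unfolding time_changes_def
  proof (intro CollectI conjI)
    show "continuous_on {0..T} (\<sigma> \<circ> \<tau>)" using \<tau> \<sigma> continuous_on_compose by metis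
    show "strict_mono_on {0..T} (\<sigma> \<circ> \<tau>)"
    proof (rule strict_mono_onI)
      fix r s assume rs: "r \<in> {0..T}" "s \<in> {0..T}" "r < s"
      then have "\<tau> r < \<tau> s" using strict_mono_onD[OF \<tau>(2)] by blast
      then show "(\<sigma> \<circ> \<tau>) r < (\<sigma> \<circ> \<tau>) s"
        using strict_mono_onD[OF \<sigma>(2) \<tau>in \<tau>in] rs by simp
    qed
    show "(\<sigma> \<circ> \<tau>) ` {0..T} = {0..T}" using \<tau>(3) \<sigma>(3) by (metis image_comp)
  qed
  moreover have "\<bar>(\<sigma> \<circ> \<tau>) t - t\<bar> < \<delta> + \<epsilon> \<and> x t = z ((\<sigma> \<circ> \<tau>) t)" if "t \<in> {0..T}" for t
    using \<tau>(4)[OF that] \<sigma>(4)[OF \<tau>in[OF that]] by auto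
  ultimately show ?thesis unfolding discrete_near_def by blast
qed

text \<open>For \<open>t\<close> in \<open>{0..T}\<close> this is the last grid point not after
  \<open>t\<close>. The \<open>min\<close> keeps the index within \<open>0..m\<close> for every real
  \<open>t\<close>, so that a discretised path is a function of \<open>m + 1\<close> values.\<close>

definition grid_floor :: "real \<Rightarrow> nat \<Rightarrow> real \<Rightarrow> real"
  where "grid_floor T m t = real (min m (nat \<lfloor>t * real m / T\<rfloor>)) * T / real m"

text \<open>The time change moves each jump time to the next grid point by adding a small triangular bump
  centred at the jump time.\<close>

lemma discrete_near_grid:
  fixes x :: "real \<Rightarrow> 's"
  assumes T: "0 < T" and \<delta>: "0 < \<delta>" and x: "step_path T J x"
  shows "\<forall>\<^sub>F m in sequentially. discrete_near T \<delta> x (\<lambda>t. x (grid_floor T m t))"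
proof -
  have J: "finite J" "J \<subseteq> {0..T}" "0 \<in> J" "T \<in> J"
    and Jx: "\<And>s t. 0 \<le> s \<Longrightarrow> s \<le> t \<Longrightarrow> t \<le> T \<Longrightarrow> J \<inter> {s<..t} = {} \<Longrightarrow> x s = x t"
    using x unfolding step_path_def by blast+
  \<comment> \<open>\<open>\<rho>\<close> is at most the least distance between points of
    \<open>J\<close>, so a bump of half-width \<open>\<rho>\<close> centred at one of them vanishes
    at all the others. The inserted 1 makes \<open>D\<close> nonempty at once.\<close>
  define D where "D = insert 1 ((\<lambda>(j, k). \<bar>j - k\<bar>) ` {(j, k) \<in> J \<times> J. j \<noteq> k})"
  define \<rho> where "\<rho> = Min D"
  have "finite {(j, k) \<in> J \<times> J. j \<noteq> k}"
    by (rule finite_subset[of _ "J \<times> J"]) (use J(1) in auto)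
  then have D: "finite D" "D \<noteq> {}" unfolding D_def by blast+
  have \<rho>0: "\<rho> > 0" unfolding \<rho>_def using D by (subst Min_gr_iff) (auto simp: D_def)
  have \<rho>: "\<rho> \<le> \<bar>j - k\<bar>" if "j \<in> J" "k \<in> J" "j \<noteq> k" for j k
    unfolding \<rho>_def using D that by (intro Min_le) (auto simp: D_def)
  \<comment> \<open>The total height of the bumps is at most \<open>card J * T / m\<close>. Below
    \<open>\<rho>\<close> the slopes add to less than 1 and the time change stays increasing; below
    \<open>\<delta>\<close> the displacement is small enough.\<close>
  define \<eta> where "\<eta> = min \<delta> \<rho>"
  have "(\<lambda>m. real (card J) * T / real m) \<longlonglongrightarrow> 0"
    by (rule lim_const_over_n)
  then have "\<forall>\<^sub>F m in sequentially. real (card J) * T / real m < \<eta>"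
    using \<rho>0 \<delta> by (intro order_tendstoD) (auto simp: \<eta>_def)
  then show ?thesis
    using eventually_gt_at_top[of 0]
  proof eventually_elim
    case (elim m)
    \<comment> \<open>Jump times are rounded up: a grid point reached after \<open>u j\<close> then
      sees the state after the jump at \<open>j\<close>, and the last grid point before
      \<open>u j\<close> lies strictly before \<open>j\<close>. The end points 0 and
      \<open>T\<close> stay fixed.\<close>
    define u where "u j = of_int \<lceil>j * real m / T\<rceil> * T / real m" for j
    define c where "c j = u j - j" for j
    define h where "h j t = max 0 (1 - \<bar>t - j\<bar> / \<rho>)" for j t
    define \<tau> where "\<tau> t = t + (\<Sum>j\<in>J. c j * h j t)" for t
    have m: "real m > 0" using elim by simp
    have c: "0 \<le> c j" "c j \<le> T / real m" for j
    proof -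
      have "j * real m / T \<le> of_int \<lceil>j * real m / T\<rceil>" "of_int \<lceil>j * real m / T\<rceil> \<le> j * real m / T + 1"
        by linarith+
      then have "j * real m \<le> of_int \<lceil>j * real m / T\<rceil> * T" "of_int \<lceil>j * real m / T\<rceil> * T \<le> j * real m + T"
        using T mult_right_mono[of "j * real m / T" "of_int \<lceil>j * real m / T\<rceil>" T]
          mult_right_mono[of "of_int \<lceil>j * real m / T\<rceil>" "j * real m / T + 1" T]
        by (simp_all add: distrib_right)
      moreover have "c j = (of_int \<lceil>j * real m / T\<rceil> * T - j * real m) / real m"
        unfolding c_def u_def using m by (simp add: diff_divide_distrib)
      ultimately show "0 \<le> c j" "c j \<le> T / real m"
        using m by (auto intro: divide_right_mono)
    qed
    have h: "0 \<le> h j t" "h j t \<le> 1" for j t using \<rho>0 by (auto simp: h_def)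
    have hL: "\<bar>h j s - h j t\<bar> \<le> \<bar>s - t\<bar> / \<rho>" for j s t
    proof -
      have "\<bar>h j s - h j t\<bar> \<le> \<bar>\<bar>t - j\<bar> / \<rho> - \<bar>s - j\<bar> / \<rho>\<bar>"
        unfolding h_def by linarith
      also have "\<dots> = \<bar>\<bar>t - j\<bar> - \<bar>s - j\<bar>\<bar> / \<rho>"
        using \<rho>0 by (simp add: diff_divide_distrib[symmetric])
      also have "\<dots> \<le> \<bar>s - t\<bar> / \<rho>"
        using \<rho>0 by (intro divide_right_mono) auto
      finally show ?thesis .
    qed
    have cJ: "(\<Sum>j\<in>J. c j * v) \<le> real (card J) * T / real m * v" if "0 \<le> v" for v
    proof -
      have "(\<Sum>j\<in>J. c j * v) \<le> (\<Sum>j\<in>J. T / real m * v)"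
        using c that by (intro sum_mono mult_right_mono) auto
      then show ?thesis by simp
    qed
    have mono: "\<tau> s < \<tau> t" if "s < t" for s t
    proof -
      have "(\<Sum>j\<in>J. c j * h j s) - (\<Sum>j\<in>J. c j * h j t) = (\<Sum>j\<in>J. c j * (h j s - h j t))"
        by (simp add: sum_subtractf right_diff_distrib)
      also have "\<dots> \<le> (\<Sum>j\<in>J. c j * ((t - s) / \<rho>))"
        using c hL[of _ s t] that by (intro sum_mono mult_left_mono) (auto intro: order_trans[OF abs_ge_self])
      also have "\<dots> \<le> real (card J) * T / real m * ((t - s) / \<rho>)"
        using that \<rho>0 by (intro cJ) auto
      also have "\<dots> < \<rho> * ((t - s) / \<rho>)"
        using elim that \<rho>0 by (intro mult_strict_right_mono) (auto simp: \<eta>_def)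
      also have "\<dots> = t - s" using \<rho>0 by simp
      finally show ?thesis by (simp add: \<tau>_def)
    qed
    have \<tau>j: "\<tau> j = u j" if "j \<in> J" for j
    proof -
      have "h k j = 0" if "k \<in> J - {j}" for k
        using \<rho>[of j k] that \<open>j \<in> J\<close> \<rho>0 by (auto simp: h_def)
      then have "(\<Sum>k\<in>J. c k * h k j) = c j * h j j"
        using \<open>j \<in> J\<close> J(1) by (subst sum.remove[of _ j]) auto
      then show ?thesis by (simp add: \<tau>_def h_def c_def)
    qed
    have ends: "\<tau> 0 = 0" "\<tau> T = T"
      using \<tau>j J m T by (auto simp: u_def)
    have cont: "continuous_on {0..T} \<tau>"
      unfolding \<tau>_def h_def using \<rho>0 by (intro continuous_intros) auto
    have img: "\<tau> ` {0..T} = {0..T}"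
    proof
      show "\<tau> ` {0..T} \<subseteq> {0..T}"
      proof (rule image_subsetI)
        fix t assume "t \<in> {0..T}"
        then show "\<tau> t \<in> {0..T}"
          using mono[of 0 t] mono[of t T] ends by (cases "t = 0"; cases "t = T") auto
      qed
      show "{0..T} \<subseteq> \<tau> ` {0..T}"
      proof
        fix y assume "y \<in> {0..T}"
        then obtain t where "0 \<le> t" "t \<le> T" "\<tau> t = y"
          using IVT'[of \<tau> 0 y T] ends cont T by auto
        then show "y \<in> \<tau> ` {0..T}" by auto
      qed
    qed
    have "\<tau> \<in> time_changes T"
      using cont img mono by (auto simp: time_changes_def intro: strict_mono_onI)
    moreover have "\<bar>\<tau> t - t\<bar> < \<delta>" for t
    proof -
      have "0 \<le> (\<Sum>j\<in>J. c j * h j t)" using c h by (intro sum_nonneg mult_nonneg_nonneg)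
      moreover have "(\<Sum>j\<in>J. c j * h j t) \<le> (\<Sum>j\<in>J. c j * 1)"
        using c h by (intro sum_mono mult_left_mono)
      moreover have "\<dots> \<le> real (card J) * T / real m * 1" by (rule cJ) simp
      ultimately show ?thesis using elim by (simp add: \<tau>_def \<eta>_def)
    qed
    moreover have "x t = x (grid_floor T m (\<tau> t))" if t: "t \<in> {0..T}" for t
    proof -
      \<comment> \<open>The last point of \<open>J\<close> not after \<open>t\<close>, which exists
        as 0 is in \<open>J\<close>. Both \<open>t\<close> and the grid point \<open>g\<close> turn
        out to lie in the stretch from \<open>j\<close> to the next point of \<open>J\<close>, where
        the path is constant.\<close>
      define j where "j = Max {k \<in> J. k \<le> t}"
      have "j \<in> {k \<in> J. k \<le> t}"
        unfolding j_def using J t by (intro Max_in) auto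
      then have j: "j \<in> J" "j \<le> t" by auto
      have jmax: "k \<le> j" if "k \<in> J" "k \<le> t" for k
        unfolding j_def using that J(1) by (intro Max_ge) auto
      define g where "g = grid_floor T m (\<tau> t)"
      have \<tau>t: "0 \<le> \<tau> t" "\<tau> t \<le> T" using img t by auto
      have "\<lfloor>\<tau> t * real m / T\<rfloor> \<le> int m"
      proof -
        have "\<tau> t * real m / T \<le> T * real m / T"
          using \<tau>t T m by (intro divide_right_mono mult_right_mono) auto
        then show ?thesis using T by (simp add: floor_le_iff)
      qed
      moreover have "0 \<le> \<lfloor>\<tau> t * real m / T\<rfloor>" using \<tau>t T m by simp
      ultimately have g: "g = of_int \<lfloor>\<tau> t * real m / T\<rfloor> * T / real m"
        unfolding g_def grid_floor_def by (simp add: min_absorb2 nat_le_iff)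
      have g_le: "g \<le> \<tau> t"
      proof -
        have "of_int \<lfloor>\<tau> t * real m / T\<rfloor> * T \<le> \<tau> t * real m / T * T"
          using T by (intro mult_right_mono) auto
        then show ?thesis unfolding g using T m by (auto simp: field_simps)
      qed
      have "u j \<le> \<tau> t"
        using \<tau>j[OF j(1)] mono[of j t] j(2) by (cases "j = t") auto
      then have "of_int \<lceil>j * real m / T\<rceil> \<le> \<tau> t * real m / T"
        unfolding u_def using T m by (auto simp: field_simps)
      then have "\<lceil>j * real m / T\<rceil> \<le> \<lfloor>\<tau> t * real m / T\<rfloor>" by (simp add: le_floor_iff)
      then have "u j \<le> g"
        unfolding g u_def using T m by (intro divide_right_mono mult_right_mono) auto
      then have jg: "j \<le> g" using c(1)[of j] by (simp add: c_def)
      have "J \<inter> {j<..t} = {}" using jmax by force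
      then have "x j = x t" using Jx[of j t] j J(2) t by auto
      moreover have "J \<inter> {j<..g} = {}"
      proof (rule ccontr)
        assume "J \<inter> {j<..g} \<noteq> {}"
        then obtain k where k: "k \<in> J" "j < k" "k \<le> g" by auto
        then have "t < k" using jmax[of k] by force
        then have "\<tau> t < u k" using mono \<tau>j[OF k(1)] by metis
        then have "\<tau> t * real m / T < of_int \<lceil>k * real m / T\<rceil>"
          unfolding u_def using T m by (auto simp: field_simps)
        then have "\<lfloor>\<tau> t * real m / T\<rfloor> < \<lceil>k * real m / T\<rceil>" by (simp add: floor_less_iff)
        then have "of_int \<lfloor>\<tau> t * real m / T\<rfloor> < k * real m / T" by (simp add: less_ceiling_iff)
        then have "g < k" unfolding g using T m by (auto simp: field_simps)
        then show False using k(3) by simp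
      qed
      then have "x j = x g" using Jx[of j g] jg j J(2) g_le \<tau>t by auto
      ultimately show ?thesis by (simp add: g_def)
    qed
    ultimately show ?case unfolding discrete_near_def by blast
  qed
qed

lemma skorokhod_nbhd_embed:
  assumes near: "discrete_near T \<epsilon> x y" and \<epsilon>: "0 < \<epsilon>"
    and y: "(\<lambda>t\<in>{0..T}. \<Psi> (y t)) \<in> cadlag_paths T"
  shows "(\<lambda>t\<in>{0..T}. \<Psi> (y t)) \<in> skorokhod_nbhd T (\<lambda>t\<in>{0..T}. \<Psi> (x t)) F \<epsilon>"
proof -
  obtain \<tau> where \<tau>: "\<tau> \<in> time_changes T" "\<And>t. t \<in> {0..T} \<Longrightarrow> \<bar>\<tau> t - t\<bar> < \<epsilon> \<and> x t = y (\<tau> t)"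
    using near unfolding discrete_near_def by blast
  then have "\<tau> t \<in> {0..T}" if "t \<in> {0..T}" for t
    using that unfolding time_changes_def by blast
  then have "\<forall>t\<in>{0..T}. \<bar>\<tau> t - t\<bar> < \<epsilon> \<and> (\<forall>f\<in>F. \<bar>blinfun_apply ((\<lambda>t\<in>{0..T}. \<Psi> (x t)) t) f -
      blinfun_apply ((\<lambda>t\<in>{0..T}. \<Psi> (y t)) (\<tau> t)) f\<bar> < \<epsilon>)"
    using \<tau>(2) \<epsilon> by simp
  with \<tau>(1) y show ?thesis
    unfolding skorokhod_nbhd_def by blast
qed

lemma embed_cadlag:
  assumes right: "\<And>t. 0 \<le> t \<Longrightarrow> \<forall>\<^sub>F s in at_right t. x s = x t"
    and left: "\<And>t. 0 < t \<Longrightarrow> \<exists>c. \<forall>\<^sub>F s in at_left t. x s = c"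
  shows "(\<lambda>t\<in>{0..T}. \<Psi> (x t)) \<in> cadlag_paths T"
  unfolding cadlag_paths_def
proof (intro CollectI conjI ballI)
  fix t assume t: "t \<in> {0..<T}"
  have "\<forall>\<^sub>F s in at_right t. s < T" using t by (auto simp: eventually_at_right_field)
  moreover have "\<forall>\<^sub>F s in at_right t. t < s" by (simp add: eventually_at_right_less)
  moreover have "\<forall>\<^sub>F s in at_right t. x s = x t" using right t by simp
  ultimately have "\<forall>\<^sub>F s in at_right t. (\<lambda>t\<in>{0..T}. \<Psi> (x t)) s = (\<lambda>t\<in>{0..T}. \<Psi> (x t)) t"
    by eventually_elim (use t in auto)
  then show "limitin weak_star (\<lambda>t\<in>{0..T}. \<Psi> (x t)) ((\<lambda>t\<in>{0..T}. \<Psi> (x t)) t) (at_right t)"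
    by (intro limitin_eventually) auto
next
  fix t assume t: "t \<in> {0<..T}"
  then obtain c where "\<forall>\<^sub>F s in at_left t. x s = c" using left by auto
  moreover have "\<forall>\<^sub>F s in at_left t. 0 < s" using t by (auto simp: eventually_at_left_field)
  moreover have "\<forall>\<^sub>F s in at_left t. s < t"
    unfolding eventually_at_left_field by (intro exI[of _ "t - 1"]) auto
  ultimately have "\<forall>\<^sub>F s in at_left t. (\<lambda>t\<in>{0..T}. \<Psi> (x t)) s = \<Psi> c"
    by eventually_elim (use t in auto)
  then show "\<exists>l. limitin weak_star (\<lambda>t\<in>{0..T}. \<Psi> (x t)) l (at_left t)"
    by (intro exI[of _ "\<Psi> c"] limitin_eventually) auto
qed (rule restrict_extensional)

text \<open>The weak-* Skorokhod topology is not metrizable, so limits of measurable maps need not be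
  measurable. The way out is that the preimage of an open set \<open>U\<close> only depends on the
  step path itself: it is the set of paths all of whose late grid discretisations lie, together with
  a \<open>1/r\<close>-neighbourhood for the discrete topology of the state space, in \<open>U\<close>.\<close>

lemma measurable_step_process:
  fixes X :: "real \<Rightarrow> 'w \<Rightarrow> 's" and \<Psi> :: "'s \<Rightarrow> dual_C01"
  assumes T: "0 < T" and E: "countable E"
    and X: "\<And>t. 0 \<le> t \<Longrightarrow> X t \<in> measurable M (count_space E)"
    and right: "\<And>w t. w \<in> space M \<Longrightarrow> 0 \<le> t \<Longrightarrow> \<forall>\<^sub>F s in at_right t. X s w = X t w"
    and left: "\<And>w t. w \<in> space M \<Longrightarrow> 0 < t \<Longrightarrow> \<exists>c. \<forall>\<^sub>F s in at_left t. X s w = c"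
  shows "(\<lambda>w. \<lambda>t\<in>{0..T}. \<Psi> (X t w)) \<in> measurable M (borel_of (skorokhod T))"
  unfolding borel_of_def
proof (rule measurable_sigma_sets[OF sets_measure_of])
  define emb where "emb x = (\<lambda>t\<in>{0..T}. \<Psi> (x t))" for x :: "real \<Rightarrow> 's"
  have emb_cadlag: "emb (\<lambda>t. X t w) \<in> cadlag_paths T" if "w \<in> space M" for w
    unfolding emb_def using that by (intro embed_cadlag right left)
  then show "(\<lambda>w. \<lambda>t\<in>{0..T}. \<Psi> (X t w)) \<in> space M \<rightarrow> topspace (skorokhod T)"
    by (auto simp: emb_def)
  show "{U. openin (skorokhod T) U} \<subseteq> Pow (topspace (skorokhod T))"
    using openin_subset by blast
  then show "{U. openin (skorokhod T) U} \<subseteq> Pow (topspace (skorokhod T))" .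
  fix U assume "U \<in> {U. openin (skorokhod T) U}"
  then have U: "skorokhod_open T U" by (simp add: openin_skorokhod)
  \<comment> \<open>No measurability of \<open>Ur r\<close> is claimed: a discretised path takes
    only countably many values, so its preimage of an arbitrary set is measurable. The cadlag
    condition restricts \<open>y\<close> to paths that can belong to \<open>U\<close> at
    all.\<close>
  define Ur where "Ur r = {x. \<forall>y. discrete_near T (1 / real (Suc r)) x y \<and> emb y \<in> cadlag_paths T \<longrightarrow> emb y \<in> U}" for r
  define Y where "Y m w = (\<lambda>t. X (grid_floor T m t) w)" for m w
  have near: "\<forall>\<^sub>F m in sequentially. discrete_near T (1 / real (Suc r)) (\<lambda>t. X t w) (Y m w)"
    if w: "w \<in> space M" for r w
  proof -
    obtain J where "step_path T J (\<lambda>t. X t w)"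
      using step_path_exists[OF less_imp_le[OF T] right[OF w] left[OF w]] by blast
    from discrete_near_grid[OF T _ this] show ?thesis unfolding Y_def by simp
  qed
  have iff: "emb (\<lambda>t. X t w) \<in> U \<longleftrightarrow> (\<exists>r m0. \<forall>m\<ge>m0. Y m w \<in> Ur r)" if w: "w \<in> space M" for w
  proof
    assume "emb (\<lambda>t. X t w) \<in> U"
    then obtain F \<epsilon> where \<epsilon>: "\<epsilon> > 0" "skorokhod_nbhd T (emb (\<lambda>t. X t w)) F \<epsilon> \<subseteq> U"
      using U unfolding skorokhod_open_def by blast
    obtain r where r: "1 / real (Suc r) < \<epsilon> / 2"
      using \<epsilon>(1) by (metis half_gt_zero nat_approx_posE)
    obtain m0 where m0: "\<And>m. m \<ge> m0 \<Longrightarrow> discrete_near T (1 / real (Suc r)) (\<lambda>t. X t w) (Y m w)"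
      using near[OF w, of r] unfolding eventually_sequentially by blast
    have "Y m w \<in> Ur r" if "m \<ge> m0" for m
      unfolding Ur_def
    proof (intro CollectI allI impI)
      fix y assume y: "discrete_near T (1 / real (Suc r)) (Y m w) y \<and> emb y \<in> cadlag_paths T"
      \<comment> \<open>One radius leads from the path to its discretisation and a second one from
        there to \<open>y\<close>; hence \<open>r\<close> was chosen for half of
        \<open>\<epsilon>\<close>.\<close>
      have "discrete_near T (1 / real (Suc r) + 1 / real (Suc r)) (\<lambda>t. X t w) y"
        using discrete_near_trans[OF m0[OF that]] y by blast
      then have "discrete_near T \<epsilon> (\<lambda>t. X t w) y"
        by (rule discrete_near_mono) (use r in linarith)
      then show "emb y \<in> U"
        using skorokhod_nbhd_embed[of T \<epsilon> "\<lambda>t. X t w" y \<Psi> F] \<epsilon> y unfolding emb_def by blast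
    qed
    then show "\<exists>r m0. \<forall>m\<ge>m0. Y m w \<in> Ur r" by blast
  next
    assume "\<exists>r m0. \<forall>m\<ge>m0. Y m w \<in> Ur r"
    then obtain r m0 where *: "\<And>m. m \<ge> m0 \<Longrightarrow> Y m w \<in> Ur r" by blast
    obtain m1 where m1: "\<And>m. m \<ge> m1 \<Longrightarrow> discrete_near T (1 / real (Suc r)) (\<lambda>t. X t w) (Y m w)"
      using near[OF w, of r] unfolding eventually_sequentially by blast
    \<comment> \<open>By symmetry the path itself lies in the neighbourhood of its late
      discretisations, so membership in \<open>Ur r\<close> applies to it.\<close>
    show "emb (\<lambda>t. X t w) \<in> U"
      using *[of "max m0 m1"] discrete_near_sym[OF m1[of "max m0 m1"]] emb_cadlag[OF w]
      unfolding Ur_def by auto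
  qed
  \<comment> \<open>\<open>Y m w\<close> is a function of the vector \<open>V w\<close> of grid
    values, which ranges over a countable set all of whose subsets are admissible.\<close>
  have meas: "{w \<in> space M. Y m w \<in> A} \<in> sets M" for m A
  proof -
    define V where "V w = (\<lambda>k\<in>{..m}. X (real k * T / real m) w)" for w
    have Yv: "Y m w = (\<lambda>t. V w (min m (nat \<lfloor>t * real m / T\<rfloor>)))" for w
      by (auto simp: Y_def V_def grid_floor_def)
    have "V \<in> measurable M (count_space (PiE {..m} (\<lambda>_. E)))"
    proof (rule measurable_count_space_eq_countable[THEN iffD2])
      show "countable (PiE {..m} (\<lambda>_. E))" using E by (intro countable_PiE) auto
      show "V \<in> space M \<rightarrow> PiE {..m} (\<lambda>_. E) \<and> (\<forall>a\<in>PiE {..m} (\<lambda>_. E). V -` {a} \<inter> space M \<in> sets M)"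
      proof (intro conjI ballI)
        show "V \<in> space M \<rightarrow> PiE {..m} (\<lambda>_. E)"
          using measurable_space[OF X] T by (auto simp: V_def)
        fix a assume a: "a \<in> PiE {..m} (\<lambda>_. E)"
        have "V -` {a} \<inter> space M = (\<Inter>k\<in>{..m}. X (real k * T / real m) -` {a k} \<inter> space M)"
        proof (intro set_eqI iffI)
          fix w assume "w \<in> (\<Inter>k\<in>{..m}. X (real k * T / real m) -` {a k} \<inter> space M)"
          then have "V w = a" "w \<in> space M"
            using a by (auto simp: V_def PiE_iff extensional_def)
          then show "w \<in> V -` {a} \<inter> space M" by simp
        qed (auto simp: V_def)
        moreover have "\<dots> \<in> sets M"
          using T a by (intro sets.finite_INT measurable_sets[OF X]) (auto simp: PiE_iff)
        ultimately show "V -` {a} \<inter> space M \<in> sets M" by simp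
      qed
    qed
    from measurable_sets[OF this, of "{v \<in> PiE {..m} (\<lambda>_. E). (\<lambda>t. v (min m (nat \<lfloor>t * real m / T\<rfloor>))) \<in> A}"]
    have "V -` {v \<in> PiE {..m} (\<lambda>_. E). (\<lambda>t. v (min m (nat \<lfloor>t * real m / T\<rfloor>))) \<in> A} \<inter> space M \<in> sets M"
      by auto
    also have "V -` {v \<in> PiE {..m} (\<lambda>_. E). (\<lambda>t. v (min m (nat \<lfloor>t * real m / T\<rfloor>))) \<in> A} \<inter> space M
        = {w \<in> space M. Y m w \<in> A}"
      using measurable_space[OF \<open>V \<in> _\<close>] unfolding Yv by auto
    finally show ?thesis .
  qed
  have "(\<lambda>w. \<lambda>t\<in>{0..T}. \<Psi> (X t w)) -` U \<inter> space M = {w \<in> space M. emb (\<lambda>t. X t w) \<in> U}"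
    by (auto simp: emb_def)
  also have "\<dots> = {w \<in> space M. \<exists>r m0. \<forall>m\<in>{m0..}. Y m w \<in> Ur r}"
    using iff by (simp cong: conj_cong add: Ball_def)
  also have "\<dots> \<in> sets M"
    by (intro sets.sets_Collect_countable_Ex sets.sets_Collect_countable_All' meas) auto
  finally show "(\<lambda>w. \<lambda>t\<in>{0..T}. \<Psi> (X t w)) -` U \<inter> space M \<in> sets M" .
qed


section \<open>Weak convergence\<close>

context urn_rates
begin

lemma flow_lipschitz:
  assumes "0 \<le> s" "s \<le> t" "t \<le> T"
  shows "\<bar>(flow \<phi> t) f - (flow \<phi> s) f\<bar> \<le>
    (t - s) * (norm \<phi> * (norm f * (2 * \<Lambda>) * exp (2 * \<Lambda> * T)))"
proof (cases "s = t")
  case False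
  then obtain z where z: "s < z" "z < t" "(flow \<phi> t) f - (flow \<phi> s) f =
      (t - s) * (flow \<phi> z) (drift f)"
    using MVT2[of s t "\<lambda>t. (flow \<phi> t) f" "\<lambda>t. (flow \<phi> t) (drift f)"]
      flow_has_derivative assms by auto
  have "\<bar>(flow \<phi> z) (drift f)\<bar> \<le> norm \<phi> * norm (drift f) * exp (2 * \<Lambda> * \<bar>z\<bar>)"
    unfolding flow_apply by (rule exp_series_bound[OF exp_type_init])
  also have "\<dots> \<le> norm \<phi> * (2 * \<Lambda> * norm f) * exp (2 * \<Lambda> * T)"
    using norm_drift_le[of f] z assms Lam_nonneg by (intro mult_mono mult_left_mono) (auto intro: mult_left_mono)
  finally have "\<bar>(flow \<phi> z) (drift f)\<bar> \<le> norm \<phi> * (norm f * (2 * \<Lambda>) * exp (2 * \<Lambda> * T))"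
    by (simp add: mult_ac)
  then show ?thesis using z assms by (simp add: abs_mult mult_left_mono)
qed simp

text \<open>For given \<open>s\<close> the horizon is taken to be a grid point
  \<open>\<theta> j\<close> at or shortly after \<open>s\<close>. A quarter of
  \<open>\<epsilon>\<close> each goes to the martingale deviation, twice the level
  \<open>\<epsilon> / 8\<close>; to the difference of discrete and limiting mean at the horizon; and
  to moving both quantities from the horizon back to \<open>s\<close>.\<close>

lemma uniform_convergence:
  fixes M :: "nat \<Rightarrow> 'w measure" and X :: "nat \<Rightarrow> real \<Rightarrow> 'w \<Rightarrow> nat \<Rightarrow> nat"
  assumes T: "0 < T"
    and proc: "\<And>N. 1 \<le> N \<Longrightarrow> ehrenfest_process N lam (M N) (X N)"
    and indep: "\<And>N. 1 \<le> N \<Longrightarrow>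
      prob_space.indep_vars (M N) (\<lambda>_. count_space UNIV) (\<lambda>i \<omega>. X N 0 \<omega> i) {1..N}"
    and pois: "\<And>N i. 1 \<le> N \<Longrightarrow> i \<in> {1..N} \<Longrightarrow>
      poisson_distributed (M N) (\<lambda>\<omega>. X N 0 \<omega> i) (sample N \<phi> i)"
    and \<epsilon>: "0 < \<epsilon>" and \<eta>: "0 < \<eta>"
  shows "\<forall>\<^sub>F N in sequentially. \<exists>B\<in>sets (M N). measure (M N) B \<le> \<eta> \<and>
    (\<forall>\<omega>\<in>space (M N) - B. \<forall>s\<in>{0..T}.
      \<bar>(empirical_functional N (X N s \<omega>)) f - (flow \<phi> s) f\<bar> \<le> \<epsilon>)"
proof -
  define C where "C = norm f * (2 * \<Lambda>) * exp (2 * \<Lambda> * T)"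
  have C: "0 \<le> C" using Lam_nonneg by (simp add: C_def)
  \<comment> \<open>Error per unit of time between \<open>s\<close> and its horizon: the first
    summand for the empirical measure, whose mass is at most norm of phi plus 1, the second for the
    limiting flow.\<close>
  define D where "D = (norm \<phi> + 1) * C + norm \<phi> * C"
  have D: "0 \<le> D" using C by (simp add: D_def)
  obtain J :: nat where J: "4 * T * D / \<epsilon> < real J" using reals_Archimedean2 by blast
  have "0 \<le> 4 * T * D / \<epsilon>" using T D \<epsilon> by simp
  then have J0: "0 < real J" using J by linarith
  have JD: "T / real J * D \<le> \<epsilon> / 4" using J J0 \<epsilon> by (simp add: field_simps)
  define \<theta> where "\<theta> j = T * real j / real J" for j :: nat
  have \<theta>0: "0 < \<theta> j" if "j \<in> {1..J}" for j using that T J0 by (simp add: \<theta>_def)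
  have \<theta>T: "\<theta> j \<le> T" if "j \<in> {1..J}" for j
    using that T J0 by (simp add: \<theta>_def field_simps)
  define m where "m N t = (\<Sum>i=1..N. sample N \<phi> i * urn_boxes.box_flow lam N (sample N f) t i) / real N" for N t
  define c where "c t = norm \<phi> + norm \<phi> * (norm f * exp (2 * \<Lambda> * t))\<^sup>2 / (\<epsilon> / 8)\<^sup>2 +
    (norm \<phi> + 1) * ((norm f)\<^sup>2 * exp (2 * \<Lambda> * t)) / (\<epsilon> / 8)\<^sup>2" for t
  have "\<forall>\<^sub>F N in sequentially. \<forall>j\<in>{1..J}. \<bar>m N (\<theta> j) - (flow \<phi> (\<theta> j)) f\<bar> < \<epsilon> / 4"
  proof (intro eventually_ball_finite ballI)
    fix j
    have "(\<lambda>N. m N (\<theta> j)) \<longlonglongrightarrow> (flow \<phi> (\<theta> j)) f"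
      unfolding m_def by (rule sample_flow_tendsto)
    from tendstoD[OF this, of "\<epsilon> / 4"] \<epsilon>
    show "\<forall>\<^sub>F N in sequentially. \<bar>m N (\<theta> j) - (flow \<phi> (\<theta> j)) f\<bar> < \<epsilon> / 4"
      by (simp add: dist_real_def)
  qed simp
  moreover have "\<forall>\<^sub>F N in sequentially. \<forall>j\<in>{1..J}. c (\<theta> j) / real N < \<eta> / real J"
  proof (intro eventually_ball_finite ballI)
    fix j
    have "(\<lambda>N. c (\<theta> j) / real N) \<longlonglongrightarrow> 0" by (rule lim_const_over_n)
    moreover have "0 < \<eta> / real J" using \<eta> J0 by simp
    ultimately show "\<forall>\<^sub>F N in sequentially. c (\<theta> j) / real N < \<eta> / real J"
      by (rule order_tendstoD(2))
  qed simp
  ultimately show ?thesis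
    using eventually_ge_at_top[of 1]
  proof eventually_elim
    case (elim N)
    interpret urn_boxes lam \<Lambda> N by (rule urn_boxes[OF elim(3)])
    have N0: "0 < real N" using elim(3) by simp
    define near where "near j \<omega> \<longleftrightarrow> (\<exists>n. real n \<le> (norm \<phi> + 1) * real N \<and>
      (\<forall>s\<in>{0..\<theta> j}. X N s \<omega> \<in> states n \<and>
        \<bar>lin (box_flow (sample N f) (\<theta> j - s)) (X N s \<omega>) / real N - m N (\<theta> j)\<bar> \<le> 2 * (\<epsilon> / 8)))" for j \<omega>
    have "\<exists>B. B \<in> sets (M N) \<and> measure (M N) B \<le> c (\<theta> j) / real N \<and>
      (\<forall>\<omega>\<in>space (M N) - B. near j \<omega>)"
      if j: "j \<in> {1..J}" for j
    proof -
      have "0 < \<epsilon> / 8" using \<epsilon> by simp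
      from path_deviation[OF proc[OF elim(3)] indep[OF elim(3)] pois[OF elim(3)] \<theta>0[OF j] this, of f]
      show ?thesis unfolding near_def c_def m_def Bex_def .
    qed
    then have "\<forall>j\<in>{1..J}. \<exists>B. B \<in> sets (M N) \<and> measure (M N) B \<le> c (\<theta> j) / real N \<and>
      (\<forall>\<omega>\<in>space (M N) - B. near j \<omega>)" by blast
    from bchoice[OF this] obtain B where B0: "\<forall>j\<in>{1..J}. B j \<in> sets (M N) \<and> measure (M N) (B j) \<le> c (\<theta> j) / real N \<and>
      (\<forall>\<omega>\<in>space (M N) - B j. near j \<omega>)" ..
    define U where "U = (\<Union>j\<in>{1..J}. B j)"
    have UM: "U \<in> sets (M N)" unfolding U_def using B0 by (intro sets.finite_UN) auto
    have "measure (M N) U \<le> (\<Sum>j=1..J. measure (M N) (B j))"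
      unfolding U_def using B0 by (intro measure_UNION_le) auto
    also have "\<dots> \<le> (\<Sum>j=1..J. \<eta> / real J)"
    proof (rule sum_mono)
      fix j assume j: "j \<in> {1..J}"
      have "measure (M N) (B j) \<le> c (\<theta> j) / real N" using B0 j by blast
      also have "\<dots> \<le> \<eta> / real J" using elim(2) j by (simp add: less_imp_le)
      finally show "measure (M N) (B j) \<le> \<eta> / real J" .
    qed
    also have "\<dots> = \<eta>" using J0 by simp
    finally have U: "measure (M N) U \<le> \<eta>" .
    have "\<bar>(empirical_functional N (X N s \<omega>)) f - (flow \<phi> s) f\<bar> \<le> \<epsilon>"
      if \<omega>: "\<omega> \<in> space (M N) - U" and s: "s \<in> {0..T}" for \<omega> s
    proof -
      define q where "q = s * real J / T"
      have q: "0 \<le> q" "q \<le> real J" "s = T * q / real J"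
        using s T J0 by (auto simp: q_def field_simps)
      \<comment> \<open>The \<open>max\<close> with 1 concerns \<open>s = 0\<close>: the deviation
        bound requires a positive horizon.\<close>
      define j where "j = max 1 (nat \<lceil>q\<rceil>)"
      have "nat \<lceil>q\<rceil> \<le> J" using q(2) by (simp add: nat_le_iff ceiling_le_iff)
      then have j: "j \<in> {1..J}" using J0 by (auto simp: j_def)
      have "real (nat \<lceil>q\<rceil>) = of_int \<lceil>q\<rceil>" using q(1) by simp
      moreover have "q \<le> of_int \<lceil>q\<rceil>" "of_int \<lceil>q\<rceil> \<le> q + 1" by linarith+
      moreover have "real j = max 1 (real (nat \<lceil>q\<rceil>))" by (simp add: j_def max_def)
      ultimately have qj: "q \<le> real j" "real j \<le> q + 1" using q(1) by linarith+
      have sj: "s \<le> \<theta> j"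
        unfolding \<theta>_def q(3) using T J0 qj(1) by (intro divide_right_mono mult_left_mono) auto
      have "\<theta> j - s = T / real J * (real j - q)"
        unfolding \<theta>_def by (subst q(3)) (simp add: diff_divide_distrib right_diff_distrib)
      also have "\<dots> \<le> T / real J * 1" using T J0 qj(2) by (intro mult_left_mono) auto
      finally have js: "\<theta> j - s \<le> T / real J" by simp
      define r where "r = \<theta> j - s"
      have r: "0 \<le> r" "r \<le> T / real J" "r \<le> T" using sj js s \<theta>T[OF j] by (auto simp: r_def)
      have "\<omega> \<in> space (M N) - B j" using \<omega> j unfolding U_def by blast
      then obtain n where n: "real n \<le> (norm \<phi> + 1) * real N"
        "\<forall>s\<in>{0..\<theta> j}. X N s \<omega> \<in> states n \<and>
        \<bar>lin (box_flow (sample N f) (\<theta> j - s)) (X N s \<omega>) / real N - m N (\<theta> j)\<bar> \<le> 2 * (\<epsilon> / 8)"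
        using B0 j unfolding near_def by blast
      then have x: "X N s \<omega> \<in> states n"
        and dev: "\<bar>lin (box_flow (sample N f) r) (X N s \<omega>) / real N - m N (\<theta> j)\<bar> \<le> \<epsilon> / 4"
        using s sj by (auto simp: r_def)
      have "\<bar>lin (box_flow (sample N f) r) (X N s \<omega>) - lin (sample N f) (X N s \<omega>)\<bar> \<le>
          real n * (r * (norm f * (2 * \<Lambda>) * exp (2 * \<Lambda> * r)))"
        by (rule lin_box_flow_increment[OF x r(1)]) (rule sample_abs_le)
      also have "\<dots> \<le> ((norm \<phi> + 1) * real N) * (r * C)"
        unfolding C_def using n(1) r Lam_nonneg by (intro mult_mono mult_left_mono) (auto intro: mult_left_mono)
      finally have "\<bar>lin (box_flow (sample N f) r) (X N s \<omega>) - lin (sample N f) (X N s \<omega>)\<bar> / real N \<le>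
          (norm \<phi> + 1) * (r * C)"
        using N0 by (simp add: field_simps)
      then have inc: "\<bar>lin (box_flow (sample N f) r) (X N s \<omega>) / real N - lin (sample N f) (X N s \<omega>) / real N\<bar> \<le>
          (norm \<phi> + 1) * (r * C)"
        using N0 by (simp add: diff_divide_distrib[symmetric])
      have lip: "\<bar>(flow \<phi> (\<theta> j)) f - (flow \<phi> s) f\<bar> \<le> r * (norm \<phi> * C)"
        unfolding r_def C_def by (rule flow_lipschitz) (use s sj \<theta>T[OF j] in auto)
      have "(norm \<phi> + 1) * (r * C) + r * (norm \<phi> * C) = r * D" by (simp add: D_def algebra_simps)
      also have "\<dots> \<le> T / real J * D" using r D by (intro mult_right_mono) auto
      also have "\<dots> \<le> \<epsilon> / 4" by (rule JD)
      finally have small: "(norm \<phi> + 1) * (r * C) + r * (norm \<phi> * C) \<le> \<epsilon> / 4" .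
      have "\<bar>m N (\<theta> j) - (flow \<phi> (\<theta> j)) f\<bar> < \<epsilon> / 4" using elim(1) j by blast
      then show ?thesis
        unfolding empirical_functional_apply using dev inc lip small \<epsilon> by linarith
    qed
    then show ?case using UM U by blast
  qed
qed

end

section \<open>Laws on the path space and the final estimate\<close>

lemma space_borel_of: "space (borel_of X) = topspace X"
  unfolding borel_of_def by (rule space_measure_of) (auto dest: openin_subset)

lemma borel_measurable_continuous_map:
  assumes "continuous_map X euclideanreal G"
  shows "G \<in> borel_measurable (borel_of X)"
proof (rule borel_measurableI)
  fix S :: "real set" assume "open S"
  then have "openin X {x \<in> topspace X. G x \<in> S}"
    using assms by (simp add: continuous_map_def)
  moreover have "{x \<in> topspace X. G x \<in> S} = G -` S \<inter> space (borel_of X)"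
    by (auto simp: space_borel_of)
  moreover have "{U. openin X U} \<subseteq> sets (borel_of X)"
    unfolding borel_of_def by (subst sets_measure_of) (auto dest: openin_subset)
  ultimately show "G -` S \<inter> space (borel_of X) \<in> sets (borel_of X)" by auto
qed

theorem theorem2p3:
  fixes T :: real
    and lam :: "real \<Rightarrow> real \<Rightarrow> real"
    and \<phi> :: C01
    and M :: "nat \<Rightarrow> 'w measure"
    and X :: "nat \<Rightarrow> real \<Rightarrow> 'w \<Rightarrow> nat \<Rightarrow> nat"
  assumes "0 < T"
    and "\<forall>x\<in>{0..1}. \<forall>y\<in>{0..1}. 0 < lam x y"
    and "C1_on_square lam"
    and "\<And>N. 1 \<le> N \<Longrightarrow> ehrenfest_process N lam (M N) (X N)"
    and "\<And>N. 1 \<le> N \<Longrightarrow>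
      prob_space.indep_vars (M N) (\<lambda>_. count_space UNIV) (\<lambda>i \<omega>. X N 0 \<omega> i) {1..N}"
    and "\<And>N i. 1 \<le> N \<Longrightarrow> i \<in> {1..N} \<Longrightarrow>
      poisson_distributed (M N) (\<lambda>\<omega>. X N 0 \<omega> i) (apply_bcontfun \<phi> (pt (real i / real N)))"
  shows "(\<forall>N\<ge>1. empirical_path T N (X N) \<in> measurable (M N) (borel_of (skorokhod T))) \<and>
    (\<exists>!\<mu>. \<mu> \<in> cadlag_paths T \<and> weak_solution lam \<phi> T \<mu>) \<and>
    (\<forall>\<mu>. \<mu> \<in> cadlag_paths T \<and> weak_solution lam \<phi> T \<mu> \<longrightarrow>
      converges_weakly (skorokhod T)
        (\<lambda>N. distr (M N) (borel_of (skorokhod T)) (empirical_path T N (X N)))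
        (return (borel_of (skorokhod T)) \<mu>))"
proof -
  note T = assms(1) and proc = assms(4)
  have cont: "continuous_on ({0..1} \<times> {0..1}) (\<lambda>(x, y). lam x y)"
    by (rule C1_on_square_continuous[OF assms(3)])
  have "compact ((\<lambda>(x, y). lam x y) ` ({0..1} \<times> {0..1}))"
    by (rule compact_continuous_image[OF cont]) (intro compact_Times; simp)
  then obtain \<Lambda> where "\<forall>z\<in>(\<lambda>(x, y). lam x y) ` ({0..1} \<times> {0..1}). norm z \<le> \<Lambda>"
    using compact_imp_bounded bounded_iff by blast
  then interpret urn_rates lam \<Lambda>
    by unfold_locales (use cont in auto)
  have path_eq: "empirical_path T N (X N) = (\<lambda>\<omega>. \<lambda>t\<in>{0..T}. empirical_functional N (X N t \<omega>))" for N
    by (auto simp: empirical_path_def)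
  have meas: "empirical_path T N (X N) \<in> measurable (M N) (borel_of (skorokhod T))" if N: "1 \<le> N" for N
    unfolding path_eq
  proof (rule measurable_step_process[OF T, where E = "urn_states N"])
    show "countable (urn_states N)" unfolding urn_states_def by (intro countable_PiE) auto
  qed (use proc[OF N] in \<open>auto simp: ehrenfest_process_def markov_process_def\<close>)
  define \<mu> where "\<mu> = (\<lambda>t\<in>{0..T}. flow \<phi> t)"
  have \<mu>: "\<mu> \<in> cadlag_paths T" "weak_solution lam \<phi> T \<mu>"
    unfolding \<mu>_def by (rule flow_cadlag, rule flow_weak_solution)
  have unique: "\<nu> = \<mu>" if "\<nu> \<in> cadlag_paths T \<and> weak_solution lam \<phi> T \<nu>" for \<nu>
    using weak_solution_unique[OF T] that \<mu> by blast
  have "converges_weakly (skorokhod T)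
      (\<lambda>N. distr (M N) (borel_of (skorokhod T)) (empirical_path T N (X N)))
      (return (borel_of (skorokhod T)) \<mu>)"
    unfolding converges_weakly_def
  proof (intro allI impI)
    fix G assume G: "continuous_map (skorokhod T) euclideanreal G \<and> bounded (G ` topspace (skorokhod T))"
    have Gm: "G \<in> borel_measurable (borel_of (skorokhod T))"
      using G borel_measurable_continuous_map by blast
    obtain K where K: "\<And>\<xi>. \<xi> \<in> cadlag_paths T \<Longrightarrow> \<bar>G \<xi>\<bar> \<le> K"
      using G by (auto simp: bounded_iff)
    have K0: "0 \<le> K" using K[OF \<mu>(1)] by linarith
    have ret: "(\<integral>\<xi>. G \<xi> \<partial>return (borel_of (skorokhod T)) \<mu>) = G \<mu>"
      using \<mu>(1) Gm by (intro integral_return) (auto simp: space_borel_of)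
    show "(\<lambda>N. \<integral>\<xi>. G \<xi> \<partial>distr (M N) (borel_of (skorokhod T)) (empirical_path T N (X N)))
        \<longlonglongrightarrow> (\<integral>\<xi>. G \<xi> \<partial>return (borel_of (skorokhod T)) \<mu>)"
      unfolding ret
    proof (rule tendstoI)
      fix e :: real assume e: "0 < e"
      \<comment> \<open>Continuity of \<open>G\<close> is used only through this open set: it
        contains a basic neighbourhood of the limit path, which involves finitely many test
        functions.\<close>
      define V where "V = {\<xi> \<in> topspace (skorokhod T). G \<xi> \<in> ball (G \<mu>) (e / 2)}"
      have "openin (skorokhod T) V"
        unfolding V_def by (rule openin_continuous_map_preimage[OF conjunct1[OF G]]) simp
      moreover have "\<mu> \<in> V" using \<mu>(1) e by (simp add: V_def)
      ultimately obtain F \<delta> where F: "finite F" "0 < \<delta>" "skorokhod_nbhd T \<mu> F \<delta> \<subseteq> V"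
        unfolding openin_skorokhod skorokhod_open_def by blast
      \<comment> \<open>Summed over \<open>F\<close> the exceptional sets have probability at most
        \<open>e / (8 * (K + 1))\<close>, so the bound \<open>2 * K\<close> valid there contributes
        less than \<open>e / 4\<close>. Both summands 1 guard against division by 0.\<close>
      define \<eta> where "\<eta> = e / (8 * (K + 1)) / (real (card F) + 1)"
      have \<eta>: "0 < \<eta>" unfolding \<eta>_def using e K0 by simp
      define close where "close N f \<omega> \<longleftrightarrow> (\<forall>s\<in>{0..T}. \<bar>(empirical_functional N (X N s \<omega>)) f -
        (flow \<phi> s) f\<bar> \<le> \<delta> / 2)" for N f \<omega>
      have "\<forall>\<^sub>F N in sequentially. \<forall>f\<in>F. \<exists>B\<in>sets (M N). measure (M N) B \<le> \<eta> \<and>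
        (\<forall>\<omega>\<in>space (M N) - B. close N f \<omega>)"
      proof (rule eventually_ball_finite[OF F(1)], rule ballI)
        fix f
        show "\<forall>\<^sub>F N in sequentially. \<exists>B\<in>sets (M N). measure (M N) B \<le> \<eta> \<and>
          (\<forall>\<omega>\<in>space (M N) - B. close N f \<omega>)"
          unfolding close_def
          by (rule uniform_convergence[OF T proc assms(5) assms(6)[folded sample_def] half_gt_zero[OF F(2)] \<eta>])
      qed
      then show "\<forall>\<^sub>F N in sequentially.
        dist (\<integral>\<xi>. G \<xi> \<partial>distr (M N) (borel_of (skorokhod T)) (empirical_path T N (X N))) (G \<mu>) < e"
        using eventually_ge_at_top[of 1]
      proof eventually_elim
        case (elim N)
        interpret prob_space "M N" using proc[OF elim(2)] by (simp add: ehrenfest_process_def markov_process_def)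
        define \<Xi> where "\<Xi> = empirical_path T N (X N)"
        have \<Xi>m: "\<Xi> \<in> measurable (M N) (borel_of (skorokhod T))" unfolding \<Xi>_def by (rule meas[OF elim(2)])
        have \<Xi>c: "\<Xi> \<omega> \<in> cadlag_paths T" if "\<omega> \<in> space (M N)" for \<omega>
          using measurable_space[OF \<Xi>m that] by (simp add: space_borel_of)
        have "\<forall>f\<in>F. \<exists>B. B \<in> sets (M N) \<and> measure (M N) B \<le> \<eta> \<and>
          (\<forall>\<omega>\<in>space (M N) - B. close N f \<omega>)"
          using elim(1) by blast
        from bchoice[OF this] obtain B where B: "\<forall>f\<in>F. B f \<in> sets (M N) \<and> measure (M N) (B f) \<le> \<eta> \<and>
          (\<forall>\<omega>\<in>space (M N) - B f. close N f \<omega>)" ..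
        define U where "U = (\<Union>f\<in>F. B f)"
        have UM: "U \<in> sets (M N)" unfolding U_def using B F(1) by (intro sets.finite_UN) auto
        have "measure (M N) U \<le> (\<Sum>f\<in>F. measure (M N) (B f))"
          unfolding U_def using B F(1) by (intro measure_UNION_le) auto
        also have "\<dots> \<le> (\<Sum>f\<in>F. \<eta>)" using B by (intro sum_mono) auto
        also have "\<dots> \<le> (real (card F) + 1) * \<eta>" using \<eta> by (simp add: distrib_right)
        also have "\<dots> = e / (8 * (K + 1))"
        proof -
          have "real (card F) + 1 \<noteq> 0" by linarith
          then show ?thesis unfolding \<eta>_def by (metis nonzero_mult_div_cancel_left times_divide_eq_right)
        qed
        finally have U: "measure (M N) U \<le> e / (8 * (K + 1))" .
        have near: "\<bar>G (\<Xi> \<omega>) - G \<mu>\<bar> \<le> e / 2 + 2 * K * indicator U \<omega>" if \<omega>: "\<omega> \<in> space (M N)" for \<omega>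
        proof (cases "\<omega> \<in> U")
          case True
          then show ?thesis using K[OF \<Xi>c[OF \<omega>]] K[OF \<mu>(1)] e by simp
        next
          case False
          have "\<Xi> \<omega> \<in> skorokhod_nbhd T \<mu> F \<delta>"
          proof -
            have lt: "\<bar>blinfun_apply (\<mu> t) f - blinfun_apply (\<Xi> \<omega> t) f\<bar> < \<delta>"
              if t: "t \<in> {0..T}" and f: "f \<in> F" for t f
            proof -
              have "\<bar>(empirical_functional N (X N t \<omega>)) f - (flow \<phi> t) f\<bar> \<le> \<delta> / 2"
                using B f False \<omega> t unfolding U_def close_def by blast
              then show ?thesis
                using t F(2) by (simp add: \<mu>_def \<Xi>_def path_eq abs_minus_commute)
            qed
            \<comment> \<open>The paths are uniformly close for every \<open>f\<close> in
              \<open>F\<close>, so the identity serves as the common time change.\<close>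
            have "(\<lambda>t. t) \<in> time_changes T" by (auto simp: time_changes_def intro: strict_mono_onI)
            with lt \<Xi>c[OF \<omega>] F(2) show ?thesis
              unfolding skorokhod_nbhd_def by (intro CollectI conjI bexI[of _ "\<lambda>t. t"]) auto
          qed
          then have "\<Xi> \<omega> \<in> V" using F(3) by blast
          then have "\<bar>G (\<Xi> \<omega>) - G \<mu>\<bar> < e / 2" by (simp add: V_def dist_real_def abs_minus_commute)
          then show ?thesis using False by simp
        qed
        have int: "integrable (M N) (\<lambda>\<omega>. G (\<Xi> \<omega>))"
          by (rule integrable_const_bound[where B = K])
            (use K \<Xi>c measurable_compose[OF \<Xi>m Gm] in auto)
        have indU: "integrable (M N) (\<lambda>\<omega>. 2 * K * indicator U \<omega> :: real)"
          by (intro integrable_mult_right integrable_real_indicator UM)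
            (simp add: emeasure_eq_measure)
        have "(\<integral>\<xi>. G \<xi> \<partial>distr (M N) (borel_of (skorokhod T)) \<Xi>) - G \<mu> = (\<integral>\<omega>. G (\<Xi> \<omega>) - G \<mu> \<partial>M N)"
          using int by (subst integral_distr[OF \<Xi>m Gm]) (simp add: prob_space)
        also have "\<bar>\<dots>\<bar> \<le> (\<integral>\<omega>. e / 2 + 2 * K * indicator U \<omega> \<partial>M N)"
        proof -
          have "norm (\<integral>\<omega>. G (\<Xi> \<omega>) - G \<mu> \<partial>M N) \<le> (\<integral>\<omega>. norm (G (\<Xi> \<omega>) - G \<mu>) \<partial>M N)"
            by (rule integral_norm_bound)
          also have "\<dots> \<le> (\<integral>\<omega>. e / 2 + 2 * K * indicator U \<omega> \<partial>M N)"
            using int near indU by (intro integral_mono Bochner_Integration.integrable_add) auto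
          finally show ?thesis by simp
        qed
        also have "\<dots> = e / 2 + 2 * K * measure (M N) U"
          using UM indU by (subst Bochner_Integration.integral_add) (auto simp: prob_space)
        also have "\<dots> \<le> e / 2 + 2 * K * (e / (8 * (K + 1)))"
          using U K0 by (intro add_left_mono mult_left_mono) auto
        also have "\<dots> < e" using e K0 by (simp add: field_simps add_pos_nonneg)
        finally show ?case by (simp add: dist_real_def \<Xi>_def)
      qed
    qed
  qed
  then show ?thesis using meas \<mu> unique by blast
qed

end
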